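(* Let $f:\mathbb{R}^2\to\mathbb{R}$ be a Borel function satisfying $$|f(x,y_1)-f(x,y_2)|\le C(1+|x|^p+|y_1|^p+|y_2|^p)|y_1-y_2|\qquad\text{for all }x,y_1,y_2,$$ for some constants $C,p>0$. Assume that $\mathbb{P}((S_T,I_T)\notin\mathscr{D}_f)=0$, with $\mathscr{D}_f:=\{(x,y)\in\mathbb{R}^+\times\mathbb{R}^+ : \partial_2f(x,y)\text{ exists}\}$, where $\partial_2f$ denotes the partial derivative of $f$ with respect to its second variable. Then $$\lim_{n\to\infty}n\,\mathbb{E}\big(f(S_T,I^n_T)-f(S_T,I_T)\big)=\hat{\mathbb{E}}\big(\partial_2f(S_T,I_T)\chi_T\big).$$
   Context: $T>0$, $S_0>0$, and $\sigma>0$, $r$ are real constants. $(W_t)_{t\in[0,T]}$ is a standard Brownian motion on a stochastic basis $\mathcal{B}$, and $S_t=S_0\exp((r-\sigma^2/2)t+\sigma W_t)$. $I_T=\frac1T\int_0^TS_u\,du$. The trapezoidal scheme with $n$ steps is $$I^n_T=\frac{\delta}{T}\sum_{k=1}^nS_{t_{k-1}}\Big(1+\frac{r\delta}{2}+\sigma\frac{W_{t_k}-W_{t_{k-1}}}{2}\Big),\qquad\delta=\frac Tn,\ t_k=k\delta.$$ $\chi_T=\frac{\sigma}{2\sqrt3}\int_0^TS_s\,dB'_s$, where $B'$ is a standard Brownian motion independent of $W$ on an extension $\hat{\mathcal{B}}$ of $\mathcal{B}$; $\hat{\mathbb{E}}$ is expectation on the extension. *)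

theory Defs
  imports "HOL-Probability.Probability"
begin

section \<open>Stochastic bases and Brownian motion\<close>

text \<open>Time is indexed by all reals; only the index set \<open>{0..T}\<close> matters, and a filtration
  on \<open>{0..T}\<close> extends to the reals by being constant to the left of \<open>0\<close> and to the right
  of \<open>T\<close>.\<close>

locale stochastic_basis = prob_space M + filtration "space M" F
  for M :: "'a measure" and F :: "real \<Rightarrow> 'a measure" +
  assumes subalgebra_F: "\<And>t. subalgebra M (F t)"

text \<open>An extension is given by the projection \<open>\<pi>\<close> onto the original space; in the
  product construction \<open>\<pi> = fst\<close>. Random variables \<open>X\<close> on the original basis are read on
  the extension as \<open>\<lambda>\<omega>. X (\<pi> \<omega>)\<close>.\<close>

definition basis_extension ::
  "'a measure \<Rightarrow> (real \<Rightarrow> 'a measure) \<Rightarrow> 'b measure \<Rightarrow> (real \<Rightarrow> 'b measure) \<Rightarrow> ('b \<Rightarrow> 'a) \<Rightarrow> bool" where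
  "basis_extension M F N G \<pi> \<longleftrightarrow>
     stochastic_basis N G \<and>
     \<pi> \<in> measurable N M \<and> distr N M \<pi> = M \<and>
     (\<forall>t. \<pi> \<in> measurable (G t) (F t))"

definition brownian_motion ::
  "'a measure \<Rightarrow> (real \<Rightarrow> 'a measure) \<Rightarrow> real \<Rightarrow> (real \<Rightarrow> 'a \<Rightarrow> real) \<Rightarrow> bool" where
  "brownian_motion M F T W \<longleftrightarrow>
     stochastic_basis M F \<and>
     (\<forall>t\<in>{0..T}. W t \<in> borel_measurable (F t)) \<and>
     (AE \<omega> in M. W 0 \<omega> = 0) \<and>
     (\<forall>\<omega>\<in>space M. continuous_on {0..T} (\<lambda>t. W t \<omega>)) \<and>
     (\<forall>s t. 0 \<le> s \<longrightarrow> s < t \<longrightarrow> t \<le> T \<longrightarrow>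
        distributed M lborel (\<lambda>\<omega>. W t \<omega> - W s \<omega>) (normal_density 0 (sqrt (t - s))) \<and>
        prob_space.indep_set M (sets (F s))
          (sets (vimage_algebra (space M) (\<lambda>\<omega>. W t \<omega> - W s \<omega>) borel)))"

definition indep_processes ::
  "'a measure \<Rightarrow> real \<Rightarrow> (real \<Rightarrow> 'a \<Rightarrow> real) \<Rightarrow> (real \<Rightarrow> 'a \<Rightarrow> real) \<Rightarrow> bool" where
  "indep_processes M T X Y \<longleftrightarrow>
     prob_space.indep_var M
       (\<Pi>\<^sub>M t\<in>{0..T}. borel) (\<lambda>\<omega>. \<lambda>t\<in>{0..T}. X t \<omega>)
       (\<Pi>\<^sub>M t\<in>{0..T}. borel) (\<lambda>\<omega>. \<lambda>t\<in>{0..T}. Y t \<omega>)"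

section \<open>The Ito integral over \<open>{0..T}\<close>\<close>

text \<open>The data \<open>(m, \<tau>, \<xi>)\<close> encode the simple predictable process that equals
  \<open>\<xi> i\<close> on \<open>{\<tau> i<..\<tau> (Suc i)}\<close> for \<open>i < m\<close>.\<close>

definition simple_integrand ::
  "'a measure \<Rightarrow> (real \<Rightarrow> 'a measure) \<Rightarrow> real \<Rightarrow> nat \<Rightarrow> (nat \<Rightarrow> real) \<Rightarrow> (nat \<Rightarrow> 'a \<Rightarrow> real) \<Rightarrow> bool" where
  "simple_integrand M F T m \<tau> \<xi> \<longleftrightarrow>
     0 \<le> \<tau> 0 \<and> (\<forall>i<m. \<tau> i \<le> \<tau> (Suc i)) \<and> \<tau> m \<le> T \<and>
     (\<forall>i<m. \<xi> i \<in> borel_measurable (F (\<tau> i)) \<and> (\<exists>K. \<forall>\<omega>\<in>space M. \<bar>\<xi> i \<omega>\<bar> \<le> K))"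

definition simple_process ::
  "nat \<Rightarrow> (nat \<Rightarrow> real) \<Rightarrow> (nat \<Rightarrow> 'a \<Rightarrow> real) \<Rightarrow> real \<Rightarrow> 'a \<Rightarrow> real" where
  "simple_process m \<tau> \<xi> t \<omega> = (\<Sum>i<m. \<xi> i \<omega> * indicator {\<tau> i<..\<tau> (Suc i)} t)"

definition simple_integral ::
  "(real \<Rightarrow> 'a \<Rightarrow> real) \<Rightarrow> nat \<Rightarrow> (nat \<Rightarrow> real) \<Rightarrow> (nat \<Rightarrow> 'a \<Rightarrow> real) \<Rightarrow> 'a \<Rightarrow> real" where
  "simple_integral B m \<tau> \<xi> \<omega> = (\<Sum>i<m. \<xi> i \<omega> * (B (\<tau> (Suc i)) \<omega> - B (\<tau> i) \<omega>))"

text \<open>\<open>X\<close> is a version of the integral of \<open>H\<close> against \<open>B\<close>: simple processes approximate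
  \<open>H\<close> in \<open>L\<^sup>2(dt \<otimes> P)\<close> and their elementary integrals approximate \<open>X\<close> in \<open>L\<^sup>2(P)\<close>.
  As the integral is only defined up to null sets, this is a relation (like
  \<open>has_integral\<close>) rather than a function.\<close>

definition has_ito_integral ::
  "'a measure \<Rightarrow> (real \<Rightarrow> 'a measure) \<Rightarrow> real \<Rightarrow> (real \<Rightarrow> 'a \<Rightarrow> real) \<Rightarrow> (real \<Rightarrow> 'a \<Rightarrow> real)
     \<Rightarrow> ('a \<Rightarrow> real) \<Rightarrow> bool" where
  "has_ito_integral M F T B H X \<longleftrightarrow>
     (\<lambda>(t, \<omega>). H t \<omega>) \<in> borel_measurable (restrict_space lborel {0..T} \<Otimes>\<^sub>M M) \<and>
     X \<in> borel_measurable M \<and>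
     (\<exists>m \<tau> \<xi>.
        (\<forall>k::nat. simple_integrand M F T (m k) (\<tau> k) (\<xi> k)) \<and>
        (\<lambda>k. \<integral>\<^sup>+ (t, \<omega>). ennreal ((simple_process (m k) (\<tau> k) (\<xi> k) t \<omega> - H t \<omega>)\<^sup>2)
               \<partial>(restrict_space lborel {0..T} \<Otimes>\<^sub>M M)) \<longlonglongrightarrow> 0 \<and>
        (\<lambda>k. \<integral>\<^sup>+ \<omega>. ennreal ((simple_integral B (m k) (\<tau> k) (\<xi> k) \<omega> - X \<omega>)\<^sup>2) \<partial>M) \<longlonglongrightarrow> 0)"

section \<open>The Black-Scholes model, the average and its trapezoidal scheme\<close>

definition stock ::
  "real \<Rightarrow> real \<Rightarrow> real \<Rightarrow> (real \<Rightarrow> 'a \<Rightarrow> real) \<Rightarrow> real \<Rightarrow> 'a \<Rightarrow> real" where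
  "stock S0 r \<sigma> W t \<omega> = S0 * exp ((r - \<sigma>\<^sup>2 / 2) * t + \<sigma> * W t \<omega>)"

definition average ::
  "real \<Rightarrow> real \<Rightarrow> real \<Rightarrow> real \<Rightarrow> (real \<Rightarrow> 'a \<Rightarrow> real) \<Rightarrow> 'a \<Rightarrow> real" where
  "average S0 r \<sigma> T W \<omega> = 1 / T * (LBINT u:{0..T}. stock S0 r \<sigma> W u \<omega>)"

definition trapezoidal ::
  "real \<Rightarrow> real \<Rightarrow> real \<Rightarrow> real \<Rightarrow> (real \<Rightarrow> 'a \<Rightarrow> real) \<Rightarrow> nat \<Rightarrow> 'a \<Rightarrow> real" where
  "trapezoidal S0 r \<sigma> T W n \<omega> =
     (let \<delta> = T / real n; t = (\<lambda>k::nat. real k * \<delta>) in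
      \<delta> / T * (\<Sum>k=1..n. stock S0 r \<sigma> W (t (k - 1)) \<omega> *
                 (1 + r * \<delta> / 2 + \<sigma> * ((W (t k) \<omega> - W (t (k - 1)) \<omega>) / 2))))"

section \<open>The partial derivative in the second variable\<close>

definition partial2 :: "(real \<times> real \<Rightarrow> real) \<Rightarrow> real \<times> real \<Rightarrow> real" where
  "partial2 f = (\<lambda>(x, y). deriv (\<lambda>v. f (x, v)) y)"

definition partial2_domain :: "(real \<times> real \<Rightarrow> real) \<Rightarrow> (real \<times> real) set" where
  "partial2_domain f = {(x, y). 0 < x \<and> 0 < y \<and> (\<lambda>v. f (x, v)) differentiable (at y)}"

end

theory Submission
  imports Defs
begin

text \<open>Both sides of the limit identity vanish. On the right, \<open>\<chi>\<^sub>T\<close> is conditionally centred given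
  \<open>W\<close>: approximating the stock by truncated step functions of \<open>W\<close> and using the Ito isometry, the
  stochastic integral is orthogonal to every square integrable functional of \<open>W\<close>.

  On the left put \<open>U\<^sub>n = n (I\<^sup>n\<^sub>T - I\<^sub>T)\<close>, which is bounded in \<open>L\<^sup>2\<close>. A first order expansion of \<open>f\<close>
  in its second variable, together with moment bounds, reduces the claim to
  \<open>E (g (S\<^sub>T, I\<^sub>T) U\<^sub>n) \<longlonglongrightarrow> 0\<close> for \<open>g = \<partial>\<^sub>2 f\<close>; no central limit theorem is needed. The functions
  \<open>g\<close> with this property are closed in \<open>L\<^sup>2\<close>, so bounded continuous \<open>g\<close> suffice, and for those
  \<open>I\<^sub>T\<close> may be replaced by \<open>I\<^sup>n\<^sub>T\<close>, a function of the grid values of \<open>W\<close>. The leading part of the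
  error on the step \<open>[s, s + \<delta>]\<close> is \<open>\<sigma> S\<^sub>s\<close> times the time integral of
  \<open>(W\<^sub>s\<^sub>+\<^sub>\<delta> - W\<^sub>s) / 2 - (W\<^sub>u - W\<^sub>s)\<close>. It changes sign under time reversal of the path within the
  step, which fixes the grid values and preserves the law of \<open>W\<close>; hence it is orthogonal to all
  functions of the grid. The rest of the error is of order \<open>n\<^sup>-\<^sup>3\<^sup>/\<^sup>2\<close> in \<open>L\<^sup>2\<close>.\<close>

section \<open>Square integrable functions, Gaussian moments and continuous paths\<close>

text \<open>Three obstacles shape the details. The derivative \<open>partial2 f\<close> is only
  Borel, so convergence in law of the error would not by itself give the limit; instead the test
  functions are enlarged from bounded continuous to square integrable ones, which costs only a
  uniform L2 bound on \<open>U n\<close>. Likewise \<open>f\<close> is differentiable only almost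
  surely at the relevant point, so the expansion works with the difference quotient itself: its
  error tends to 0 almost surely and is bounded in L4, hence tends to 0 in L2. Time reversal is
  never carried out on path space. After Fubini in \<open>u\<close>, only one pair of mirrored times
  in a step matters, and reversal then amounts to exchanging two equally long increments on a finite
  grid, which finite-dimensional laws justify. On the extension, independence is known only for the
  product sigma-algebra over \<open>{0..T}\<close>, where a time integral of the path is not
  directly a measurable functional. The average is therefore read as a limit of trapezoidal sums,
  which uses the almost sure convergence of the scheme once more.\<close>

lemma integrable_mult_L2:
  fixes f g :: "'a \<Rightarrow> real"
  assumes [measurable]: "f \<in> borel_measurable M" "g \<in> borel_measurable M"
    and "integrable M (\<lambda>x. (f x)\<^sup>2)" "integrable M (\<lambda>x. (g x)\<^sup>2)"
  shows "integrable M (\<lambda>x. f x * g x)"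
proof (rule Bochner_Integration.integrable_bound)
  show "integrable M (\<lambda>x. (f x)\<^sup>2 + (g x)\<^sup>2)" using assms by simp
  show "AE x in M. norm (f x * g x) \<le> norm ((f x)\<^sup>2 + (g x)\<^sup>2)"
  proof (intro AE_I2)
    fix x
    have "2 * (\<bar>f x\<bar> * \<bar>g x\<bar>) \<le> (f x)\<^sup>2 + (g x)\<^sup>2"
      using sum_squares_bound[of "\<bar>f x\<bar>" "\<bar>g x\<bar>"] by (simp add: mult.assoc)
    moreover have "0 \<le> \<bar>f x\<bar> * \<bar>g x\<bar>" by simp
    ultimately show "norm (f x * g x) \<le> norm ((f x)\<^sup>2 + (g x)\<^sup>2)"
      unfolding real_norm_def abs_mult by linarith
  qed
qed simp

lemma square_add_le: "(a + b)\<^sup>2 \<le> 2 * a\<^sup>2 + 2 * (b::real)\<^sup>2"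
  using sum_squares_bound[of a b] by (simp add: power2_sum)

lemma integrable_add_L2:
  fixes f g :: "'a \<Rightarrow> real"
  assumes [measurable]: "f \<in> borel_measurable M" "g \<in> borel_measurable M"
    and "integrable M (\<lambda>x. (f x)\<^sup>2)" "integrable M (\<lambda>x. (g x)\<^sup>2)"
  shows "integrable M (\<lambda>x. (f x + g x)\<^sup>2)"
  using assms integrable_mult_L2[OF assms]
  by (simp add: power2_sum mult.assoc)

lemma integrable_diff_L2:
  fixes f g :: "'a \<Rightarrow> real"
  assumes "f \<in> borel_measurable M" "g \<in> borel_measurable M"
    and "integrable M (\<lambda>x. (f x)\<^sup>2)" "integrable M (\<lambda>x. (g x)\<^sup>2)"
  shows "integrable M (\<lambda>x. (f x - g x)\<^sup>2)"
  using integrable_add_L2[of f M "\<lambda>x. - g x"] assms by simp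

lemma integrable_sum_L2:
  fixes f :: "'i \<Rightarrow> 'a \<Rightarrow> real"
  assumes "finite I" "\<And>i. i \<in> I \<Longrightarrow> f i \<in> borel_measurable M"
    and "\<And>i. i \<in> I \<Longrightarrow> integrable M (\<lambda>x. (f i x)\<^sup>2)"
  shows "integrable M (\<lambda>x. (\<Sum>i\<in>I. f i x)\<^sup>2)"
  using assms
proof (induction I rule: finite_induct)
  case (insert i I)
  then show ?case by (simp add: integrable_add_L2)
qed simp

lemma integral_square_add_le:
  fixes f g :: "'a \<Rightarrow> real"
  assumes "f \<in> borel_measurable M" "g \<in> borel_measurable M"
    and "integrable M (\<lambda>x. (f x)\<^sup>2)" "integrable M (\<lambda>x. (g x)\<^sup>2)"
  shows "(\<integral>x. (f x + g x)\<^sup>2 \<partial>M) \<le> 2 * (\<integral>x. (f x)\<^sup>2 \<partial>M) + 2 * (\<integral>x. (g x)\<^sup>2 \<partial>M)"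
proof -
  have "(\<integral>x. (f x + g x)\<^sup>2 \<partial>M) \<le> (\<integral>x. 2 * (f x)\<^sup>2 + 2 * (g x)\<^sup>2 \<partial>M)"
    using assms by (intro integral_mono integrable_add_L2 square_add_le) auto
  then show ?thesis using assms by simp
qed

text \<open>The integral of \<open>(f + t g)\<^sup>2\<close> is a nonnegative quadratic polynomial
  in \<open>t\<close>; its value at the minimiser \<open>- C / B\<close> gives the inequality. For
  \<open>B = 0\<close> it is affine in \<open>t\<close>, which forces \<open>C = 0\<close>.\<close>

lemma cauchy_schwarz_integral:
  fixes f g :: "'a \<Rightarrow> real"
  assumes m: "f \<in> borel_measurable M" "g \<in> borel_measurable M"
    and i: "integrable M (\<lambda>x. (f x)\<^sup>2)" "integrable M (\<lambda>x. (g x)\<^sup>2)"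
  shows "(\<integral>x. f x * g x \<partial>M)\<^sup>2 \<le> (\<integral>x. (f x)\<^sup>2 \<partial>M) * (\<integral>x. (g x)\<^sup>2 \<partial>M)"
proof -
  define A B C where "A = (\<integral>x. (f x)\<^sup>2 \<partial>M)" and "B = (\<integral>x. (g x)\<^sup>2 \<partial>M)"
    and "C = (\<integral>x. f x * g x \<partial>M)"
  have fg: "integrable M (\<lambda>x. f x * g x)" by (rule integrable_mult_L2[OF m i])
  have key: "0 \<le> A + 2 * t * C + t\<^sup>2 * B" for t
  proof -
    have "0 \<le> (\<integral>x. (f x + t * g x)\<^sup>2 \<partial>M)" by simp
    also have "\<dots> = (\<integral>x. (f x)\<^sup>2 + 2 * t * (f x * g x) + t\<^sup>2 * (g x)\<^sup>2 \<partial>M)"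
      by (simp add: power2_sum power_mult_distrib algebra_simps)
    also have "\<dots> = A + 2 * t * C + t\<^sup>2 * B"
      unfolding A_def B_def C_def using fg i by simp
    finally show ?thesis .
  qed
  have B0: "B \<ge> 0" unfolding B_def by simp
  show ?thesis
  proof (cases "B = 0")
    case True
    have "C = 0"
    proof (rule ccontr)
      assume "C \<noteq> 0"
      \<comment> \<open>At this \<open>t\<close> the affine function takes the value -1.\<close>
      with key[of "- (A + 1) / (2 * C)"] True show False by (simp add: field_simps)
    qed
    then show ?thesis using True by (simp add: A_def B_def C_def)
  next
    case False
    then have "B > 0" using B0 by simp
    with key[of "- C / B"] have "C\<^sup>2 \<le> A * B"
      by (simp add: field_simps power2_eq_square)
    then show ?thesis by (simp add: A_def B_def C_def)
  qed
qed

text \<open>The form used for error estimates: the second moments enter only through upper bounds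
  \<open>a\<close> and \<open>b\<close>.\<close>

lemma cauchy_schwarz_integral_bound:
  fixes f g :: "'a \<Rightarrow> real"
  assumes m: "f \<in> borel_measurable M" "g \<in> borel_measurable M"
    and i: "integrable M (\<lambda>x. (f x)\<^sup>2)" "integrable M (\<lambda>x. (g x)\<^sup>2)"
    and b: "(\<integral>x. (f x)\<^sup>2 \<partial>M) \<le> a" "(\<integral>x. (g x)\<^sup>2 \<partial>M) \<le> b"
  shows "\<bar>\<integral>x. f x * g x \<partial>M\<bar> \<le> sqrt a * sqrt b"
proof -
  have nn: "0 \<le> (\<integral>x. (f x)\<^sup>2 \<partial>M)" "0 \<le> (\<integral>x. (g x)\<^sup>2 \<partial>M)" by simp_all
  then have "a \<ge> 0" using b(1) by linarith
  have "(\<integral>x. f x * g x \<partial>M)\<^sup>2 \<le> a * b"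
    using cauchy_schwarz_integral[OF m i] mult_mono[OF b \<open>a \<ge> 0\<close> nn(2)] by linarith
  then show ?thesis by (metis real_sqrt_abs real_sqrt_le_iff real_sqrt_mult)
qed

section \<open>Exponential and polynomial moments of centred Gaussian variables\<close>

context prob_space
begin

text \<open>Exponential tilting: completing the square turns the \<open>N(0, v)\<close> density
  times \<open>exp (c * x)\<close> into \<open>exp (c\<^sup>2 * v / 2)\<close> times the
  \<open>N(c * v, v)\<close> density. Moments with an exponential weight are thereby ordinary
  moments of a shifted Gaussian.\<close>

lemma normal_exp_moment:
  assumes D: "distributed M lborel X (normal_density 0 (sqrt v))" and v: "v > 0"
  shows "integrable M (\<lambda>\<omega>. exp (c * X \<omega>))" "expectation (\<lambda>\<omega>. exp (c * X \<omega>)) = exp (c\<^sup>2 * v / 2)"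
    "integrable M X" "expectation X = 0"
    "integrable M (\<lambda>\<omega>. (X \<omega>)\<^sup>2)" "expectation (\<lambda>\<omega>. (X \<omega>)\<^sup>2) = v"
    "integrable M (\<lambda>\<omega>. X \<omega> * exp (c * X \<omega>))"
    "expectation (\<lambda>\<omega>. X \<omega> * exp (c * X \<omega>)) = c * v * exp (c\<^sup>2 * v / 2)"
proof -
  have sv: "0 < sqrt v" using v by simp
  have shift: "normal_density 0 (sqrt v) x * exp (c * x)
      = exp (c\<^sup>2 * v / 2) * normal_density (c * v) (sqrt v) x" for x
  proof -
    have "- x\<^sup>2 / (2 * v) + c * x = c\<^sup>2 * v / 2 + - (x - c * v)\<^sup>2 / (2 * v)"
      using v by (simp add: field_simps power2_eq_square)
    then have "exp (- x\<^sup>2 / (2 * v)) * exp (c * x) = exp (c\<^sup>2 * v / 2) * exp (- (x - c * v)\<^sup>2 / (2 * v))"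
      by (simp flip: exp_add)
    then show ?thesis using v by (simp add: normal_density_def)
  qed
  have shift2: "normal_density 0 (sqrt v) x * (x * exp (c * x))
      = exp (c\<^sup>2 * v / 2) * (normal_density (c * v) (sqrt v) x * x)" for x
    using shift[of x] by (simp add: algebra_simps)
  have I: "integrable M (\<lambda>\<omega>. g (X \<omega>)) \<longleftrightarrow> integrable lborel (\<lambda>x. normal_density 0 (sqrt v) x * g x)"
    if "g \<in> borel_measurable borel" for g :: "real \<Rightarrow> real"
    using that distributed_integrable[OF D, of g] by (simp)
  have E: "expectation (\<lambda>\<omega>. g (X \<omega>)) = (\<integral>x. normal_density 0 (sqrt v) x * g x \<partial>lborel)"
    if "g \<in> borel_measurable borel" for g :: "real \<Rightarrow> real"
    using that distributed_integral[OF D, of g] by (simp)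
  show "integrable M (\<lambda>\<omega>. exp (c * X \<omega>))" by (subst I) (simp_all add: shift integrable_normal_density[OF sv])
  show "expectation (\<lambda>\<omega>. exp (c * X \<omega>)) = exp (c\<^sup>2 * v / 2)" by (subst E) (simp_all add: shift integral_normal_density[OF sv])
  show "integrable M X" using integrable_normal_moment_nz_1[OF sv, of 0] I[of "\<lambda>x. x"] by simp
  show "expectation X = 0" using integral_normal_moment_nz_1[OF sv, of 0] E[of "\<lambda>x. x"] by simp
  show "integrable M (\<lambda>\<omega>. (X \<omega>)\<^sup>2)"
    using integrable_normal_moment[OF sv, of 0 2] I[of "\<lambda>x. x\<^sup>2"] by simp
  show "expectation (\<lambda>\<omega>. (X \<omega>)\<^sup>2) = v"
    using integral_normal_moment_even[OF sv, of 0 1] E[of "\<lambda>x. x\<^sup>2"] v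
    by (simp add: fact_numeral)
  show "integrable M (\<lambda>\<omega>. X \<omega> * exp (c * X \<omega>))"
    using I[of "\<lambda>x. x * exp (c * x)"] integrable_normal_moment_nz_1[OF sv, of "c * v"]
    by (simp add: shift2)
  show "expectation (\<lambda>\<omega>. X \<omega> * exp (c * X \<omega>)) = c * v * exp (c\<^sup>2 * v / 2)"
    using E[of "\<lambda>x. x * exp (c * x)"] integral_normal_moment_nz_1[OF sv, of "c * v"]
    by (simp add: shift2)
qed

end

section \<open>Joint measurability and pathwise integrals of continuous processes\<close>

text \<open>Rounding the time down to a multiple of \<open>1 / Suc k\<close> leaves only countably
  many random variables to glue together, which is jointly measurable; continuity of the paths
  recovers the process as the pointwise limit.\<close>

lemma borel_measurable_continuous_paths:
  fixes X :: "real \<Rightarrow> 'a \<Rightarrow> real"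
  assumes m: "\<And>u. u \<in> {a..b} \<Longrightarrow> X u \<in> borel_measurable M"
    and c: "\<And>\<omega>. \<omega> \<in> space M \<Longrightarrow> continuous_on {a..b} (\<lambda>u. X u \<omega>)"
  shows "(\<lambda>(u, \<omega>). indicator {a..b} u * X u \<omega>) \<in> borel_measurable (lborel \<Otimes>\<^sub>M M)"
proof (cases "a \<le> b")
  case True
  \<comment> \<open>Time is clamped to \<open>{a..b}\<close>, because the rounded time can leave the
    interval even when \<open>u\<close> lies in it.\<close>
  define Y where "Y u \<omega> = X (max a (min b u)) \<omega>" for u \<omega>
  have mY: "Y u \<in> borel_measurable M" for u unfolding Y_def using m True by auto
  have cY: "isCont (\<lambda>u. Y u \<omega>) u" if "\<omega> \<in> space M" for u \<omega>
  proof -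
    have "continuous_on UNIV (\<lambda>u. X (max a (min b u)) \<omega>)"
      by (rule continuous_on_compose2[OF c[OF that]]) (use True in \<open>auto intro!: continuous_intros\<close>)
    then show ?thesis unfolding Y_def by (simp add: continuous_on_eq_continuous_at)
  qed
  define A where "A k z = Y (real_of_int \<lfloor>real (Suc k) * fst z\<rfloor> / real (Suc k)) (snd z)" for k :: nat and z :: "real \<times> 'a"
  have mA: "A k \<in> borel_measurable (lborel \<Otimes>\<^sub>M M)" for k
  proof -
    have "(\<lambda>z. (\<lambda>i::int. \<lambda>z. Y (real_of_int i / real (Suc k)) (snd z)) \<lfloor>real (Suc k) * fst z\<rfloor> z)
        \<in> borel_measurable (lborel \<Otimes>\<^sub>M M)"
    proof (rule measurable_compose_countable[where f="\<lambda>i z. Y (real_of_int i / real (Suc k)) (snd z)"])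
      fix i :: int
      show "(\<lambda>z. Y (real_of_int i / real (Suc k)) (snd z)) \<in> borel_measurable (lborel \<Otimes>\<^sub>M M)"
        using measurable_compose[OF measurable_snd mY] by simp
      show "(\<lambda>z. \<lfloor>real (Suc k) * fst z\<rfloor>) \<in> lborel \<Otimes>\<^sub>M M \<rightarrow>\<^sub>M count_space UNIV"
        by measurable
    qed
    then show ?thesis by (simp add: A_def[abs_def])
  qed
  have lim: "(\<lambda>k. A k z) \<longlonglongrightarrow> Y (fst z) (snd z)" if "z \<in> space (lborel \<Otimes>\<^sub>M M)" for z
  proof -
    have "snd z \<in> space M" using that by (auto simp: space_pair_measure)
    have "(\<lambda>k. real_of_int \<lfloor>real (Suc k) * fst z\<rfloor> / real (Suc k)) \<longlonglongrightarrow> fst z"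
    proof (rule tendsto_sandwich[where f="\<lambda>k. fst z - 1 / real (Suc k)" and h="\<lambda>k. fst z"])
      show "\<forall>\<^sub>F k in sequentially. fst z - 1 / real (Suc k) \<le> real_of_int \<lfloor>real (Suc k) * fst z\<rfloor> / real (Suc k)"
      proof (intro always_eventually allI)
        fix k
        have "real (Suc k) * fst z - 1 \<le> real_of_int \<lfloor>real (Suc k) * fst z\<rfloor>" by linarith
        then have "(real (Suc k) * fst z - 1) / real (Suc k) \<le> real_of_int \<lfloor>real (Suc k) * fst z\<rfloor> / real (Suc k)"
          by (intro divide_right_mono) auto
        then show "fst z - 1 / real (Suc k) \<le> real_of_int \<lfloor>real (Suc k) * fst z\<rfloor> / real (Suc k)"
          by (simp add: diff_divide_distrib)
      qed
      show "\<forall>\<^sub>F k in sequentially. real_of_int \<lfloor>real (Suc k) * fst z\<rfloor> / real (Suc k) \<le> fst z"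
      proof (intro always_eventually allI)
        fix k
        have "real_of_int \<lfloor>real (Suc k) * fst z\<rfloor> / real (Suc k) \<le> (real (Suc k) * fst z) / real (Suc k)"
          by (intro divide_right_mono) auto
        then show "real_of_int \<lfloor>real (Suc k) * fst z\<rfloor> / real (Suc k) \<le> fst z" by simp
      qed
      have "(\<lambda>k. fst z - 1 / real (Suc k)) \<longlonglongrightarrow> fst z - 0"
        by (intro tendsto_diff tendsto_const LIMSEQ_inverse_real_of_nat[unfolded inverse_eq_divide])
      then show "(\<lambda>k. fst z - 1 / real (Suc k)) \<longlonglongrightarrow> fst z" by simp
    qed simp
    then show ?thesis unfolding A_def
      using cY[OF \<open>snd z \<in> space M\<close>, of "fst z"] by (rule isCont_tendsto_compose[rotated])
  qed
  have [measurable]: "(\<lambda>z. Y (fst z) (snd z)) \<in> borel_measurable (lborel \<Otimes>\<^sub>M M)"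
    by (rule borel_measurable_LIMSEQ_real[OF lim mA])
  have "(\<lambda>z. indicator {a..b} (fst z) * Y (fst z) (snd z)) \<in> borel_measurable (lborel \<Otimes>\<^sub>M M)"
    by measurable
  moreover have "(\<lambda>z. indicator {a..b} (fst z) * Y (fst z) (snd z)) = (\<lambda>(u, \<omega>). indicator {a..b} u * X u \<omega>)"
    by (auto simp: Y_def fun_eq_iff indicator_def split: if_splits)
  ultimately show ?thesis by simp
qed simp

lemma borel_measurable_integral_continuous_paths:
  fixes X :: "real \<Rightarrow> 'a \<Rightarrow> real"
  assumes m: "\<And>u. u \<in> {a..b} \<Longrightarrow> X u \<in> borel_measurable M"
    and c: "\<And>\<omega>. \<omega> \<in> space M \<Longrightarrow> continuous_on {a..b} (\<lambda>u. X u \<omega>)"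
  shows "(\<lambda>\<omega>. LBINT u:{a..b}. X u \<omega>) \<in> borel_measurable M"
proof -
  note [measurable] = borel_measurable_continuous_paths[OF m c]
  have "(\<lambda>(\<omega>, u). indicator {a..b} u * X u \<omega>) \<in> borel_measurable (M \<Otimes>\<^sub>M lborel)"
    by (subst measurable_pair_swap_iff)
      (use borel_measurable_continuous_paths[OF m c] in \<open>simp add: split_beta'\<close>)
  then show ?thesis
    unfolding set_lebesgue_integral_def
    by (intro lborel.borel_measurable_lebesgue_integral) (simp add: split_beta')
qed

text \<open>Cauchy-Schwarz against the indicator of the interval, whose square has integral
  \<open>b - a\<close>.\<close>

lemma set_integral_square_le:
  fixes g :: "real \<Rightarrow> real"
  assumes "a \<le> b" and c: "continuous_on {a..b} g"
  shows "(LBINT u:{a..b}. g u)\<^sup>2 \<le> (b - a) * (LBINT u:{a..b}. (g u)\<^sup>2)"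
proof -
  have [simp]: "(indicator {a..b} x * y)\<^sup>2 = indicator {a..b} x * (y::real)\<^sup>2" for x y :: real
    by (auto simp: indicator_def)
  have i1: "set_integrable lborel {a..b} g" 
    by (rule borel_integrable_atLeastAtMost') (rule c)
  have i2: "set_integrable lborel {a..b} (\<lambda>u. (g u)\<^sup>2)"
    by (rule borel_integrable_atLeastAtMost') (intro continuous_intros c)
  have [measurable]: "(\<lambda>x. indicator {a..b} x * g x) \<in> borel_measurable lborel"
    using i1 by (auto simp: set_integrable_def)
  have i3: "integrable lborel (\<lambda>x. (indicator {a..b} x :: real)\<^sup>2)"
  proof -
    have "(\<lambda>x. (indicator {a..b} x :: real)\<^sup>2) = indicator {a..b}"
      by (auto simp: indicator_def)
    then show ?thesis
      using integrable_real_indicator[of "{a..b}" lborel]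
      by (simp del: integrable_indicator_iff add: emeasure_lborel_Icc_eq)
  qed
  have i4: "integrable lborel (\<lambda>x. (indicator {a..b} x * g x)\<^sup>2)"
    using i2 by (simp add: set_integrable_def)
  have "(\<integral>x. indicator {a..b} x * (indicator {a..b} x * g x) \<partial>lborel)\<^sup>2
     \<le> (\<integral>x. (indicator {a..b} x)\<^sup>2 \<partial>lborel) * (\<integral>x. (indicator {a..b} x * g x)\<^sup>2 \<partial>lborel)"
    using i3 i4 by (intro cauchy_schwarz_integral) auto
  moreover have "indicator {a..b} x * (indicator {a..b} x * g x) = indicator {a..b} x * g x" for x
    by (auto simp: indicator_def)
  moreover have "(indicator {a..b} x)\<^sup>2 = (indicator {a..b} x :: real)" for x
    by (auto simp: indicator_def)
  ultimately show ?thesis using \<open>a \<le> b\<close>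
    by (simp add: set_lebesgue_integral_def)
qed

section \<open>Weak convergence in the space of square integrable functions\<close>

lemma integrable_nn_bound:
  fixes f :: "'a \<Rightarrow> real"
  assumes "f \<in> borel_measurable M" "\<And>x. 0 \<le> f x" "(\<integral>\<^sup>+ x. ennreal (f x) \<partial>M) \<le> ennreal K" "0 \<le> K"
  shows "integrable M f" "(\<integral>x. f x \<partial>M) \<le> K"
proof -
  show i: "integrable M f"
    using assms by (intro integrableI_bounded) (auto intro: le_less_trans)
  have "ennreal (\<integral>x. f x \<partial>M) = (\<integral>\<^sup>+ x. ennreal (f x) \<partial>M)"
    using i assms by (intro nn_integral_eq_integral[symmetric]) auto
  then have "ennreal (\<integral>x. f x \<partial>M) \<le> ennreal K" using assms by simp
  then show "(\<integral>x. f x \<partial>M) \<le> K" using assms by (simp add: ennreal_le_iff)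
qed

section \<open>Time integrals of square integrable processes\<close>

context prob_space
begin

text \<open>Cauchy-Schwarz in time holds path by path, and Tonelli exchanges time and expectation.
  Working with nonnegative integrals yields integrability and the bound at once.\<close>

lemma time_integral_L2:
  fixes c :: "real \<Rightarrow> 'a \<Rightarrow> real"
  assumes ab: "a \<le> b"
    and m: "\<And>u. u \<in> {a..b} \<Longrightarrow> c u \<in> borel_measurable M"
    and cont: "\<And>\<omega>. \<omega> \<in> space M \<Longrightarrow> continuous_on {a..b} (\<lambda>u. c u \<omega>)"
    and i: "\<And>u. u \<in> {a..b} \<Longrightarrow> integrable M (\<lambda>\<omega>. (c u \<omega>)\<^sup>2)"
    and k: "\<And>u. u \<in> {a..b} \<Longrightarrow> expectation (\<lambda>\<omega>. (c u \<omega>)\<^sup>2) \<le> \<kappa>"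
  shows "integrable M (\<lambda>\<omega>. (LBINT u:{a..b}. c u \<omega>)\<^sup>2)"
    and "expectation (\<lambda>\<omega>. (LBINT u:{a..b}. c u \<omega>)\<^sup>2) \<le> (b - a)\<^sup>2 * \<kappa>"
proof -
  have k0: "0 \<le> \<kappa>" using k[of a] ab by (intro order_trans[OF _ k[of a]] Bochner_Integration.integral_nonneg) auto
  note mj[measurable] = borel_measurable_continuous_paths[OF m cont]
  have mj': "(\<lambda>z. indicator {a..b} (fst z) * (c (fst z) (snd z))\<^sup>2) \<in> borel_measurable (lborel \<Otimes>\<^sub>M M)"
  proof -
    have "(\<lambda>z. (case z of (u, \<omega>) \<Rightarrow> indicator {a..b} u * c u \<omega>)\<^sup>2) \<in> borel_measurable (lborel \<Otimes>\<^sub>M M)" 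
      using mj by (rule borel_measurable_power)
    moreover have "(\<lambda>z. (case z of (u, \<omega>) \<Rightarrow> indicator {a..b} u * c u \<omega>)\<^sup>2)
       = (\<lambda>z. indicator {a..b} (fst z) * (c (fst z) (snd z))\<^sup>2)"
      by (auto simp: indicator_def fun_eq_iff)
    ultimately show ?thesis by simp
  qed
  interpret P: pair_sigma_finite lborel M ..
  have "(\<integral>\<^sup>+\<omega>. ennreal ((LBINT u:{a..b}. c u \<omega>)\<^sup>2) \<partial>M)
     \<le> (\<integral>\<^sup>+\<omega>. ennreal (b - a) * (\<integral>\<^sup>+u. ennreal (indicator {a..b} u * (c u \<omega>)\<^sup>2) \<partial>lborel) \<partial>M)"
  proof (rule nn_integral_mono)
    fix \<omega> assume w: "\<omega> \<in> space M"
    have i2: "set_integrable lborel {a..b} (\<lambda>u. (c u \<omega>)\<^sup>2)"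
      by (rule borel_integrable_atLeastAtMost') (intro continuous_intros cont w)
    have "ennreal ((LBINT u:{a..b}. c u \<omega>)\<^sup>2) \<le> ennreal ((b - a) * (LBINT u:{a..b}. (c u \<omega>)\<^sup>2))"
      by (intro ennreal_leI set_integral_square_le ab cont w)
    also have "\<dots> = ennreal (b - a) * ennreal (LBINT u:{a..b}. (c u \<omega>)\<^sup>2)"
      using ab unfolding set_lebesgue_integral_def
      by (intro ennreal_mult Bochner_Integration.integral_nonneg) auto
    also have "ennreal (LBINT u:{a..b}. (c u \<omega>)\<^sup>2) = (\<integral>\<^sup>+u. ennreal (indicator {a..b} u * (c u \<omega>)\<^sup>2) \<partial>lborel)"
      unfolding set_lebesgue_integral_def
      using i2 by (subst nn_integral_eq_integral) (auto simp: set_integrable_def)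
    finally show "ennreal ((LBINT u:{a..b}. c u \<omega>)\<^sup>2)
      \<le> ennreal (b - a) * (\<integral>\<^sup>+u. ennreal (indicator {a..b} u * (c u \<omega>)\<^sup>2) \<partial>lborel)" .
  qed
  also have "\<dots> = ennreal (b - a) * (\<integral>\<^sup>+\<omega>. (\<integral>\<^sup>+u. ennreal (indicator {a..b} u * (c u \<omega>)\<^sup>2) \<partial>lborel) \<partial>M)"
  proof (rule nn_integral_cmult)
    have "(\<lambda>z. ennreal (indicator {a..b} (snd z) * (c (snd z) (fst z))\<^sup>2)) \<in> borel_measurable (M \<Otimes>\<^sub>M lborel)"
      using measurable_compose[OF measurable_pair_swap' mj'[THEN measurable_compose[OF _ measurable_ennreal]]]
      by (simp add: split_beta' comp_def)
    then show "(\<lambda>\<omega>. \<integral>\<^sup>+u. ennreal (indicator {a..b} u * (c u \<omega>)\<^sup>2) \<partial>lborel) \<in> borel_measurable M"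
      by (intro lborel.borel_measurable_nn_integral) (simp add: split_beta')
  qed
  also have "(\<integral>\<^sup>+\<omega>. (\<integral>\<^sup>+u. ennreal (indicator {a..b} u * (c u \<omega>)\<^sup>2) \<partial>lborel) \<partial>M)
     = (\<integral>\<^sup>+u. (\<integral>\<^sup>+\<omega>. ennreal (indicator {a..b} u * (c u \<omega>)\<^sup>2) \<partial>M) \<partial>lborel)"
    by (rule P.Fubini') (use mj' in \<open>simp add: split_beta'\<close>)
  also have "\<dots> \<le> (\<integral>\<^sup>+u. ennreal \<kappa> * indicator {a..b} u \<partial>lborel)"
  proof (rule nn_integral_mono)
    fix u :: real
    show "(\<integral>\<^sup>+\<omega>. ennreal (indicator {a..b} u * (c u \<omega>)\<^sup>2) \<partial>M) \<le> ennreal \<kappa> * indicator {a..b} u"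
    proof (cases "u \<in> {a..b}")
      case True
      then have "(\<integral>\<^sup>+\<omega>. ennreal (indicator {a..b} u * (c u \<omega>)\<^sup>2) \<partial>M) = ennreal (expectation (\<lambda>\<omega>. (c u \<omega>)\<^sup>2))"
        using i[OF True] by (simp add: nn_integral_eq_integral)
      then show ?thesis using True k[OF True] by (simp add: ennreal_leI)
    qed simp
  qed
  also have "\<dots> = ennreal \<kappa> * ennreal (b - a)"
    using ab by (simp add: nn_integral_cmult_indicator emeasure_lborel_Icc_eq)
  also have "ennreal (b - a) * (ennreal \<kappa> * ennreal (b - a)) = ennreal ((b - a)\<^sup>2 * \<kappa>)"
    using ab k0 by (simp add: power2_eq_square ennreal_mult[symmetric] mult_ac)
  finally have *: "(\<integral>\<^sup>+\<omega>. ennreal ((LBINT u:{a..b}. c u \<omega>)\<^sup>2) \<partial>M) \<le> ennreal ((b - a)\<^sup>2 * \<kappa>)"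
    by (simp add: mult_left_mono)
  show "integrable M (\<lambda>\<omega>. (LBINT u:{a..b}. c u \<omega>)\<^sup>2)"
    "expectation (\<lambda>\<omega>. (LBINT u:{a..b}. c u \<omega>)\<^sup>2) \<le> (b - a)\<^sup>2 * \<kappa>"
    using * k0 borel_measurable_integral_continuous_paths[OF m cont]
    by (auto intro!: integrable_nn_bound[where K="(b - a)\<^sup>2 * \<kappa>"])
qed

text \<open>Fubini applies because the product of \<open>Z\<close> and \<open>c u\<close> is
  dominated by the sum of their squares, whose expectation is at most \<open>L + \<kappa>\<close> at
  every time of the bounded interval.\<close>

lemma expectation_mult_time_integral:
  fixes c :: "real \<Rightarrow> 'a \<Rightarrow> real"
  assumes ab: "a \<le> b"
    and m: "\<And>u. u \<in> {a..b} \<Longrightarrow> c u \<in> borel_measurable M"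
    and cont: "\<And>\<omega>. \<omega> \<in> space M \<Longrightarrow> continuous_on {a..b} (\<lambda>u. c u \<omega>)"
    and i: "\<And>u. u \<in> {a..b} \<Longrightarrow> integrable M (\<lambda>\<omega>. (c u \<omega>)\<^sup>2)"
    and k: "\<And>u. u \<in> {a..b} \<Longrightarrow> expectation (\<lambda>\<omega>. (c u \<omega>)\<^sup>2) \<le> \<kappa>"
    and Z[measurable]: "Z \<in> borel_measurable M" and Zi: "integrable M (\<lambda>\<omega>. (Z \<omega>)\<^sup>2)"
  shows "expectation (\<lambda>\<omega>. Z \<omega> * (LBINT u:{a..b}. c u \<omega>)) = (LBINT u:{a..b}. expectation (\<lambda>\<omega>. Z \<omega> * c u \<omega>))"
proof -
  interpret P: pair_sigma_finite lborel M ..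
  define L where "L = expectation (\<lambda>\<omega>. (Z \<omega>)\<^sup>2)"
  have L0: "L \<ge> 0" unfolding L_def by simp
  have k0: "0 \<le> \<kappa>" using k[of a] ab by (intro order_trans[OF _ k[of a]] Bochner_Integration.integral_nonneg) auto
  note mj[measurable] = borel_measurable_continuous_paths[OF m cont]
  have mj'[measurable]: "(\<lambda>(u, \<omega>). indicator {a..b} u * (Z \<omega> * c u \<omega>)) \<in> borel_measurable (lborel \<Otimes>\<^sub>M M)"
  proof -
    have "(\<lambda>z. Z (snd z) * (case z of (u, \<omega>) \<Rightarrow> indicator {a..b} u * c u \<omega>)) \<in> borel_measurable (lborel \<Otimes>\<^sub>M M)" 
      by measurable
    then show ?thesis by (simp add: split_beta' mult_ac)
  qed
  have int: "integrable (lborel \<Otimes>\<^sub>M M) (\<lambda>(u, \<omega>). indicator {a..b} u * (Z \<omega> * c u \<omega>))"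
  proof (rule integrableI_bounded)
    have "(\<integral>\<^sup>+z. ennreal (norm (case z of (u, \<omega>) \<Rightarrow> indicator {a..b} u * (Z \<omega> * c u \<omega>))) \<partial>(lborel \<Otimes>\<^sub>M M))
      = (\<integral>\<^sup>+u. (\<integral>\<^sup>+\<omega>. ennreal (norm (indicator {a..b} u * (Z \<omega> * c u \<omega>))) \<partial>M) \<partial>lborel)"
      by (subst nn_integral_fst[symmetric]) (auto simp: split_beta')
    also have "\<dots> \<le> (\<integral>\<^sup>+u. ennreal (L + \<kappa>) * indicator {a..b} u \<partial>lborel)"
    proof (rule nn_integral_mono)
      fix u :: real
      show "(\<integral>\<^sup>+\<omega>. ennreal (norm (indicator {a..b} u * (Z \<omega> * c u \<omega>))) \<partial>M) \<le> ennreal (L + \<kappa>) * indicator {a..b} u"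
      proof (cases "u \<in> {a..b}")
        case True
        have "(\<integral>\<^sup>+\<omega>. ennreal (norm (indicator {a..b} u * (Z \<omega> * c u \<omega>))) \<partial>M)
          \<le> (\<integral>\<^sup>+\<omega>. ennreal ((Z \<omega>)\<^sup>2 + (c u \<omega>)\<^sup>2) \<partial>M)"
        proof (intro nn_integral_mono ennreal_leI)
          fix \<omega>
          have "2 * (\<bar>Z \<omega>\<bar> * \<bar>c u \<omega>\<bar>) \<le> (Z \<omega>)\<^sup>2 + (c u \<omega>)\<^sup>2"
            using sum_squares_bound[of "\<bar>Z \<omega>\<bar>" "\<bar>c u \<omega>\<bar>"] by (simp add: mult.assoc)
          moreover have "0 \<le> \<bar>Z \<omega>\<bar> * \<bar>c u \<omega>\<bar>" by simp
          ultimately have "\<bar>Z \<omega>\<bar> * \<bar>c u \<omega>\<bar> \<le> (Z \<omega>)\<^sup>2 + (c u \<omega>)\<^sup>2" by linarith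
          then show "norm (indicator {a..b} u * (Z \<omega> * c u \<omega>)) \<le> (Z \<omega>)\<^sup>2 + (c u \<omega>)\<^sup>2"
            using True by (simp add: abs_mult)
        qed
        also have "\<dots> = ennreal (L + expectation (\<lambda>\<omega>. (c u \<omega>)\<^sup>2))"
          unfolding L_def using i[OF True] Zi by (subst nn_integral_eq_integral) auto
        also have "\<dots> \<le> ennreal (L + \<kappa>)" using k[OF True] by (intro ennreal_leI) simp
        finally show ?thesis using True by simp
      qed simp
    qed
    also have "\<dots> < \<infinity>"
      using ab by (simp add: nn_integral_cmult_indicator emeasure_lborel_Icc_eq ennreal_mult_less_top)
    finally show "(\<integral>\<^sup>+z. ennreal (norm (case z of (u, \<omega>) \<Rightarrow> indicator {a..b} u * (Z \<omega> * c u \<omega>))) \<partial>(lborel \<Otimes>\<^sub>M M)) < \<infinity>" .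
  qed measurable
  have "expectation (\<lambda>\<omega>. Z \<omega> * (LBINT u:{a..b}. c u \<omega>))
     = (\<integral>\<omega>. (\<integral>u. indicator {a..b} u * (Z \<omega> * c u \<omega>) \<partial>lborel) \<partial>M)"
    unfolding set_lebesgue_integral_def
    by (simp add: mult.left_commute[of _ "Z _"] flip: integral_mult_right_zero)
  also have "\<dots> = (\<integral>u. (\<integral>\<omega>. indicator {a..b} u * (Z \<omega> * c u \<omega>) \<partial>M) \<partial>lborel)"
    by (rule P.Fubini_integral) (use int in simp)
  finally show ?thesis unfolding set_lebesgue_integral_def by simp
qed

section \<open>Enlarging the class of test functions\<close>

text \<open>Replacing \<open>Y\<close> by \<open>V i\<close> changes the expectation by at most the
  L2 distance of the two times \<open>sqrt K\<close>, uniformly in \<open>n\<close>; so the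
  admissible test variables are closed in L2.\<close>

lemma weak_null_closed:
  fixes U :: "nat \<Rightarrow> 'a \<Rightarrow> real"
  assumes U: "\<And>n. U n \<in> borel_measurable M" "\<And>n. integrable M (\<lambda>\<omega>. (U n \<omega>)\<^sup>2)"
    "\<And>n. expectation (\<lambda>\<omega>. (U n \<omega>)\<^sup>2) \<le> K"
    and Y: "Y \<in> borel_measurable M" "integrable M (\<lambda>\<omega>. (Y \<omega>)\<^sup>2)"
    and V: "\<And>i::nat. V i \<in> borel_measurable M" "\<And>i. integrable M (\<lambda>\<omega>. (V i \<omega>)\<^sup>2)"
    and lim: "(\<lambda>i. expectation (\<lambda>\<omega>. (Y \<omega> - V i \<omega>)\<^sup>2)) \<longlonglongrightarrow> 0"
    and w: "\<And>i. (\<lambda>n. expectation (\<lambda>\<omega>. V i \<omega> * U n \<omega>)) \<longlonglongrightarrow> 0"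
  shows "(\<lambda>n. expectation (\<lambda>\<omega>. Y \<omega> * U n \<omega>)) \<longlonglongrightarrow> 0"
proof (rule LIMSEQ_I)
  fix e :: real assume e: "e > 0"
  have "(\<lambda>i. sqrt (expectation (\<lambda>\<omega>. (Y \<omega> - V i \<omega>)\<^sup>2)) * sqrt K) \<longlonglongrightarrow> sqrt 0 * sqrt K"
    by (intro tendsto_intros lim)
  then have "eventually (\<lambda>i. sqrt (expectation (\<lambda>\<omega>. (Y \<omega> - V i \<omega>)\<^sup>2)) * sqrt K < e / 2) sequentially"
    using e by (intro order_tendstoD(2)) auto
  then obtain i where i: "sqrt (expectation (\<lambda>\<omega>. (Y \<omega> - V i \<omega>)\<^sup>2)) * sqrt K < e / 2"
    by (meson eventually_happens' sequentially_bot)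
  obtain N where N: "\<And>n. n \<ge> N \<Longrightarrow> \<bar>expectation (\<lambda>\<omega>. V i \<omega> * U n \<omega>)\<bar> < e / 2"
    using LIMSEQ_D[OF w, of "e / 2" i] e by auto
  have "\<bar>expectation (\<lambda>\<omega>. Y \<omega> * U n \<omega>)\<bar> < e" if "n \<ge> N" for n
  proof -
    have d: "integrable M (\<lambda>\<omega>. (Y \<omega> - V i \<omega>)\<^sup>2)" "(\<lambda>\<omega>. Y \<omega> - V i \<omega>) \<in> borel_measurable M"
      using Y V by (auto intro!: integrable_diff_L2)
    have "expectation (\<lambda>\<omega>. Y \<omega> * U n \<omega>) = expectation (\<lambda>\<omega>. V i \<omega> * U n \<omega> + (Y \<omega> - V i \<omega>) * U n \<omega>)"
      by (simp add: algebra_simps)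
    also have "\<dots> = expectation (\<lambda>\<omega>. V i \<omega> * U n \<omega>) + expectation (\<lambda>\<omega>. (Y \<omega> - V i \<omega>) * U n \<omega>)"
      using d Y V U by (intro Bochner_Integration.integral_add integrable_mult_L2) auto
    finally show ?thesis
      using cauchy_schwarz_integral_bound[OF d(2) U(1) d(1) U(2) order_refl U(3), of n] N[OF that] i
      by linarith
  qed
  then show "\<exists>no. \<forall>n\<ge>no. norm (expectation (\<lambda>\<omega>. Y \<omega> * U n \<omega>) - 0) < e" by auto
qed

text \<open>A monotone class argument in which every passage is a pointwise limit dominated in L2:
  bounded continuous functions approximate indicators of open sets, a Dynkin argument reaches all
  Borel sets, and simple functions reach \<open>g\<close>. This is what allows a merely Borel
  derivative as test function.\<close>

lemma weak_null_of_continuous: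
  fixes U :: "nat \<Rightarrow> 'a \<Rightarrow> real" and X :: "'a \<Rightarrow> 'b::metric_space"
  assumes U: "\<And>n. U n \<in> borel_measurable M" "\<And>n. integrable M (\<lambda>\<omega>. (U n \<omega>)\<^sup>2)"
    "\<And>n. expectation (\<lambda>\<omega>. (U n \<omega>)\<^sup>2) \<le> K"
    and X[measurable]: "X \<in> borel_measurable M"
    and c: "\<And>\<phi>. continuous_on UNIV \<phi> \<Longrightarrow> (\<And>x. \<bar>\<phi> x\<bar> \<le> 1) \<Longrightarrow>
      (\<lambda>n. expectation (\<lambda>\<omega>. \<phi> (X \<omega>) * U n \<omega>)) \<longlonglongrightarrow> 0"
    and g[measurable]: "g \<in> borel_measurable borel" and gi: "integrable M (\<lambda>\<omega>. (g (X \<omega>))\<^sup>2)"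
  shows "(\<lambda>n. expectation (\<lambda>\<omega>. g (X \<omega>) * U n \<omega>)) \<longlonglongrightarrow> 0"
proof -
  let ?P = "\<lambda>g. (\<lambda>n. expectation (\<lambda>\<omega>. g (X \<omega>) * U n \<omega>)) \<longlonglongrightarrow> 0"
  have L2_closed: "?P h" if [measurable]: "h \<in> borel_measurable borel" "\<And>i. V i \<in> borel_measurable borel"
    and "integrable M (\<lambda>\<omega>. (h (X \<omega>))\<^sup>2)" "\<And>i. integrable M (\<lambda>\<omega>. (V i (X \<omega>))\<^sup>2)"
    and "\<And>x. (\<lambda>i. V i x) \<longlonglongrightarrow> h x" "\<And>i x. (h x - V i x)\<^sup>2 \<le> D x" "integrable M (\<lambda>\<omega>. D (X \<omega>))"
    and "\<And>i. ?P (V i)" for h D :: "'b \<Rightarrow> real" and V :: "nat \<Rightarrow> 'b \<Rightarrow> real"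
  proof (rule weak_null_closed[where V="\<lambda>i \<omega>. V i (X \<omega>)", OF U])
    have "(\<lambda>i. expectation (\<lambda>\<omega>. (h (X \<omega>) - V i (X \<omega>))\<^sup>2)) \<longlonglongrightarrow> expectation (\<lambda>\<omega>. 0)"
    proof (rule integral_dominated_convergence[where w="\<lambda>\<omega>. D (X \<omega>)"])
      show "AE x in M. (\<lambda>i. (h (X x) - V i (X x))\<^sup>2) \<longlonglongrightarrow> 0"
      proof (intro AE_I2)
        fix x
        have "(\<lambda>i. (h (X x) - V i (X x))\<^sup>2) \<longlonglongrightarrow> (h (X x) - h (X x))\<^sup>2"
          by (intro tendsto_intros that)
        then show "(\<lambda>i. (h (X x) - V i (X x))\<^sup>2) \<longlonglongrightarrow> 0" by simp
      qed
    qed (use that in auto)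
    then show "(\<lambda>i. expectation (\<lambda>\<omega>. (h (X \<omega>) - V i (X \<omega>))\<^sup>2)) \<longlonglongrightarrow> 0" by simp
  qed (use that in auto)
  have bdd: "integrable M (\<lambda>\<omega>. (h (X \<omega>))\<^sup>2)" if [measurable]: "h \<in> borel_measurable borel"
    and "\<And>x. \<bar>h x\<bar> \<le> 1" for h :: "'b \<Rightarrow> real"
    using that(2) by (intro integrable_const_bound[where B=1])
      (auto simp: abs_square_le_1)
  have one: "?P (\<lambda>x. 1)" by (rule c) auto
  have opn: "?P (indicator S)" if "open S" for S
  \<comment> \<open>The distance to the empty set is 0 by convention, so the approximation below
    would fail for the whole space.\<close>
  proof (cases "S = UNIV")
    case True then show ?thesis using one by simp
  next
    case False
    \<comment> \<open>Lipschitz functions that increase to the indicator of the open set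
      \<open>S\<close>.\<close>
    define \<phi> where "\<phi> i x = min 1 (real i * infdist x (- S))" for i x
    have cphi: "continuous_on UNIV (\<phi> i)" for i
      unfolding \<phi>_def by (intro continuous_intros)
    have bphi: "0 \<le> \<phi> i x" "\<phi> i x \<le> 1" for i x unfolding \<phi>_def by (auto simp: infdist_nonneg)
    have limphi: "(\<lambda>i. \<phi> i x) \<longlonglongrightarrow> indicator S x" for x
    proof (cases "x \<in> S")
      case True
      have "closed (- S)" using \<open>open S\<close> by auto
      then have "infdist x (- S) > 0"
        using True False in_closed_iff_infdist_zero[of "- S" x] infdist_nonneg[of x "- S"] by fastforce
      obtain N where N: "real N > 1 / infdist x (- S)" using reals_Archimedean2 by blast
      have "\<phi> i x = 1" if "i \<ge> N" for i
      proof -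
        have "real i > 1 / infdist x (- S)" using that N by (meson less_le_trans of_nat_le_iff)
        then show ?thesis using \<open>infdist x (- S) > 0\<close> by (simp add: \<phi>_def field_simps)
      qed
      then show ?thesis using True
        by (intro tendsto_eventually) (auto simp: eventually_sequentially)
    next
      case False
      then have "infdist x (- S) = 0" by (simp add: infdist_zero)
      then show ?thesis using False by (simp add: \<phi>_def)
    qed
    have ab: "\<bar>\<phi> i x\<bar> \<le> 1" for i x using bphi[of i x] by simp
    have [measurable]: "\<phi> i \<in> borel_measurable borel" for i
      using cphi by (rule borel_measurable_continuous_onI)
    show ?thesis
    proof (rule L2_closed[of "indicator S" \<phi> "\<lambda>x. 1"])
      show "(indicator S x - \<phi> i x)\<^sup>2 \<le> 1" for i x
        using bphi[of i x] by (auto simp: indicator_def power_le_one abs_square_le_1)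
      show "(indicator S :: 'b \<Rightarrow> real) \<in> borel_measurable borel"
        using \<open>open S\<close> by (intro borel_measurable_indicator) auto
      then show "integrable M (\<lambda>\<omega>. (indicator S (X \<omega>) :: real)\<^sup>2)"
        by (rule bdd) (auto simp: indicator_def)
    qed (use limphi ab in \<open>auto intro!: bdd c cphi\<close>)
  qed
  \<comment> \<open>Open sets form an intersection-stable generator, so it remains to pass to
    complements and countable disjoint unions.\<close>
  have ind: "?P (indicator A)" if "A \<in> sets borel" for A
  proof -
    have "Int_stable {S::'b set. open S}" by (auto simp: Int_stable_def)
    moreover have "{S::'b set. open S} \<subseteq> Pow UNIV" by auto
    moreover have "A \<in> sigma_sets UNIV {S::'b set. open S}" using that by (simp add: borel_def)
    ultimately show ?thesis
    proof (induction rule: sigma_sets_induct_disjoint)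
      case (basic A) then show ?case using opn by auto
    next
      case empty then show ?case by simp
    next
      case (compl A)
      have A[measurable]: "A \<in> sets borel" using compl by (simp add: borel_def)
      have "(\<lambda>n. expectation (\<lambda>\<omega>. 1 * U n \<omega>) - expectation (\<lambda>\<omega>. indicator A (X \<omega>) * U n \<omega>)) \<longlonglongrightarrow> 0 - 0"
        by (intro tendsto_diff compl one)
      moreover have "expectation (\<lambda>\<omega>. 1 * U n \<omega>) - expectation (\<lambda>\<omega>. indicator A (X \<omega>) * U n \<omega>)
        = expectation (\<lambda>\<omega>. indicator (UNIV - A) (X \<omega>) * U n \<omega>)" for n
      proof -
        have "integrable M (\<lambda>\<omega>. indicator A (X \<omega>) * U n \<omega>)"
          using U by (intro integrable_mult_L2 bdd) (auto simp: indicator_def)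
        moreover have "integrable M (\<lambda>\<omega>. 1 * U n \<omega>)"
          using U by (intro integrable_mult_L2) (auto simp: indicator_def)
        moreover have "indicator (UNIV - A) (X \<omega>) * U n \<omega> = 1 * U n \<omega> - indicator A (X \<omega>) * U n \<omega>" for \<omega>
          by (auto simp: indicator_def)
        ultimately show ?thesis by simp
      qed
      ultimately show ?case by simp
    next
      case (union A)
      have A[measurable]: "A i \<in> sets borel" for i using union by (auto simp: borel_def)
      define V where "V m x = (\<Sum>i<m. indicator (A i) x :: real)" for m and x :: 'b
      have Vi: "V m x = indicator (\<Union>i<m. A i) x" for m x
        unfolding V_def using union(1)
        by (subst indicator_UN_disjoint) (auto intro: disjoint_family_on_mono)
      show ?case
      proof (rule L2_closed[of "indicator (\<Union> (range A))" V "\<lambda>x. 1"])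
        show "(\<lambda>i. V i x) \<longlonglongrightarrow> indicator (\<Union> (range A)) x" for x
          unfolding Vi by (rule LIMSEQ_indicator_UN)
        show "(indicator (\<Union> (range A)) x - V m x)\<^sup>2 \<le> 1" for m x
          unfolding Vi by (auto simp: indicator_def)
        show "?P (V m)" for m
        proof -
          have "integrable M (\<lambda>\<omega>. indicator (A i) (X \<omega>) * U n \<omega>)" for i n
            using U by (intro integrable_mult_L2 bdd) (auto simp: indicator_def)
          then have "expectation (\<lambda>\<omega>. V m (X \<omega>) * U n \<omega>) = (\<Sum>i<m. expectation (\<lambda>\<omega>. indicator (A i) (X \<omega>) * U n \<omega>))" for n
            unfolding V_def sum_distrib_right by (intro Bochner_Integration.integral_sum)
          then show ?thesis using union by (simp add: tendsto_null_sum)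
        qed
        show "V i \<in> borel_measurable borel" for i unfolding V_def by measurable
        show "integrable M (\<lambda>\<omega>. (V i (X \<omega>))\<^sup>2)" for i unfolding Vi by (rule bdd) (auto simp: indicator_def)
        show "integrable M (\<lambda>\<omega>. (indicator (\<Union> (range A)) (X \<omega>) :: real)\<^sup>2)" by (rule bdd) (auto simp: indicator_def)
      qed auto
    qed
  qed
  \<comment> \<open>The approximating simple functions satisfy
    \<open>\<bar>s i x\<bar> \<le> 2 * \<bar>g x\<bar>\<close>, hence differ from \<open>g\<close>
    by at most three times its modulus; this is the origin of the factors 4 and 9 below.\<close>
  obtain s where s: "\<And>i. simple_function borel (s i)" "\<And>x. (\<lambda>i. s i x) \<longlonglongrightarrow> g x"
    "\<And>i x. dist (s i x) 0 \<le> 2 * dist (g x) 0"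
    using borel_measurable_implies_sequence_metric[OF g, of 0] by auto
  have sm[measurable]: "s i \<in> borel_measurable borel" for i using s(1) by (rule borel_measurable_simple_function)
  have g4: "integrable M (\<lambda>\<omega>. 4 * (g (X \<omega>))\<^sup>2)" using gi by simp
  have s4: "norm ((s i x)\<^sup>2) \<le> norm (4 * (g x)\<^sup>2)" for i x
  proof -
    have "\<bar>s i x\<bar> \<le> \<bar>2 * g x\<bar>" using s(3)[of i x] by simp
    then show ?thesis by (simp add: abs_le_square_iff power_mult_distrib)
  qed
  have si: "integrable M (\<lambda>\<omega>. (s i (X \<omega>))\<^sup>2)" for i
    by (rule Bochner_Integration.integrable_bound[OF g4]) (use s4 in auto)
  show ?thesis
  proof (rule L2_closed[of g s "\<lambda>x. 9 * (g x)\<^sup>2"])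
    show "(g x - s i x)\<^sup>2 \<le> 9 * (g x)\<^sup>2" for i x
    proof -
      have "\<bar>g x - s i x\<bar> \<le> \<bar>3 * g x\<bar>" using s(3)[of i x] by simp
      then show ?thesis by (simp add: abs_le_square_iff power_mult_distrib)
    qed
    show "?P (s i)" for i
    proof -
      have fin: "finite (range (s i))" using simple_functionD(1)[OF s(1)] by simp
      have eq: "s i x = (\<Sum>y\<in>range (s i). y * indicator (s i -` {y}) x)" for x
        using fin by (simp add: indicator_def if_distrib sum.delta' cong: if_cong)
      have [measurable]: "s i -` {y} \<in> sets borel" for y
        using measurable_sets[OF sm[of i], of "{y}"] by simp
      have "integrable M (\<lambda>\<omega>. indicator (s i -` {y}) (X \<omega>) * U n \<omega>)" for y n
        using U by (intro integrable_mult_L2 bdd) (auto simp: indicator_def)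
      then have "expectation (\<lambda>\<omega>. s i (X \<omega>) * U n \<omega>)
         = (\<Sum>y\<in>range (s i). y * expectation (\<lambda>\<omega>. indicator (s i -` {y}) (X \<omega>) * U n \<omega>))" for n
        by (subst eq) (simp add: sum_distrib_right mult.assoc)
      moreover have "(\<lambda>n. \<Sum>y\<in>range (s i). y * expectation (\<lambda>\<omega>. indicator (s i -` {y}) (X \<omega>) * U n \<omega>)) \<longlonglongrightarrow> 0"
        by (intro tendsto_null_sum tendsto_mult_right_zero ind) simp
      ultimately show ?thesis by simp
    qed
  qed (use s(2) si gi in auto)
qed

end

section \<open>Borel measurability of the partial derivative\<close>

lemma borel_measurable_partial2:
  fixes f :: "real \<times> real \<Rightarrow> real"
  assumes f[measurable]: "f \<in> borel_measurable borel"
    and cont: "\<And>x. continuous_on UNIV (\<lambda>y. f (x, y))"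
  shows "partial2 f \<in> borel_measurable borel"
proof -
  \<comment> \<open>Difference quotients are continuous in \<open>h \<noteq> 0\<close>, so the Cauchy criterion for differentiability
    only needs rational \<open>h\<close>. Where it fails, \<^const>\<open>deriv\<close> is the constant \<open>SOME D. False\<close>.\<close>
  define q where "q h z = (f (fst z, snd z + h) - f z) / h" for h :: real and z :: "real \<times> real"
  have [measurable]: "q h \<in> borel_measurable borel" for h
  proof -
    have "(\<lambda>z. (fst z, snd z + h)) \<in> borel \<rightarrow>\<^sub>M (borel :: (real \<times> real) measure)"
      by (intro borel_measurable_continuous_onI continuous_intros)
    from measurable_compose[OF this f] show ?thesis unfolding q_def[abs_def] by simp
  qed
  define D where "D z \<longleftrightarrow> (\<forall>i::nat. \<exists>j::nat. \<forall>a b::rat. a \<noteq> 0 \<longrightarrow> b \<noteq> 0 \<longrightarrow>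
     \<bar>real_of_rat a\<bar> < 1 / real (Suc j) \<longrightarrow> \<bar>real_of_rat b\<bar> < 1 / real (Suc j) \<longrightarrow>
     \<bar>q (of_rat a) z - q (of_rat b) z\<bar> \<le> 1 / real (Suc i))" for z
  have [measurable]: "Measurable.pred borel D" unfolding D_def by measurable
  have small: "\<exists>i::nat. 1 / real (Suc i) < e" if "e > 0" for e :: real
    using nat_approx_posE[OF that] by metis
  have D_imp: "DERIV (\<lambda>v. f (fst z, v)) (snd z) :> lim (\<lambda>n. q (1 / real (Suc n)) z)" if "D z" for z
  proof -
    define L where "L = lim (\<lambda>n. q (1 / real (Suc n)) z)"
    have rat: "1 / real (Suc n) = real_of_rat (1 / of_nat (Suc n))" for n
      by (simp add: of_rat_divide of_rat_add)
    have less: "\<bar>1 / real (Suc n)\<bar> < 1 / real (Suc j)" if "n > j" for n j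
      using that by (simp add: divide_strict_left_mono)
    have D2: "\<exists>j. \<forall>a b::rat. a \<noteq> 0 \<longrightarrow> b \<noteq> 0 \<longrightarrow>
     \<bar>real_of_rat a\<bar> < 1 / real (Suc j) \<longrightarrow> \<bar>real_of_rat b\<bar> < 1 / real (Suc j) \<longrightarrow>
     \<bar>q (of_rat a) z - q (of_rat b) z\<bar> \<le> e" if "e > 0" for e
      using \<open>D z\<close> small[OF that] unfolding D_def by (meson less_imp_le order_trans)
    have "Cauchy (\<lambda>n. q (1 / real (Suc n)) z)"
    proof (rule CauchyI)
      fix e :: real assume e: "e > 0"
      from D2[of "e / 2"] e obtain j where j: "\<And>a b::rat. a \<noteq> 0 \<Longrightarrow> b \<noteq> 0 \<Longrightarrow>
     \<bar>real_of_rat a\<bar> < 1 / real (Suc j) \<Longrightarrow> \<bar>real_of_rat b\<bar> < 1 / real (Suc j) \<Longrightarrow>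
     \<bar>q (of_rat a) z - q (of_rat b) z\<bar> \<le> e / 2" by auto
      have "\<bar>q (1 / real (Suc m)) z - q (1 / real (Suc n)) z\<bar> < e" if "m > j" "n > j" for m n
        using j[of "1 / of_nat (Suc m)" "1 / of_nat (Suc n)"] less[OF that(1)] less[OF that(2)] e
        unfolding rat by (simp del: of_nat_Suc)
      then show "\<exists>M. \<forall>m\<ge>M. \<forall>n\<ge>M. norm (q (1 / real (Suc m)) z - q (1 / real (Suc n)) z) < e"
        by (intro exI[of _ "Suc j"]) auto
    qed
    then have L: "(\<lambda>n. q (1 / real (Suc n)) z) \<longlonglongrightarrow> L"
      unfolding L_def by (simp add: Cauchy_convergent_iff convergent_LIMSEQ_iff)
    have "(\<lambda>h. q h z) \<midarrow>0\<rightarrow> L"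
    proof (rule LIM_I)
      fix e :: real assume e: "e > 0"
      from D2[of "e / 4"] e obtain j where j: "\<And>a b::rat. a \<noteq> 0 \<Longrightarrow> b \<noteq> 0 \<Longrightarrow>
     \<bar>real_of_rat a\<bar> < 1 / real (Suc j) \<Longrightarrow> \<bar>real_of_rat b\<bar> < 1 / real (Suc j) \<Longrightarrow>
     \<bar>q (of_rat a) z - q (of_rat b) z\<bar> \<le> e / 4" by auto
      have rl: "\<bar>q (of_rat a) z - L\<bar> \<le> e / 4" if "a \<noteq> 0" "\<bar>real_of_rat a\<bar> < 1 / real (Suc j)" for a
      proof (rule tendsto_upperbound)
        show "(\<lambda>n. \<bar>q (of_rat a) z - q (1 / real (Suc n)) z\<bar>) \<longlonglongrightarrow> \<bar>q (of_rat a) z - L\<bar>"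
          by (intro tendsto_intros L)
        show "\<forall>\<^sub>F n in sequentially. \<bar>q (of_rat a) z - q (1 / real (Suc n)) z\<bar> \<le> e / 4"
          using eventually_gt_at_top[of j]
        proof eventually_elim
          case (elim n)
          then show ?case using j[of a "1 / of_nat (Suc n)"] that less[of j n]
            unfolding rat by (simp del: of_nat_Suc)
        qed
      qed simp
      have "\<bar>q h z - L\<bar> < e" if h: "h \<noteq> 0" "\<bar>h\<bar> < 1 / real (Suc j)" for h
      proof -
        have "isCont (\<lambda>h. q h z) h"
        proof -
          have "isCont (\<lambda>h. f (fst z, snd z + h)) h"
            by (rule isCont_o2[where g="\<lambda>y. f (fst z, y)"])
              (use cont[of "fst z"] in \<open>auto simp: continuous_on_eq_continuous_at\<close>)
          then show ?thesis unfolding q_def using h by (intro continuous_intros) auto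
        qed
        then obtain s where s: "s > 0" "\<And>x. \<bar>x - h\<bar> < s \<Longrightarrow> \<bar>q x z - q h z\<bar> < e / 4"
          using e unfolding continuous_at_eps_delta dist_real_def by (metis zero_less_divide_iff zero_less_numeral)
        \<comment> \<open>The rational number is sought in \<open>(h, h + t)\<close>. The three
          bounds on \<open>t\<close> keep it in the range where the quotient changes by less than
          \<open>e / 4\<close>, away from 0, and inside the radius provided by
          \<open>j\<close>.\<close>
        define t where "t = min s (min \<bar>h\<bar> (1 / real (Suc j) - \<bar>h\<bar>))"
        have "t > 0" using s h by (auto simp: t_def)
        then obtain a where a: "h < real_of_rat a" "real_of_rat a < h + t"
          using of_rat_dense[of h "h + t"] by auto
        have "\<bar>real_of_rat a\<bar> < 1 / real (Suc j)" "real_of_rat a \<noteq> 0" "\<bar>real_of_rat a - h\<bar> < s"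
          using a unfolding t_def by linarith+
        moreover from this have "a \<noteq> 0" by auto
        ultimately have "\<bar>q (of_rat a) z - L\<bar> \<le> e / 4" "\<bar>q (of_rat a) z - q h z\<bar> < e / 4"
          using rl s(2) by blast+
        then show ?thesis using e by linarith
      qed
      then show "\<exists>s>0. \<forall>x. x \<noteq> 0 \<and> norm (x - 0) < s \<longrightarrow> norm (q x z - L) < e"
        by (intro exI[of _ "1 / real (Suc j)"]) auto
    qed
    then show ?thesis unfolding DERIV_def L_def[symmetric] by (simp add: prod.collapse q_def)
  qed
  have imp_D: "D z" if "DERIV (\<lambda>v. f (fst z, v)) (snd z) :> L" for z L
    unfolding D_def
  proof
    fix i :: nat
    define e where "e = 1 / real (Suc i)"
    have "e > 0" by (simp add: e_def)
    have "(\<lambda>h. q h z) \<midarrow>0\<rightarrow> L" using that unfolding DERIV_def q_def by (simp add: prod.collapse)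
    from LIM_D[OF this, of "e / 2"] obtain s where s: "s > 0"
      "\<And>x. x \<noteq> 0 \<Longrightarrow> \<bar>x\<bar> < s \<Longrightarrow> \<bar>q x z - L\<bar> < e / 2" using \<open>e > 0\<close> by auto
    obtain j :: nat where j: "1 / real (Suc j) < s" using small[OF s(1)] by auto
    have "\<exists>j. \<forall>a b::rat. a \<noteq> 0 \<longrightarrow> b \<noteq> 0 \<longrightarrow>
     \<bar>real_of_rat a\<bar> < 1 / real (Suc j) \<longrightarrow> \<bar>real_of_rat b\<bar> < 1 / real (Suc j) \<longrightarrow>
     \<bar>q (of_rat a) z - q (of_rat b) z\<bar> \<le> e"
    proof (intro exI[of _ j] allI impI)
      fix a b :: rat assume "a \<noteq> 0" "b \<noteq> 0" "\<bar>real_of_rat a\<bar> < 1 / real (Suc j)" "\<bar>real_of_rat b\<bar> < 1 / real (Suc j)"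
      then have "\<bar>q (of_rat a) z - L\<bar> < e / 2" "\<bar>q (of_rat b) z - L\<bar> < e / 2"
        using j by (auto intro!: s(2)[OF _ less_trans[OF _ j]] simp only: of_rat_eq_0_iff not_False_eq_True)
      then show "\<bar>q (of_rat a) z - q (of_rat b) z\<bar> \<le> e" by linarith
    qed
    then show "\<exists>j. \<forall>a b::rat. a \<noteq> 0 \<longrightarrow> b \<noteq> 0 \<longrightarrow>
     \<bar>real_of_rat a\<bar> < 1 / real (Suc j) \<longrightarrow> \<bar>real_of_rat b\<bar> < 1 / real (Suc j) \<longrightarrow>
     \<bar>q (of_rat a) z - q (of_rat b) z\<bar> \<le> 1 / real (Suc i)" unfolding e_def .
  qed
  have "partial2 f z = (if D z then lim (\<lambda>n. q (1 / real (Suc n)) z) else (SOME D. False))" for z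
  proof (cases "D z")
    case True then show ?thesis using DERIV_imp_deriv[OF D_imp[OF True]] by (simp add: partial2_def split_beta)
  next
    case False
    then have "\<not> (DERIV (\<lambda>v. f (fst z, v)) (snd z) :> L)" for L using imp_D by blast
    then show ?thesis using False by (simp add: partial2_def split_beta deriv_def)
  qed
  then have "partial2 f = (\<lambda>z. if D z then lim (\<lambda>n. q (1 / real (Suc n)) z) else (SOME D. False))" by auto
  moreover have "\<dots> \<in> borel_measurable borel" by measurable
  ultimately show ?thesis by simp
qed

section \<open>Increments of Brownian motion\<close>

locale brownian =
  fixes M :: "'a measure" and F :: "real \<Rightarrow> 'a measure" and T :: real and W :: "real \<Rightarrow> 'a \<Rightarrow> real"
  assumes bm: "brownian_motion M F T W" and T_pos: "0 < T"

sublocale brownian \<subseteq> stochastic_basis M F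
  using bm unfolding brownian_motion_def by blast

context brownian
begin

lemma measurable_F_imp: "X \<in> borel_measurable (F s) \<Longrightarrow> X \<in> borel_measurable M"
  using measurable_from_subalg[OF subalgebra_F] .

lemma measurable_F_mono: "X \<in> borel_measurable (F s) \<Longrightarrow> s \<le> t \<Longrightarrow> X \<in> borel_measurable (F t)"
  using measurable_mono[OF order_refl refl sets_F_mono[of s t]] space_F by (auto simp: subset_iff)

lemma measurable_W_F: "0 \<le> t \<Longrightarrow> t \<le> T \<Longrightarrow> t \<le> s \<Longrightarrow> W t \<in> borel_measurable (F s)"
  using bm measurable_F_mono[of "W t" t s] unfolding brownian_motion_def by auto

lemma measurable_W: "0 \<le> t \<Longrightarrow> t \<le> T \<Longrightarrow> W t \<in> borel_measurable M"
  using measurable_W_F[of t t] measurable_F_imp by auto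

lemma continuous_W: "\<omega> \<in> space M \<Longrightarrow> continuous_on {0..T} (\<lambda>t. W t \<omega>)"
  using bm unfolding brownian_motion_def by auto

lemma AE_W_0: "AE \<omega> in M. W 0 \<omega> = 0"
  using bm unfolding brownian_motion_def by auto

lemma increment_distributed:
  "0 \<le> s \<Longrightarrow> s < t \<Longrightarrow> t \<le> T \<Longrightarrow>
    distributed M lborel (\<lambda>\<omega>. W t \<omega> - W s \<omega>) (normal_density 0 (sqrt (t - s)))"
  using bm unfolding brownian_motion_def by auto

lemma prob_increment:
  assumes "0 \<le> s" "s < t" "t \<le> T" "A \<in> sets (F s)" "B \<in> sets borel"
  shows "prob (A \<inter> {\<omega>\<in>space M. W t \<omega> - W s \<omega> \<in> B}) = prob A * prob {\<omega>\<in>space M. W t \<omega> - W s \<omega> \<in> B}"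
proof -
  have i: "indep_set (sets (F s)) (sets (vimage_algebra (space M) (\<lambda>\<omega>. W t \<omega> - W s \<omega>) borel))"
    using bm assms unfolding brownian_motion_def by auto
  have "{\<omega>\<in>space M. W t \<omega> - W s \<omega> \<in> B} \<in> sets (vimage_algebra (space M) (\<lambda>\<omega>. W t \<omega> - W s \<omega>) borel)"
    unfolding sets_vimage_algebra using assms(5) by (intro sigma_sets.Basic) auto
  then show ?thesis by (rule indep_setD[OF i assms(4)])
qed

lemma indep_increment:
  fixes X :: "'a \<Rightarrow> real"
  assumes st: "0 \<le> s" "s < t" "t \<le> T" and X: "X \<in> borel_measurable (F s)"
  shows "indep_var borel X borel (\<lambda>\<omega>. W t \<omega> - W s \<omega>)"
  unfolding indep_var_eq
proof (intro conjI)
  show "random_variable borel X" using X by (rule measurable_F_imp)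
  show "random_variable borel (\<lambda>\<omega>. W t \<omega> - W s \<omega>)"
    using measurable_W[of s] measurable_W[of t] st by auto
  have i: "indep_set (sets (F s)) (sets (vimage_algebra (space M) (\<lambda>\<omega>. W t \<omega> - W s \<omega>) borel))"
    using bm st unfolding brownian_motion_def by auto
  have "{X -` A \<inter> space (F s) |A. A \<in> sets borel} \<subseteq> sets (F s)"
    using X by (auto intro: measurable_sets)
  then have "sigma_sets (space M) {X -` A \<inter> space M |A. A \<in> sets borel} \<subseteq> sets (F s)"
    using sets.sigma_sets_subset[of _ "F s"] by (simp add: space_F)
  then show "indep_set (sigma_sets (space M) {X -` A \<inter> space M |A. A \<in> sets borel})
     (sigma_sets (space M) {(\<lambda>\<omega>. W t \<omega> - W s \<omega>) -` A \<inter> space M |A. A \<in> sets borel})"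
    using i unfolding indep_sets2_eq sets_vimage_algebra by blast
qed

text \<open>Independence of \<open>X\<close> and the increment factorises the expectation. The empty
  interval \<open>s = t\<close> is included, where the second factor is the constant
  \<open>h 0\<close>, so that time integrands can be treated up to the left end of a step.\<close>

lemma expectation_indep_increment:
  fixes X :: "'a \<Rightarrow> real" and h :: "real \<Rightarrow> real"
  assumes st: "0 \<le> s" "s \<le> t" "t \<le> T" and X: "X \<in> borel_measurable (F s)" "integrable M X"
    and h: "h \<in> borel_measurable borel" "integrable M (\<lambda>\<omega>. h (W t \<omega> - W s \<omega>))"
  shows "integrable M (\<lambda>\<omega>. X \<omega> * h (W t \<omega> - W s \<omega>))"
    and "expectation (\<lambda>\<omega>. X \<omega> * h (W t \<omega> - W s \<omega>)) = expectation X * expectation (\<lambda>\<omega>. h (W t \<omega> - W s \<omega>))"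
proof -
  have "integrable M (\<lambda>\<omega>. X \<omega> * h (W t \<omega> - W s \<omega>)) \<and>
    expectation (\<lambda>\<omega>. X \<omega> * h (W t \<omega> - W s \<omega>)) = expectation X * expectation (\<lambda>\<omega>. h (W t \<omega> - W s \<omega>))"
  proof (cases "s = t")
    case True
    then show ?thesis using X by (simp add: prob_space)
  next
    case False
    then have "indep_var borel X borel (\<lambda>\<omega>. W t \<omega> - W s \<omega>)"
      using st X by (intro indep_increment) auto
    from indep_var_compose[OF this measurable_ident_sets[OF refl] h(1)]
    have "indep_var borel X borel (\<lambda>\<omega>. h (W t \<omega> - W s \<omega>))" by (simp add: comp_def)
    then show ?thesis using X h by (simp add: indep_var_lebesgue_integral indep_var_integrable)
  qed
  then show "integrable M (\<lambda>\<omega>. X \<omega> * h (W t \<omega> - W s \<omega>))"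
    "expectation (\<lambda>\<omega>. X \<omega> * h (W t \<omega> - W s \<omega>)) = expectation X * expectation (\<lambda>\<omega>. h (W t \<omega> - W s \<omega>))" by auto
qed

text \<open>The exponential weights are those that occur in the second moments of stock increments
  and of \<open>hQ\<close>; the mixed weight \<open>x * exp (c * x)\<close> comes from the cross
  term in the square of \<open>hQ\<close>.\<close>

lemma increment_moments:
  assumes st: "0 \<le> s" "s \<le> t" "t \<le> T"
  shows "integrable M (\<lambda>\<omega>. exp (c * (W t \<omega> - W s \<omega>)))"
    "expectation (\<lambda>\<omega>. exp (c * (W t \<omega> - W s \<omega>))) = exp (c\<^sup>2 * (t - s) / 2)"
    "integrable M (\<lambda>\<omega>. W t \<omega> - W s \<omega>)" "expectation (\<lambda>\<omega>. W t \<omega> - W s \<omega>) = 0"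
    "integrable M (\<lambda>\<omega>. (W t \<omega> - W s \<omega>)\<^sup>2)" "expectation (\<lambda>\<omega>. (W t \<omega> - W s \<omega>)\<^sup>2) = t - s"
    "integrable M (\<lambda>\<omega>. (W t \<omega> - W s \<omega>) * exp (c * (W t \<omega> - W s \<omega>)))"
    "expectation (\<lambda>\<omega>. (W t \<omega> - W s \<omega>) * exp (c * (W t \<omega> - W s \<omega>))) = c * (t - s) * exp (c\<^sup>2 * (t - s) / 2)"
proof -
  consider "s = t" | "s < t" using st by linarith
  then have "integrable M (\<lambda>\<omega>. exp (c * (W t \<omega> - W s \<omega>))) \<and>
    expectation (\<lambda>\<omega>. exp (c * (W t \<omega> - W s \<omega>))) = exp (c\<^sup>2 * (t - s) / 2) \<and>
    integrable M (\<lambda>\<omega>. W t \<omega> - W s \<omega>) \<and> expectation (\<lambda>\<omega>. W t \<omega> - W s \<omega>) = 0 \<and>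
    integrable M (\<lambda>\<omega>. (W t \<omega> - W s \<omega>)\<^sup>2) \<and> expectation (\<lambda>\<omega>. (W t \<omega> - W s \<omega>)\<^sup>2) = t - s \<and>
    integrable M (\<lambda>\<omega>. (W t \<omega> - W s \<omega>) * exp (c * (W t \<omega> - W s \<omega>))) \<and>
    expectation (\<lambda>\<omega>. (W t \<omega> - W s \<omega>) * exp (c * (W t \<omega> - W s \<omega>))) = c * (t - s) * exp (c\<^sup>2 * (t - s) / 2)"
  proof cases
    case 1 then show ?thesis by (simp add: prob_space)
  next
    case 2
    then show ?thesis
      using normal_exp_moment(1,2,7,8)[OF increment_distributed[OF st(1) 2 st(3)], of c]
        normal_exp_moment(3-6)[OF increment_distributed[OF st(1) 2 st(3)]] by simp
  qed
  then show "integrable M (\<lambda>\<omega>. exp (c * (W t \<omega> - W s \<omega>)))"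
    "expectation (\<lambda>\<omega>. exp (c * (W t \<omega> - W s \<omega>))) = exp (c\<^sup>2 * (t - s) / 2)"
    "integrable M (\<lambda>\<omega>. W t \<omega> - W s \<omega>)" "expectation (\<lambda>\<omega>. W t \<omega> - W s \<omega>) = 0"
    "integrable M (\<lambda>\<omega>. (W t \<omega> - W s \<omega>)\<^sup>2)" "expectation (\<lambda>\<omega>. (W t \<omega> - W s \<omega>)\<^sup>2) = t - s"
    "integrable M (\<lambda>\<omega>. (W t \<omega> - W s \<omega>) * exp (c * (W t \<omega> - W s \<omega>)))"
    "expectation (\<lambda>\<omega>. (W t \<omega> - W s \<omega>) * exp (c * (W t \<omega> - W s \<omega>))) = c * (t - s) * exp (c\<^sup>2 * (t - s) / 2)"
    by blast+
qed

text \<open>Since \<open>W 0\<close> vanishes only almost surely, the moments of \<open>W t\<close>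
  are read off from the increment over \<open>{0..t}\<close>.\<close>

lemma exp_W_moment:
  assumes "0 \<le> t" "t \<le> T"
  shows "integrable M (\<lambda>\<omega>. exp (c * W t \<omega>))" "expectation (\<lambda>\<omega>. exp (c * W t \<omega>)) = exp (c\<^sup>2 * t / 2)"
proof -
  have [measurable]: "W t \<in> borel_measurable M" "W 0 \<in> borel_measurable M"
    using measurable_W assms T_pos by auto
  have ae: "AE \<omega> in M. exp (c * W t \<omega>) = exp (c * (W t \<omega> - W 0 \<omega>))"
    using AE_W_0 by eventually_elim simp
  show "integrable M (\<lambda>\<omega>. exp (c * W t \<omega>))"
    using increment_moments(1)[of 0 t c] assms by (subst integrable_cong_AE[OF _ _ ae]) auto
  show "expectation (\<lambda>\<omega>. exp (c * W t \<omega>)) = exp (c\<^sup>2 * t / 2)"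
    using increment_moments(2)[of 0 t c] assms by (subst integral_cong_AE[OF _ _ ae]) auto
qed

section \<open>Joint law of finitely many increments and its symmetries\<close>

text \<open>Induction on the number of increments: the event about the first \<open>j\<close> of
  them lies in \<open>F (s j)\<close> and is therefore independent of the next one. Membership in
  the filtration is carried along because the induction step needs it.\<close>

lemma prob_increments_Int:
  fixes s :: "nat \<Rightarrow> real"
  assumes s: "0 \<le> s 0" "\<And>i. i < m \<Longrightarrow> s i < s (Suc i)" "s m \<le> T"
    and A: "\<And>i. i < m \<Longrightarrow> A i \<in> sets borel" and "j \<le> m"
  shows "{\<omega>\<in>space M. \<forall>i<j. W (s (Suc i)) \<omega> - W (s i) \<omega> \<in> A i} \<in> sets (F (s j)) \<and>
    prob {\<omega>\<in>space M. \<forall>i<j. W (s (Suc i)) \<omega> - W (s i) \<omega> \<in> A i}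
     = (\<Prod>i<j. prob {\<omega>\<in>space M. W (s (Suc i)) \<omega> - W (s i) \<omega> \<in> A i})"
  using \<open>j \<le> m\<close>
proof (induction j)
  case 0
  show ?case using sets.top[of "F (s 0)"] unfolding space_F by (simp add: prob_space)
next
  case (Suc j)
  have mono: "s i \<le> s k" if "i \<le> k" "k \<le> m" for i k
    using that
  proof (induction k rule: dec_induct)
    case (step n) then show ?case using s(2)[of n] by linarith
  qed simp
  have b: "0 \<le> s j" "s j < s (Suc j)" "s (Suc j) \<le> T"
    using mono[of 0 j] mono[of "Suc j" m] s(1,3) s(2)[of j] Suc.prems by linarith+
  let ?E = "{\<omega>\<in>space M. \<forall>i<j. W (s (Suc i)) \<omega> - W (s i) \<omega> \<in> A i}"
  let ?B = "{\<omega>\<in>space M. W (s (Suc j)) \<omega> - W (s j) \<omega> \<in> A j}"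
  note IH = Suc.IH[OF Suc_leD[OF Suc.prems]]
  have E: "?E \<in> sets (F (s j))" using IH by (rule conjunct1)
  have m: "(\<lambda>\<omega>. W (s (Suc j)) \<omega> - W (s j) \<omega>) \<in> borel_measurable (F (s (Suc j)))"
    using b by (intro borel_measurable_diff measurable_W_F) linarith+
  have "?B = (\<lambda>\<omega>. W (s (Suc j)) \<omega> - W (s j) \<omega>) -` A j \<inter> space (F (s (Suc j)))"
    using space_F[of "s (Suc j)"] by auto
  also have "\<dots> \<in> sets (F (s (Suc j)))"
    using measurable_sets[OF m A[of j]] Suc.prems by simp
  finally have B: "?B \<in> sets (F (s (Suc j)))" .
  have eq: "{\<omega>\<in>space M. \<forall>i<Suc j. W (s (Suc i)) \<omega> - W (s i) \<omega> \<in> A i} = ?E \<inter> ?B"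
    by (auto simp: less_Suc_eq)
  have "?E \<in> sets (F (s (Suc j)))" using E sets_F_mono[of "s j" "s (Suc j)"] b(2) by (meson less_imp_le subsetD)
  then have "?E \<inter> ?B \<in> sets (F (s (Suc j)))" using B by (rule sets.Int)
  moreover have "prob (?E \<inter> ?B) = prob ?E * prob ?B"
    using Suc.prems by (intro prob_increment b E A) simp
  ultimately show ?case
    unfolding eq prod.lessThan_Suc IH[THEN conjunct2, symmetric] by (rule conjI)
qed

lemma prob_increment_eq:
  assumes "0 \<le> s" "s < t" "t \<le> T" "0 \<le> s'" "s' < t'" "t' \<le> T" "t - s = t' - s'" "B \<in> sets borel"
  shows "prob {\<omega>\<in>space M. W t \<omega> - W s \<omega> \<in> B} = prob {\<omega>\<in>space M. W t' \<omega> - W s' \<omega> \<in> B}"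
proof -
  have "distr M lborel (\<lambda>\<omega>. W t \<omega> - W s \<omega>) = distr M lborel (\<lambda>\<omega>. W t' \<omega> - W s' \<omega>)"
    using increment_distributed[OF assms(1-3)] increment_distributed[OF assms(4-6)] assms(7)
    by (simp add: distributed_distr_eq_density)
  then have "measure (distr M lborel (\<lambda>\<omega>. W t \<omega> - W s \<omega>)) B = measure (distr M lborel (\<lambda>\<omega>. W t' \<omega> - W s' \<omega>)) B" by simp
  moreover have [measurable]: "W s \<in> borel_measurable M" "W t \<in> borel_measurable M"
    "W s' \<in> borel_measurable M" "W t' \<in> borel_measurable M"
    using assms by (auto intro!: measurable_W)
  moreover have "f -` B \<inter> space M = {\<omega>\<in>space M. f \<omega> \<in> B}" for f :: "'a \<Rightarrow> real" by auto
  ultimately show ?thesis using assms(8)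
    by (simp add: measure_distr)
qed

text \<open>The joint law is a product of one-dimensional laws that depend only on the interval
  lengths, so permuting two intervals of equal length preserves it. The functional
  \<open>\<Psi>\<close> of the whole vector lets the symmetry be applied to grid values, which are
  partial sums.\<close>

lemma increments_exchangeable:
  fixes s :: "nat \<Rightarrow> real" and \<Psi> :: "(nat \<Rightarrow> real) \<Rightarrow> real"
  assumes s: "0 \<le> s 0" "\<And>i. i < m \<Longrightarrow> s i < s (Suc i)" "s m \<le> T"
    and pq: "p < m" "q < m" "s (Suc p) - s p = s (Suc q) - s q"
    and \<Psi>: "\<Psi> \<in> borel_measurable (\<Pi>\<^sub>M i\<in>{..<m}. borel)"
  shows "expectation (\<lambda>\<omega>. \<Psi> (\<lambda>i\<in>{..<m}. W (s (Suc i)) \<omega> - W (s i) \<omega>))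
    = expectation (\<lambda>\<omega>. \<Psi> (\<lambda>i\<in>{..<m}. W (s (Suc (Transposition.transpose p q i))) \<omega> - W (s (Transposition.transpose p q i)) \<omega>))"
proof -
  define X where "X i \<omega> = W (s (Suc i)) \<omega> - W (s i) \<omega>" for i \<omega>
  let ?\<tau> = "Transposition.transpose p q"
  have tm: "?\<tau> i < m \<longleftrightarrow> i < m" for i using pq by (auto simp: Transposition.transpose_def)
  have bij: "bij_betw ?\<tau> {..<m} {..<m}"
    by (rule bij_betw_byWitness[where f'="?\<tau>"]) (auto simp: tm)
  have mono: "s i \<le> s k" if "i \<le> k" "k \<le> m" for i k
    using that
  proof (induction k rule: dec_induct)
    case (step n) then show ?case using s(2)[of n] by linarith
  qed simp
  have b: "0 \<le> s i" "s i < s (Suc i)" "s (Suc i) \<le> T" if "i < m" for i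
    using mono[of 0 i] mono[of "Suc i" m] s(1,3) s(2)[of i] that by linarith+
  have Xm[measurable]: "X i \<in> borel_measurable M" if "i < m" for i
    unfolding X_def using b[OF that] measurable_W[of "s i"] measurable_W[of "s (Suc i)"] by auto
  define L1 where "L1 = distr M (\<Pi>\<^sub>M i\<in>{..<m}. borel) (\<lambda>\<omega>. \<lambda>i\<in>{..<m}. X i \<omega>)"
  define L2 where "L2 = distr M (\<Pi>\<^sub>M i\<in>{..<m}. borel) (\<lambda>\<omega>. \<lambda>i\<in>{..<m}. X (?\<tau> i) \<omega>)"
  have m1: "(\<lambda>\<omega>. \<lambda>i\<in>{..<m}. X i \<omega>) \<in> M \<rightarrow>\<^sub>M (\<Pi>\<^sub>M i\<in>{..<m}. borel)"
    by (rule measurable_restrict) (simp add: Xm)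
  have m2: "(\<lambda>\<omega>. \<lambda>i\<in>{..<m}. X (?\<tau> i) \<omega>) \<in> M \<rightarrow>\<^sub>M (\<Pi>\<^sub>M i\<in>{..<m}. borel)"
    by (rule measurable_restrict) (simp add: Xm tm)
  interpret L1: prob_space L1 unfolding L1_def by (rule prob_space_distr[OF m1])
  have "L1 = L2"
  \<comment> \<open>Rectangles determine the law; the whole space alone serves as exhausting
    sequence because the measures are finite.\<close>
  proof (rule measure_eqI_PiM_finite[where I="{..<m}" and M="\<lambda>_. borel" and A="\<lambda>_. space (\<Pi>\<^sub>M i\<in>{..<m}. (borel :: real measure))"])
    fix A :: "nat \<Rightarrow> real set" assume "\<And>i. i \<in> {..<m} \<Longrightarrow> A i \<in> sets borel"
    then have A: "A i \<in> sets borel" if "i < m" for i using that by auto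
    have A2: "A (?\<tau> i) \<in> sets borel" if "i < m" for i using A tm that by blast
    have sA: "Pi\<^sub>E {..<m} A \<in> sets (\<Pi>\<^sub>M i\<in>{..<m}. borel)" using A by (intro sets_PiM_I_finite) auto
    have vX: "(\<lambda>\<omega>. \<lambda>i\<in>{..<m}. Y i \<omega>) -` Pi\<^sub>E {..<m} A \<inter> space M = {\<omega>\<in>space M. \<forall>i<m. Y i \<omega> \<in> A i}" for Y
      unfolding PiE_iff vimage_def by (simp add: Int_def extensional_restrict conj_commute Ball_def)
    have "emeasure L1 (Pi\<^sub>E {..<m} A) = prob {\<omega>\<in>space M. \<forall>i<m. X i \<omega> \<in> A i}"
      unfolding L1_def emeasure_distr[OF m1 sA] emeasure_eq_measure
      by (rule arg_cong[where f="\<lambda>S. ennreal (prob S)"]) (rule vX)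
    also have "\<dots> = (\<Prod>i<m. prob {\<omega>\<in>space M. X i \<omega> \<in> A i})"
      unfolding X_def by (rule arg_cong[where f=ennreal], rule prob_increments_Int[where s=s, THEN conjunct2]) (rule s order_refl A | assumption)+
    also have "(\<Prod>i<m. prob {\<omega>\<in>space M. X i \<omega> \<in> A i}) = (\<Prod>i<m. prob {\<omega>\<in>space M. X (?\<tau> i) \<omega> \<in> A (?\<tau> i)})"
      by (rule prod.reindex_bij_betw[OF bij, symmetric])
    also have "\<dots> = (\<Prod>i<m. prob {\<omega>\<in>space M. X i \<omega> \<in> A (?\<tau> i)})"
    proof (rule prod.cong)
      fix i assume "i \<in> {..<m}"
      then show "prob {\<omega>\<in>space M. X (?\<tau> i) \<omega> \<in> A (?\<tau> i)} = prob {\<omega>\<in>space M. X i \<omega> \<in> A (?\<tau> i)}"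
        unfolding X_def using pq A2[of i] tm[of i]
        by (intro prob_increment_eq b) (auto simp: Transposition.transpose_def)
    qed simp
    also have "\<dots> = prob {\<omega>\<in>space M. \<forall>i<m. X i \<omega> \<in> A (?\<tau> i)}"
      unfolding X_def by (rule prob_increments_Int[where s=s and m=m and j=m and A="\<lambda>i. A (?\<tau> i)", OF s A2 order_refl, THEN conjunct2, symmetric])
    also have "{\<omega>\<in>space M. \<forall>i<m. X i \<omega> \<in> A (?\<tau> i)} = {\<omega>\<in>space M. \<forall>i<m. X (?\<tau> i) \<omega> \<in> A i}"
    proof (intro Collect_cong conj_cong refl iffI allI impI)
      fix \<omega> i assume "\<forall>i<m. X i \<omega> \<in> A (?\<tau> i)" "i < m"
      then have "X (?\<tau> i) \<omega> \<in> A (?\<tau> (?\<tau> i))" using tm by blast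
      then show "X (?\<tau> i) \<omega> \<in> A i" by simp
    next
      fix \<omega> i assume "\<forall>i<m. X (?\<tau> i) \<omega> \<in> A i" "i < m"
      then have "X (?\<tau> (?\<tau> i)) \<omega> \<in> A (?\<tau> i)" using tm by blast
      then show "X i \<omega> \<in> A (?\<tau> i)" by simp
    qed
    also have "ennreal (prob {\<omega>\<in>space M. \<forall>i<m. X (?\<tau> i) \<omega> \<in> A i}) = emeasure L2 (Pi\<^sub>E {..<m} A)"
      unfolding L2_def emeasure_distr[OF m2 sA] emeasure_eq_measure
      by (rule arg_cong[where f="\<lambda>S. ennreal (prob S)"]) (rule vX[symmetric])
    finally show "emeasure L1 (Pi\<^sub>E {..<m} A) = emeasure L2 (Pi\<^sub>E {..<m} A)" .
  next
    have "Pi\<^sub>E {..<m} (\<lambda>_. space (borel :: real measure)) \<in> prod_algebra {..<m} (\<lambda>_. borel)"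
      by (rule prod_algebraI_finite, rule finite_lessThan, rule ballI, rule sets.top)
    then show "range (\<lambda>_. space (\<Pi>\<^sub>M i\<in>{..<m}. (borel :: real measure))) \<subseteq> prod_algebra {..<m} (\<lambda>_. borel)"
      unfolding space_PiM by blast
    show "(\<Union>i::nat. space (\<Pi>\<^sub>M i\<in>{..<m}. (borel :: real measure))) = space (\<Pi>\<^sub>M i\<in>{..<m}. borel)"
      by simp
    show "emeasure L1 (space (\<Pi>\<^sub>M i\<in>{..<m}. (borel :: real measure))) \<noteq> \<infinity>"
      by (simp add: L1.emeasure_eq_measure)
    show "sets L1 = sets (\<Pi>\<^sub>M i\<in>{..<m}. (borel :: real measure))" by (simp only: L1_def sets_distr)
    show "sets L2 = sets (\<Pi>\<^sub>M i\<in>{..<m}. (borel :: real measure))" by (simp only: L2_def sets_distr)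
  qed (simp only: finite_lessThan)
  then have "(\<integral>x. \<Psi> x \<partial>L1) = (\<integral>x. \<Psi> x \<partial>L2)" by simp
  moreover have "(\<integral>x. \<Psi> x \<partial>L1) = expectation (\<lambda>\<omega>. \<Psi> (\<lambda>i\<in>{..<m}. X i \<omega>))"
    unfolding L1_def by (rule integral_distr[OF m1 \<Psi>])
  moreover have "(\<integral>x. \<Psi> x \<partial>L2) = expectation (\<lambda>\<omega>. \<Psi> (\<lambda>i\<in>{..<m}. X (?\<tau> i) \<omega>))"
    unfolding L2_def by (rule integral_distr[OF m2 \<Psi>])
  ultimately show ?thesis unfolding X_def by metis
qed

text \<open>Reversing the path on step \<open>k\<close> maps the increment over its first
  \<open>v\<close> time units to the one over its last \<open>v\<close> units and fixes all grid
  values. For a single \<open>v\<close> this is an exchange of two increments;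
  \<open>v < \<delta> / 2\<close> leaves a nonempty interval between them. Values are taken relative
  to \<open>W 0\<close>, since only increments are exchanged.\<close>

lemma grid_functional_swap:
  fixes \<Phi> :: "(nat \<Rightarrow> real) \<Rightarrow> real"
  assumes \<delta>: "0 < \<delta>" "real n * \<delta> \<le> T" and k: "k < n" and v: "0 < v" "v < \<delta> / 2"
    and \<Phi>: "\<Phi> \<in> borel_measurable (\<Pi>\<^sub>M i\<in>{..n}. borel)"
  shows "expectation (\<lambda>\<omega>. \<Phi> (\<lambda>j\<in>{..n}. W (real j * \<delta>) \<omega> - W 0 \<omega>) * (W (real k * \<delta> + v) \<omega> - W (real k * \<delta>) \<omega>))
    = expectation (\<lambda>\<omega>. \<Phi> (\<lambda>j\<in>{..n}. W (real j * \<delta>) \<omega> - W 0 \<omega>) *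
       (W (real (Suc k) * \<delta>) \<omega> - W (real (Suc k) * \<delta> - v) \<omega>))"
proof -
  \<comment> \<open>The grid refined by \<open>t\<^sub>k + v\<close> and its mirror image \<open>t\<^sub>k\<^sub>+\<^sub>1 - v\<close>; \<open>ix j\<close> is the index of \<open>t\<^sub>j\<close> in it.
    Partial sums up to \<open>ix j\<close> contain both or none of the increments \<open>k\<close> and \<open>k + 2\<close>, so exchanging
    these two does not affect the grid values.\<close>
  define s where "s i = (if i \<le> k then real i * \<delta> else if i = k + 1 then real k * \<delta> + v
    else if i = k + 2 then real (Suc k) * \<delta> - v else (real i - 2) * \<delta>)" for i :: nat
  define ix where "ix j = (if j \<le> k then j else j + 2)" for j :: nat
  have six: "s (ix j) = real j * \<delta>" for j unfolding s_def ix_def by auto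
  have s0: "s 0 = 0" unfolding s_def by simp
  have sinc: "s i < s (Suc i)" for i
  proof -
    consider "Suc i \<le> k" | "i = k" | "i = k + 1" | "i = k + 2" | "i > k + 2" by linarith
    then show ?thesis
    proof cases
      case 1 then show ?thesis using \<delta> by (simp add: s_def)
    next
      case 2 then show ?thesis using \<delta> v by (simp add: s_def)
    next
      case 3 then show ?thesis using \<delta> v by (simp add: s_def algebra_simps)
    next
      case 4 then show ?thesis using \<delta> v by (simp add: s_def algebra_simps)
    next
      case 5 then show ?thesis using \<delta> v by (simp add: s_def algebra_simps)
    qed
  qed
  have sm: "s (n + 2) \<le> T" using k \<delta> six[of n] by (simp add: ix_def)
  \<comment> \<open>Grid values are recovered as partial sums of the refined increments. The factor
    \<open>x k\<close> is the increment over the first \<open>v\<close> time units, and the exchange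
    turns it into increment \<open>k + 2\<close>.\<close>
  define \<Psi> where "\<Psi> x = \<Phi> (\<lambda>j\<in>{..n}. \<Sum>l<ix j. x l) * x k" for x :: "nat \<Rightarrow> real"
  have \<Psi>m: "\<Psi> \<in> borel_measurable (\<Pi>\<^sub>M i\<in>{..<n+2}. borel)"
  proof -
    have [measurable]: "(\<lambda>x. x l) \<in> borel_measurable (\<Pi>\<^sub>M i\<in>{..<n+2}. (borel :: real measure))" if "l < n + 2" for l
      using that by (intro measurable_component_singleton) auto
    have "(\<lambda>x. \<lambda>j\<in>{..n}. \<Sum>l<ix j. x l) \<in> (\<Pi>\<^sub>M i\<in>{..<n+2}. (borel :: real measure)) \<rightarrow>\<^sub>M (\<Pi>\<^sub>M i\<in>{..n}. borel)"
    proof (rule measurable_restrict)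
      fix j assume "j \<in> {..n}"
      then show "(\<lambda>x. \<Sum>l<ix j. x l) \<in> borel_measurable (\<Pi>\<^sub>M i\<in>{..<n+2}. (borel :: real measure))"
        by (intro borel_measurable_sum measurable_component_singleton) (auto simp: ix_def split: if_splits)
    qed
    from measurable_compose[OF this \<Phi>] show ?thesis
      unfolding \<Psi>_def[abs_def] using k
      by (intro borel_measurable_times measurable_component_singleton) auto
  qed
  have "expectation (\<lambda>\<omega>. \<Psi> (\<lambda>i\<in>{..<n+2}. W (s (Suc i)) \<omega> - W (s i) \<omega>))
    = expectation (\<lambda>\<omega>. \<Psi> (\<lambda>i\<in>{..<n+2}. W (s (Suc (Transposition.transpose k (k+2) i))) \<omega> - W (s (Transposition.transpose k (k+2) i)) \<omega>))"
  proof (rule increments_exchangeable[OF _ sinc sm _ _ _ \<Psi>m])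
    show "s (Suc k) - s k = s (Suc (k + 2)) - s (k + 2)" by (simp add: s_def algebra_simps)
  qed (use k in \<open>simp_all add: s0\<close>)
  moreover have "\<Psi> (\<lambda>i\<in>{..<n+2}. W (s (Suc i)) \<omega> - W (s i) \<omega>)
    = \<Phi> (\<lambda>j\<in>{..n}. W (real j * \<delta>) \<omega> - W 0 \<omega>) * (W (real k * \<delta> + v) \<omega> - W (real k * \<delta>) \<omega>)" for \<omega>
  proof -
    have "(\<Sum>l<ix j. (\<lambda>i\<in>{..<n+2}. W (s (Suc i)) \<omega> - W (s i) \<omega>) l) = W (real j * \<delta>) \<omega> - W 0 \<omega>" if "j \<le> n" for j
    proof -
      have "(\<Sum>l<ix j. (\<lambda>i\<in>{..<n+2}. W (s (Suc i)) \<omega> - W (s i) \<omega>) l) = (\<Sum>l<ix j. W (s (Suc l)) \<omega> - W (s l) \<omega>)"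
        using that by (intro sum.cong) (auto simp: ix_def split: if_splits)
      also have "\<dots> = W (s (ix j)) \<omega> - W (s 0) \<omega>" by (rule sum_lessThan_telescope)
      finally show ?thesis by (simp add: six s0)
    qed
    moreover have "s (Suc k) = real k * \<delta> + v" "s k = real k * \<delta>" by (auto simp: s_def)
    ultimately show ?thesis using k unfolding \<Psi>_def
      by (auto intro!: arg_cong[where f=\<Phi>] simp: restrict_def fun_eq_iff)
  qed
  moreover have "\<Psi> (\<lambda>i\<in>{..<n+2}. W (s (Suc (Transposition.transpose k (k+2) i))) \<omega> - W (s (Transposition.transpose k (k+2) i)) \<omega>)
    = \<Phi> (\<lambda>j\<in>{..n}. W (real j * \<delta>) \<omega> - W 0 \<omega>) * (W (real (Suc k) * \<delta>) \<omega> - W (real (Suc k) * \<delta> - v) \<omega>)" for \<omega>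
  proof -
    let ?f = "\<lambda>i. W (s (Suc i)) \<omega> - W (s i) \<omega>"
    have "(\<Sum>l<ix j. (\<lambda>i\<in>{..<n+2}. ?f (Transposition.transpose k (k+2) i)) l) = W (real j * \<delta>) \<omega> - W 0 \<omega>" if "j \<le> n" for j
    proof -
      have "(\<Sum>l<ix j. (\<lambda>i\<in>{..<n+2}. ?f (Transposition.transpose k (k+2) i)) l) = (\<Sum>l<ix j. ?f (Transposition.transpose k (k+2) l))"
        using that by (intro sum.cong) (auto simp: ix_def split: if_splits)
      also have "\<dots> = (\<Sum>l<ix j. ?f l)"
        by (rule sum.reindex_bij_betw, rule bij_betw_byWitness[where f'="Transposition.transpose k (k+2)"])
          (auto simp: ix_def Transposition.transpose_def split: if_splits)
      also have "\<dots> = W (s (ix j)) \<omega> - W (s 0) \<omega>" by (rule sum_lessThan_telescope)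
      finally show ?thesis by (simp add: six s0)
    qed
    moreover have "s (Suc (k + 2)) = real (Suc k) * \<delta>" "s (k + 2) = real (Suc k) * \<delta> - v"
      by (auto simp: s_def)
    ultimately show ?thesis using k unfolding \<Psi>_def
      by (auto intro!: arg_cong[where f=\<Phi>] simp: restrict_def fun_eq_iff)
  qed
  ultimately show ?thesis by simp
qed

end

section \<open>Errors on a single time step\<close>

text \<open>The substitution \<open>u \<mapsto> a + b - u\<close> turns the integral into its
  negative. The midpoint is exempt, being a null set, because the exchange of increments is
  available only for \<open>v < \<delta> / 2\<close>.\<close>

lemma LBINT_reflect_zero:
  fixes G :: "real \<Rightarrow> real"
  assumes "\<And>u. u \<in> {a..b} \<Longrightarrow> u \<noteq> (a + b) / 2 \<Longrightarrow> G u + G (a + b - u) = 0"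
  shows "(LBINT u:{a..b}. G u) = 0"
proof -
  have "(LBINT u:{a..b}. G u) = (\<integral>u. indicator {a..b} (a + b + - 1 * u) * G (a + b + - 1 * u) \<partial>lborel)"
    unfolding set_lebesgue_integral_def
    by (subst lborel_integral_real_affine[where c="-1" and t="a + b"]) auto
  also have "\<dots> = (\<integral>u. - (indicator {a..b} u * G u) \<partial>lborel)"
  proof (rule integral_discrete_difference[where X="{(a + b) / 2}"])
    fix u :: real assume "u \<notin> {(a + b) / 2}"
    then show "indicator {a..b} (a + b + - 1 * u) * G (a + b + - 1 * u) = - (indicator {a..b} u * G u)"
      using assms[of u] by (auto simp: indicator_def)
  qed auto
  finally show ?thesis unfolding set_lebesgue_integral_def by simp
qed

text \<open>Neighbouring closed intervals share an endpoint; additivity is taken from the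
  Henstock-Kurzweil integral, which agrees with the Lebesgue integral for continuous
  integrands.\<close>

lemma LBINT_grid_sum:
  fixes g :: "real \<Rightarrow> real"
  assumes "0 \<le> \<delta>" "continuous_on {0..real n * \<delta>} g"
  shows "(LBINT u:{0..real n * \<delta>}. g u) = (\<Sum>k<n. LBINT u:{real k * \<delta>..real k * \<delta> + \<delta>}. g u)"
proof -
  have I: "(LBINT u:{a..b}. g u) = integral {a..b} g" if "0 \<le> a" "b \<le> real n * \<delta>" for a b
    by (rule set_borel_integral_eq_integral, rule borel_integrable_atLeastAtMost')
      (use assms that in \<open>auto intro: continuous_on_subset\<close>)
  have le: "real k * \<delta> + \<delta> \<le> real n * \<delta>" if "k < n" for k
  proof -
    have "real (Suc k) * \<delta> \<le> real n * \<delta>" using that assms(1) by (intro mult_right_mono) auto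
    then show ?thesis by (simp add: algebra_simps)
  qed
  have "integral {0..real j * \<delta>} g = (\<Sum>k<j. integral {real k * \<delta>..real k * \<delta> + \<delta>} g)" if "j \<le> n" for j
    using that
  proof (induction j)
    case (Suc j)
    have "integral {0..real j * \<delta>} g + integral {real j * \<delta>..real j * \<delta> + \<delta>} g = integral {0..real j * \<delta> + \<delta>} g"
      using assms le[of j] Suc.prems
      by (intro Henstock_Kurzweil_Integration.integral_combine integrable_continuous_real)
        (auto intro: continuous_on_subset)
    moreover have "real (Suc j) * \<delta> = real j * \<delta> + \<delta>" by (simp add: algebra_simps)
    ultimately show ?case using Suc by simp
  qed simp
  from this[of n] show ?thesis using I le assms(1) by simp
qed

section \<open>Conditionally centred integrals over one step and their sums\<close>

context brownian
begin

text \<open>The common features of \<open>hA\<close> and \<open>hQ\<close>: a deterministic function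
  of the elapsed time and of the increment, with mean zero, and with second moment at most
  \<open>\<kappa>\<close> for all elapsed times up to \<open>d\<close>.\<close>

definition centered :: "(real \<Rightarrow> real \<Rightarrow> real) \<Rightarrow> real \<Rightarrow> real \<Rightarrow> bool" where
  "centered h d \<kappa> \<longleftrightarrow> continuous_on UNIV (\<lambda>(v, w). h v w) \<and>
     (\<forall>s u. 0 \<le> s \<longrightarrow> s \<le> u \<longrightarrow> u \<le> T \<longrightarrow> u - s \<le> d \<longrightarrow>
        integrable M (\<lambda>\<omega>. (h (u - s) (W u \<omega> - W s \<omega>))\<^sup>2) \<and>
        expectation (\<lambda>\<omega>. h (u - s) (W u \<omega> - W s \<omega>)) = 0 \<and>
        expectation (\<lambda>\<omega>. (h (u - s) (W u \<omega> - W s \<omega>))\<^sup>2) \<le> \<kappa>)"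

text \<open>The coefficient \<open>H\<close> is meant to be known at time \<open>s\<close>. The
  \<open>\<gamma>\<close> term involves the increment over the entire step, whatever
  \<open>u\<close> is; it carries the Brownian correction of the trapezoidal weight.\<close>

definition step :: "(real \<Rightarrow> real \<Rightarrow> real) \<Rightarrow> real \<Rightarrow> real \<Rightarrow> real \<Rightarrow> ('a \<Rightarrow> real) \<Rightarrow> real \<Rightarrow> 'a \<Rightarrow> real" where
  "step h \<gamma> s d H u \<omega> = H \<omega> * (h (u - s) (W u \<omega> - W s \<omega>) + \<gamma> * (W (s + d) \<omega> - W s \<omega>))"

lemma centered_measurable: "centered h d \<kappa> \<Longrightarrow> h v \<in> borel_measurable borel"
proof -
  assume "centered h d \<kappa>"
  then have "continuous_on UNIV (\<lambda>(v, w). h v w)" by (simp add: centered_def)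
  then have "continuous_on UNIV (\<lambda>w. (\<lambda>(v, w). h v w) (v, w))"
    by (rule continuous_on_compose2) (auto intro!: continuous_intros)
  then show ?thesis by (intro borel_measurable_continuous_onI) simp
qed

lemma step_continuous:
  assumes "0 \<le> s" "s + d \<le> T" "centered h d \<kappa>" "\<omega> \<in> space M"
  shows "continuous_on {s..s+d} (\<lambda>u. step h \<gamma> s d H u \<omega>)"
proof -
  have c: "continuous_on UNIV (\<lambda>(v, w). h v w)" using assms by (simp add: centered_def)
  have "continuous_on {s..s+d} (\<lambda>u. W u \<omega>)"
    using continuous_on_subset[OF continuous_W[OF assms(4)]] assms by auto
  then have "continuous_on {s..s+d} (\<lambda>u. (\<lambda>(v, w). h v w) (u - s, W u \<omega> - W s \<omega>))"
    by (intro continuous_on_compose2[OF c] continuous_intros) auto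
  then show ?thesis unfolding step_def by (intro continuous_intros) simp
qed

text \<open>\<open>H\<close> is known at time \<open>s\<close> and each increment is independent of
  \<open>F s\<close>, so the moments factorise. The two increments overlap and are correlated;
  \<open>square_add_le\<close>-type estimates avoid their covariance at the price of a factor
  2.\<close>

lemma step_L2:
  assumes s: "0 \<le> s" "0 \<le> d" "s + d \<le> T" and h: "centered h d \<kappa>"
    and H: "H \<in> borel_measurable (F s)" "integrable M (\<lambda>\<omega>. (H \<omega>)\<^sup>2)" "expectation (\<lambda>\<omega>. (H \<omega>)\<^sup>2) \<le> L"
    and u: "u \<in> {s..s+d}"
  shows "step h \<gamma> s d H u \<in> borel_measurable (F (s + d))"
    and "integrable M (\<lambda>\<omega>. (step h \<gamma> s d H u \<omega>)\<^sup>2)"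
    and "expectation (\<lambda>\<omega>. (step h \<gamma> s d H u \<omega>)\<^sup>2) \<le> 2 * L * (\<kappa> + \<gamma>\<^sup>2 * d)"
    and "P \<in> borel_measurable (F s) \<Longrightarrow> integrable M (\<lambda>\<omega>. (P \<omega>)\<^sup>2) \<Longrightarrow>
      expectation (\<lambda>\<omega>. P \<omega> * step h \<gamma> s d H u \<omega>) = 0"
proof -
  have hm[measurable]: "h v \<in> borel_measurable borel" for v by (rule centered_measurable[OF h])
  have [measurable]: "W u \<in> borel_measurable M" "W s \<in> borel_measurable M" "W (s + d) \<in> borel_measurable M"
    "H \<in> borel_measurable M"
    using s u H by (auto intro: measurable_W measurable_F_imp)
  define x where "x \<omega> = h (u - s) (W u \<omega> - W s \<omega>)" for \<omega>
  define y where "y \<omega> = \<gamma> * (W (s + d) \<omega> - W s \<omega>)" for \<omega>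
  have [measurable]: "x \<in> borel_measurable M" "y \<in> borel_measurable M" unfolding x_def y_def by measurable
  have step: "step h \<gamma> s d H u \<omega> = H \<omega> * x \<omega> + H \<omega> * y \<omega>" for \<omega>
    by (simp add: step_def x_def y_def algebra_simps)
  have [measurable]: "W u \<in> borel_measurable (F (s + d))" "W s \<in> borel_measurable (F (s + d))"
    "W (s + d) \<in> borel_measurable (F (s + d))" "H \<in> borel_measurable (F (s + d))"
    using s u measurable_F_mono[OF H(1)] by (auto intro!: measurable_W_F)
  show "step h \<gamma> s d H u \<in> borel_measurable (F (s + d))" unfolding step_def[abs_def] by measurable
  have hx: "integrable M (\<lambda>\<omega>. (x \<omega>)\<^sup>2)" "expectation x = 0" "expectation (\<lambda>\<omega>. (x \<omega>)\<^sup>2) \<le> \<kappa>"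
    using h s u unfolding centered_def x_def by auto
  have hy: "integrable M (\<lambda>\<omega>. (y \<omega>)\<^sup>2)" "expectation y = 0" "expectation (\<lambda>\<omega>. (y \<omega>)\<^sup>2) = \<gamma>\<^sup>2 * d"
    using increment_moments(3-6)[of s "s + d"] s unfolding y_def by (auto simp: power_mult_distrib)
  have x1: "integrable M x" and y1: "integrable M y"
    using hx hy by (auto intro: square_integrable_imp_integrable)
  have H2: "(\<lambda>\<omega>. (H \<omega>)\<^sup>2) \<in> borel_measurable (F s)" using H(1) by simp
  have ix: "integrable M (\<lambda>\<omega>. (H \<omega>)\<^sup>2 * (x \<omega>)\<^sup>2)"
    "expectation (\<lambda>\<omega>. (H \<omega>)\<^sup>2 * (x \<omega>)\<^sup>2) = expectation (\<lambda>\<omega>. (H \<omega>)\<^sup>2) * expectation (\<lambda>\<omega>. (x \<omega>)\<^sup>2)"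
    using expectation_indep_increment[of s u "\<lambda>\<omega>. (H \<omega>)\<^sup>2" "\<lambda>w. (h (u - s) w)\<^sup>2"] H2 H(2) hx(1) s u
    unfolding x_def by auto
  have iy: "integrable M (\<lambda>\<omega>. (H \<omega>)\<^sup>2 * (y \<omega>)\<^sup>2)"
    "expectation (\<lambda>\<omega>. (H \<omega>)\<^sup>2 * (y \<omega>)\<^sup>2) = expectation (\<lambda>\<omega>. (H \<omega>)\<^sup>2) * expectation (\<lambda>\<omega>. (y \<omega>)\<^sup>2)"
    using expectation_indep_increment[of s "s + d" "\<lambda>\<omega>. (H \<omega>)\<^sup>2" "\<lambda>w. (\<gamma> * w)\<^sup>2"] H2 H(2) hy(1) s
    unfolding y_def by auto
  have L: "0 \<le> L" using H(3) by (rule order_trans[rotated]) simp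
  have k: "0 \<le> \<kappa>" using hx(3) by (rule order_trans[rotated]) simp
  show "integrable M (\<lambda>\<omega>. (step h \<gamma> s d H u \<omega>)\<^sup>2)"
    unfolding step using ix(1) iy(1) by (intro integrable_add_L2) (auto simp: power_mult_distrib)
  have "expectation (\<lambda>\<omega>. (step h \<gamma> s d H u \<omega>)\<^sup>2)
    \<le> 2 * expectation (\<lambda>\<omega>. (H \<omega> * x \<omega>)\<^sup>2) + 2 * expectation (\<lambda>\<omega>. (H \<omega> * y \<omega>)\<^sup>2)"
    unfolding step using ix(1) iy(1) by (intro integral_square_add_le) (auto simp: power_mult_distrib)
  also have "\<dots> \<le> 2 * (L * \<kappa>) + 2 * (L * (\<gamma>\<^sup>2 * d))"
    unfolding power_mult_distrib ix(2) iy(2) hy(3)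
    using H(3) hx(3) L k s by (intro add_mono mult_left_mono mult_mono) auto
  finally show "expectation (\<lambda>\<omega>. (step h \<gamma> s d H u \<omega>)\<^sup>2) \<le> 2 * L * (\<kappa> + \<gamma>\<^sup>2 * d)"
    by (simp add: algebra_simps)
  assume P: "P \<in> borel_measurable (F s)" "integrable M (\<lambda>\<omega>. (P \<omega>)\<^sup>2)"
  have PH: "(\<lambda>\<omega>. P \<omega> * H \<omega>) \<in> borel_measurable (F s)" "integrable M (\<lambda>\<omega>. P \<omega> * H \<omega>)"
    using P H by (auto intro!: integrable_mult_L2 measurable_F_imp[OF P(1)] measurable_F_imp[OF H(1)])
  have "integrable M (\<lambda>\<omega>. P \<omega> * H \<omega> * x \<omega>)" "expectation (\<lambda>\<omega>. P \<omega> * H \<omega> * x \<omega>) = 0"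
    using expectation_indep_increment[of s u "\<lambda>\<omega>. P \<omega> * H \<omega>" "h (u - s)"] PH x1 hx(2) s u
    unfolding x_def by auto
  moreover have "integrable M (\<lambda>\<omega>. P \<omega> * H \<omega> * y \<omega>)" "expectation (\<lambda>\<omega>. P \<omega> * H \<omega> * y \<omega>) = 0"
    using expectation_indep_increment[of s "s + d" "\<lambda>\<omega>. P \<omega> * H \<omega>" "\<lambda>w. \<gamma> * w"] PH y1 hy(2) s
    unfolding y_def by auto
  ultimately show "expectation (\<lambda>\<omega>. P \<omega> * step h \<gamma> s d H u \<omega>) = 0"
    unfolding step by (simp add: distrib_left mult.assoc)
qed

definition step_integral where
  "step_integral h \<gamma> s d H \<omega> = (LBINT u:{s..s+d}. step h \<gamma> s d H u \<omega>)"

text \<open>Integration over the step keeps adaptedness and conditional centring, and contributes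
  the factor \<open>d\<^sup>2\<close> to the second moment.\<close>

lemma step_integral_L2:
  assumes s: "0 \<le> s" "0 \<le> d" "s + d \<le> T" and h: "centered h d \<kappa>"
    and H: "H \<in> borel_measurable (F s)" "integrable M (\<lambda>\<omega>. (H \<omega>)\<^sup>2)" "expectation (\<lambda>\<omega>. (H \<omega>)\<^sup>2) \<le> L"
  shows "step_integral h \<gamma> s d H \<in> borel_measurable (F (s + d))"
    and "integrable M (\<lambda>\<omega>. (step_integral h \<gamma> s d H \<omega>)\<^sup>2)"
    and "expectation (\<lambda>\<omega>. (step_integral h \<gamma> s d H \<omega>)\<^sup>2) \<le> d\<^sup>2 * (2 * L * (\<kappa> + \<gamma>\<^sup>2 * d))"
    and "P \<in> borel_measurable (F s) \<Longrightarrow> integrable M (\<lambda>\<omega>. (P \<omega>)\<^sup>2) \<Longrightarrow>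
      expectation (\<lambda>\<omega>. P \<omega> * step_integral h \<gamma> s d H \<omega>) = 0"
proof -
  note st = step_L2[OF s h H, where \<gamma>=\<gamma>]
  have m: "step h \<gamma> s d H u \<in> borel_measurable M" if "u \<in> {s..s+d}" for u
    using st(1)[OF that] by (rule measurable_F_imp)
  have sd: "s \<le> s + d" using s by simp
  note c = step_continuous[OF s(1,3) h, where \<gamma>=\<gamma> and H=H]
  show "step_integral h \<gamma> s d H \<in> borel_measurable (F (s + d))"
    unfolding step_integral_def[abs_def]
    by (rule borel_measurable_integral_continuous_paths[OF st(1) c]) (auto simp: space_F)
  show "integrable M (\<lambda>\<omega>. (step_integral h \<gamma> s d H \<omega>)\<^sup>2)"
    "expectation (\<lambda>\<omega>. (step_integral h \<gamma> s d H \<omega>)\<^sup>2) \<le> d\<^sup>2 * (2 * L * (\<kappa> + \<gamma>\<^sup>2 * d))"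
    unfolding step_integral_def
    using time_integral_L2[OF sd m c st(2) st(3)] by auto
  assume P: "P \<in> borel_measurable (F s)" "integrable M (\<lambda>\<omega>. (P \<omega>)\<^sup>2)"
  have "expectation (\<lambda>\<omega>. P \<omega> * step_integral h \<gamma> s d H \<omega>) = (LBINT u:{s..s+d}. expectation (\<lambda>\<omega>. P \<omega> * step h \<gamma> s d H u \<omega>))"
    unfolding step_integral_def
    using expectation_mult_time_integral[OF sd m c st(2) st(3) measurable_F_imp[OF P(1)] P(2)] .
  also have "\<dots> = (LBINT u:{s..s+d}. 0)"
    using st(4)[OF _ P] by (intro set_lebesgue_integral_cong) auto
  finally show "expectation (\<lambda>\<omega>. P \<omega> * step_integral h \<gamma> s d H \<omega>) = 0" by simp
qed

text \<open>The summands are martingale differences: each is centred given the past at its left end,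
  and earlier ones belong to that past. Cross terms vanish, so the second moment grows like
  \<open>n\<close> times that of a single step and not like its square multiple.\<close>

lemma step_integral_sum_L2:
  fixes H :: "nat \<Rightarrow> 'a \<Rightarrow> real"
  assumes \<delta>: "0 < \<delta>" "real n * \<delta> \<le> T" and h: "centered h \<delta> \<kappa>"
    and H: "\<And>k. k < n \<Longrightarrow> H k \<in> borel_measurable (F (real k * \<delta>))"
      "\<And>k. k < n \<Longrightarrow> integrable M (\<lambda>\<omega>. (H k \<omega>)\<^sup>2)" "\<And>k. k < n \<Longrightarrow> expectation (\<lambda>\<omega>. (H k \<omega>)\<^sup>2) \<le> L"
  shows "(\<lambda>\<omega>. \<Sum>k<n. step_integral h \<gamma> (real k * \<delta>) \<delta> (H k) \<omega>) \<in> borel_measurable M"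
    "integrable M (\<lambda>\<omega>. (\<Sum>k<n. step_integral h \<gamma> (real k * \<delta>) \<delta> (H k) \<omega>)\<^sup>2)"
    "expectation (\<lambda>\<omega>. (\<Sum>k<n. step_integral h \<gamma> (real k * \<delta>) \<delta> (H k) \<omega>)\<^sup>2)
      \<le> real n * (\<delta>\<^sup>2 * (2 * L * (\<kappa> + \<gamma>\<^sup>2 * \<delta>)))"
proof -
  define X where "X k = step_integral h \<gamma> (real k * \<delta>) \<delta> (H k)" for k
  have le: "real k * \<delta> + \<delta> \<le> real l * \<delta>" if "k < l" for k l
  proof -
    have "real (Suc k) * \<delta> \<le> real l * \<delta>" using that \<delta>(1) by (intro mult_right_mono) auto
    then show ?thesis by (simp add: algebra_simps)
  qed
  have s: "0 \<le> real k * \<delta>" "0 \<le> \<delta>" "real k * \<delta> + \<delta> \<le> T" if "k < n" for k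
    using \<delta> le[OF that] by auto
  note st = step_integral_L2[OF s h H, where \<gamma>=\<gamma>, folded X_def]
  have m: "X k \<in> borel_measurable M" if "k < n" for k
    using st(1)[OF that that that that that that] by (rule measurable_F_imp)
  have i2: "integrable M (\<lambda>\<omega>. (X k \<omega>)\<^sup>2)" if "k < n" for k
    using st(2)[OF that that that that that that] .
  have e2: "expectation (\<lambda>\<omega>. (X k \<omega>)\<^sup>2) \<le> \<delta>\<^sup>2 * (2 * L * (\<kappa> + \<gamma>\<^sup>2 * \<delta>))" if "k < n" for k
    using st(3)[OF that that that that that that] .
  have orth: "expectation (\<lambda>\<omega>. X j \<omega> * X k \<omega>) = 0" if "j < k" "k < n" for j k
  proof -
    have jn: "j < n" using that by simp
    have "X j \<in> borel_measurable (F (real k * \<delta>))"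
      using measurable_F_mono[OF st(1)[OF jn jn jn jn jn jn] le[OF that(1)]] .
    then show ?thesis using st(4)[OF that(2) that(2) that(2) that(2) that(2) that(2) _ i2[OF jn]] by simp
  qed
  have orth': "expectation (\<lambda>\<omega>. X j \<omega> * X k \<omega>) = 0" if "j \<noteq> k" "j < n" "k < n" for j k
    using orth[of j k] orth[of k j] that by (cases "j < k") (auto simp: mult.commute)
  show "(\<lambda>\<omega>. \<Sum>k<n. step_integral h \<gamma> (real k * \<delta>) \<delta> (H k) \<omega>) \<in> borel_measurable M"
    unfolding X_def[symmetric] using m by (intro borel_measurable_sum) auto
  show "integrable M (\<lambda>\<omega>. (\<Sum>k<n. step_integral h \<gamma> (real k * \<delta>) \<delta> (H k) \<omega>)\<^sup>2)"
    unfolding X_def[symmetric] using m i2 by (intro integrable_sum_L2) auto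
  have "expectation (\<lambda>\<omega>. (\<Sum>k<n. X k \<omega>)\<^sup>2) = expectation (\<lambda>\<omega>. \<Sum>j<n. \<Sum>k<n. X j \<omega> * X k \<omega>)"
    by (simp add: power2_eq_square sum_product)
  also have "\<dots> = (\<Sum>j<n. \<Sum>k<n. expectation (\<lambda>\<omega>. X j \<omega> * X k \<omega>))"
    using m i2 by (subst Bochner_Integration.integral_sum)
      (auto intro!: Bochner_Integration.integrable_sum integrable_mult_L2 sum.cong Bochner_Integration.integral_sum)
  also have "\<dots> = (\<Sum>j<n. \<Sum>k<n. if k = j then expectation (\<lambda>\<omega>. (X j \<omega>)\<^sup>2) else 0)"
    using orth' by (intro sum.cong) (auto simp: power2_eq_square)
  also have "\<dots> = (\<Sum>j<n. expectation (\<lambda>\<omega>. (X j \<omega>)\<^sup>2))" by simp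
  also have "\<dots> \<le> (\<Sum>j<n. \<delta>\<^sup>2 * (2 * L * (\<kappa> + \<gamma>\<^sup>2 * \<delta>)))" by (intro sum_mono e2) auto
  finally show "expectation (\<lambda>\<omega>. (\<Sum>k<n. step_integral h \<gamma> (real k * \<delta>) \<delta> (H k) \<omega>)\<^sup>2)
      \<le> real n * (\<delta>\<^sup>2 * (2 * L * (\<kappa> + \<gamma>\<^sup>2 * \<delta>)))"
    unfolding X_def[symmetric] by simp
qed

section \<open>Orthogonality to grid values by reversal within a step\<close>

text \<open>The sum of the integrands at the mirrored times \<open>s + v\<close> and
  \<open>s + \<delta> - v\<close> is the increment over the last \<open>v\<close> time units minus
  the one over the first \<open>v\<close>. By \<open>grid_functional_swap\<close> these have the
  same expectation against \<open>Z\<close>, so the integral over the step vanishes by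
  reflection.\<close>

lemma grid_functional_orthogonal:
  fixes \<Phi> :: "(nat \<Rightarrow> real) \<Rightarrow> real"
  assumes \<delta>: "0 < \<delta>" "real n * \<delta> \<le> T" and k: "k < n"
    and \<Phi>: "\<Phi> \<in> borel_measurable (\<Pi>\<^sub>M i\<in>{..n}. borel)"
    and Z: "\<And>\<omega>. Z \<omega> = \<Phi> (\<lambda>j\<in>{..n}. W (real j * \<delta>) \<omega> - W 0 \<omega>)" "integrable M (\<lambda>\<omega>. (Z \<omega>)\<^sup>2)"
  shows "expectation (\<lambda>\<omega>. Z \<omega> * (LBINT u:{real k * \<delta>..real k * \<delta> + \<delta>}.
      (W (real k * \<delta> + \<delta>) \<omega> - W (real k * \<delta>) \<omega>) / 2 - (W u \<omega> - W (real k * \<delta>) \<omega>))) = 0"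
proof -
  define s where "s = real k * \<delta>"
  have sd: "real (Suc k) * \<delta> = s + \<delta>" by (simp add: s_def algebra_simps)
  have le: "real j * \<delta> \<le> T" if "j \<le> n" for j
  proof -
    have "real j * \<delta> \<le> real n * \<delta>" using that \<delta>(1) by (intro mult_right_mono) auto
    then show ?thesis using \<delta>(2) by simp
  qed
  have s: "0 \<le> s" "s + \<delta> \<le> T" using \<delta> le[of "Suc k"] k sd by (auto simp: s_def)
  have Wm: "W u \<in> borel_measurable M" if "u \<in> {s..s + \<delta>}" for u using that s by (intro measurable_W) auto
  have Zm[measurable]: "Z \<in> borel_measurable M"
  proof -
    have "(\<lambda>\<omega>. \<lambda>j\<in>{..n}. W (real j * \<delta>) \<omega> - W 0 \<omega>) \<in> M \<rightarrow>\<^sub>M (\<Pi>\<^sub>M i\<in>{..n}. borel)"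
      using le \<delta> T_pos by (intro measurable_restrict borel_measurable_diff measurable_W) auto
    from measurable_compose[OF this \<Phi>] show ?thesis unfolding Z(1)[abs_def] .
  qed
  define c where "c u \<omega> = (W (s + \<delta>) \<omega> - W s \<omega>) / 2 - (W u \<omega> - W s \<omega>)" for u \<omega>
  have cm: "c u \<in> borel_measurable M" if "u \<in> {s..s+\<delta>}" for u
    unfolding c_def[abs_def] using that \<delta> by (intro borel_measurable_diff borel_measurable_divide Wm) auto
  have cc: "continuous_on {s..s+\<delta>} (\<lambda>u. c u \<omega>)" if "\<omega> \<in> space M" for \<omega>
    unfolding c_def using continuous_on_subset[OF continuous_W[OF that], of "{s..s+\<delta>}"] s
    by (intro continuous_intros) auto
  have W2: "integrable M (\<lambda>\<omega>. (W u \<omega> - W s \<omega>)\<^sup>2)" "expectation (\<lambda>\<omega>. (W u \<omega> - W s \<omega>)\<^sup>2) = u - s" if "u \<in> {s..s+\<delta>}" for u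
    using increment_moments(5,6)[of s u] that s by auto
  \<comment> \<open>The two squares contribute \<open>2 * (\<delta> / 4)\<close> and at most
    \<open>2 * \<delta>\<close>; the bound is made uniform in \<open>u\<close> for the use of
    Fubini.\<close>
  have cp: "integrable M (\<lambda>\<omega>. (c u \<omega>)\<^sup>2) \<and> expectation (\<lambda>\<omega>. (c u \<omega>)\<^sup>2) \<le> 3 * \<delta>" if "u \<in> {s..s+\<delta>}" for u
  proof -
    have e: "c u \<omega> = (W (s + \<delta>) \<omega> - W s \<omega>) / 2 + - (W u \<omega> - W s \<omega>)" for \<omega> by (simp add: c_def)
    have i: "integrable M (\<lambda>\<omega>. ((W (s + \<delta>) \<omega> - W s \<omega>) / 2)\<^sup>2)" "integrable M (\<lambda>\<omega>. (- (W u \<omega> - W s \<omega>))\<^sup>2)"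
      using W2(1)[of "s + \<delta>"] W2(1)[OF that] \<delta> by (auto simp: power_divide power2_commute)
    have mm: "(\<lambda>\<omega>. (W (s + \<delta>) \<omega> - W s \<omega>) / 2) \<in> borel_measurable M" "(\<lambda>\<omega>. - (W u \<omega> - W s \<omega>)) \<in> borel_measurable M"
      using that \<delta> by (auto intro!: borel_measurable_diff borel_measurable_divide borel_measurable_uminus Wm)
    have "expectation (\<lambda>\<omega>. (c u \<omega>)\<^sup>2) \<le> 2 * expectation (\<lambda>\<omega>. ((W (s + \<delta>) \<omega> - W s \<omega>) / 2)\<^sup>2)
       + 2 * expectation (\<lambda>\<omega>. (- (W u \<omega> - W s \<omega>))\<^sup>2)"
      unfolding e by (rule integral_square_add_le[OF mm i])
    also have "\<dots> = 2 * (\<delta> / 4) + 2 * (u - s)"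
      unfolding power_divide power2_minus using W2(2)[of "s + \<delta>"] W2(2)[OF that] \<delta> by simp
    also have "\<dots> \<le> 3 * \<delta>" using that \<delta> by simp
    finally show ?thesis using integrable_add_L2[OF mm i] unfolding e by simp
  qed
  have key: "expectation (\<lambda>\<omega>. Z \<omega> * c u \<omega>) + expectation (\<lambda>\<omega>. Z \<omega> * c (s + (s + \<delta>) - u) \<omega>) = 0"
    if u: "u \<in> {s..s + \<delta>}" "u \<noteq> (s + (s + \<delta>)) / 2" for u
  proof -
    have pos: "expectation (\<lambda>\<omega>. Z \<omega> * c (s + v) \<omega>) + expectation (\<lambda>\<omega>. Z \<omega> * c (s + \<delta> - v) \<omega>) = 0"
      if v: "0 \<le> v" "v < \<delta> / 2" for v
    proof -
      have i: "integrable M (\<lambda>\<omega>. Z \<omega> * c x \<omega>)" "integrable M (\<lambda>\<omega>. Z \<omega> * (W x \<omega> - W s \<omega>))" if "x \<in> {s..s+\<delta>}" for x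
        using Zm Z(2) cm[OF that] cp[OF that] W2(1)[OF that] Wm[OF that] Wm[of s] \<delta>
        by (auto intro!: integrable_mult_L2)
      have r: "s + v \<in> {s..s+\<delta>}" "s + \<delta> - v \<in> {s..s+\<delta>}" "s + \<delta> \<in> {s..s+\<delta>}" using v \<delta> by auto
      have "expectation (\<lambda>\<omega>. Z \<omega> * c (s + v) \<omega>) + expectation (\<lambda>\<omega>. Z \<omega> * c (s + \<delta> - v) \<omega>)
        = expectation (\<lambda>\<omega>. Z \<omega> * c (s + v) \<omega> + Z \<omega> * c (s + \<delta> - v) \<omega>)"
        using i(1)[OF r(1)] i(1)[OF r(2)] by simp
      also have "\<dots> = expectation (\<lambda>\<omega>. Z \<omega> * (W (s + \<delta>) \<omega> - W (s + \<delta> - v) \<omega>) - Z \<omega> * (W (s + v) \<omega> - W s \<omega>))"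
        by (rule Bochner_Integration.integral_cong) (auto simp: c_def field_simps)
      also have "\<dots> = expectation (\<lambda>\<omega>. Z \<omega> * (W (s + \<delta>) \<omega> - W (s + \<delta> - v) \<omega>)) - expectation (\<lambda>\<omega>. Z \<omega> * (W (s + v) \<omega> - W s \<omega>))"
      proof (rule Bochner_Integration.integral_diff)
        have "Z \<omega> * (W (s + \<delta>) \<omega> - W (s + \<delta> - v) \<omega>) = Z \<omega> * (W (s + \<delta>) \<omega> - W s \<omega>) - Z \<omega> * (W (s + \<delta> - v) \<omega> - W s \<omega>)" for \<omega>
          by (simp add: algebra_simps)
        then show "integrable M (\<lambda>\<omega>. Z \<omega> * (W (s + \<delta>) \<omega> - W (s + \<delta> - v) \<omega>))"
          using i(2)[OF r(2)] i(2)[OF r(3)] by simp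
      qed (rule i(2)[OF r(1)])
      also have "\<dots> = 0"
      \<comment> \<open>The exchange concerns nonempty intervals; at \<open>v = 0\<close> both
        increments vanish identically.\<close>
      proof (cases "v = 0")
        case False
        then show ?thesis
          using grid_functional_swap[OF \<delta> k _ v(2) \<Phi>] v Z(1) unfolding sd s_def[symmetric] by simp
      qed simp
      finally show ?thesis .
    qed
    show ?thesis
    \<comment> \<open>The claim is invariant under reflection, so the left half of the step decides
      both cases.\<close>
    proof (cases "u < (s + (s + \<delta>)) / 2")
      case True
      then show ?thesis using pos[of "u - s"] u by (simp add: algebra_simps field_simps)
    next
      case False
      then show ?thesis using pos[of "s + \<delta> - u"] u by (simp add: algebra_simps field_simps)
    qed
  qed
  have "expectation (\<lambda>\<omega>. Z \<omega> * (LBINT u:{s..s+\<delta>}. c u \<omega>)) = (LBINT u:{s..s+\<delta>}. expectation (\<lambda>\<omega>. Z \<omega> * c u \<omega>))"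
    using \<delta> cp by (intro expectation_mult_time_integral[where \<kappa>="3 * \<delta>"] cm cc Zm Z) auto
  also have "\<dots> = 0" by (rule LBINT_reflect_zero) (rule key)
  finally show ?thesis unfolding c_def s_def .
qed

end

section \<open>The Black-Scholes model and the local error of the scheme\<close>

lemma exp_minus_one_le:
  fixes y :: real
  shows "\<bar>exp y - 1\<bar> \<le> \<bar>y\<bar> * exp \<bar>y\<bar>"
proof (cases "0 \<le> y")
  case True
  have "1 - y \<le> exp (- y)" using exp_ge_add_one_self[of "- y"] by simp
  then have "(1 - y) * exp y \<le> exp (- y) * exp y" by (intro mult_right_mono) auto
  then have "exp y - 1 \<le> y * exp y" by (simp add: algebra_simps flip: exp_add)
  then show ?thesis using True by simp
next
  case False
  have "1 - exp y \<le> - y" using exp_ge_add_one_self[of y] by linarith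
  also have "- y * 1 \<le> - y * exp (- y)" using False by (intro mult_left_mono) auto
  finally show ?thesis using False by simp
qed

text \<open>Everything follows from \<open>1 + x \<le> exp x\<close>. For \<open>y \<ge> 0\<close>
  the bound \<open>exp y - 1 \<le> y * exp y\<close> is used twice. For \<open>y = - z < 0\<close>
  one compares \<open>exp (- z) * (1 + z) \<le> 1\<close> with
  \<open>(1 - z + z\<^sup>2) * (1 + z)\<close>, which is \<open>1 + z ^ 3\<close>.\<close>

lemma exp_minus_affine_le:
  fixes y :: real
  shows "\<bar>1 + y - exp y\<bar> \<le> y\<^sup>2 * exp \<bar>y\<bar>"
proof -
  have "exp y - 1 - y \<le> y\<^sup>2 * exp \<bar>y\<bar>"
  proof (cases "0 \<le> y")
    case True
    have "1 - y \<le> exp (- y)" using exp_ge_add_one_self[of "- y"] by simp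
    then have "(1 - y) * exp y \<le> exp (- y) * exp y" by (intro mult_right_mono) auto
    then have *: "exp y - 1 \<le> y * exp y" by (simp add: algebra_simps flip: exp_add)
    then have "y * (exp y - 1) \<le> y * (y * exp y)" using True by (rule mult_left_mono)
    then show ?thesis using * True by (simp add: algebra_simps power2_eq_square)
  next
    case False
    define z where "z = - y"
    have z: "z > 0" using False by (simp add: z_def)
    have "exp (- z) * (1 + z) \<le> exp (- z) * exp z" by (intro mult_left_mono exp_ge_add_one_self) auto
    then have "exp (- z) * (1 + z) \<le> 1" by (simp flip: exp_add)
    moreover have "1 \<le> (1 - z + z\<^sup>2) * (1 + z)" using z by (simp add: algebra_simps power2_eq_square)
    ultimately have "exp (- z) * (1 + z) \<le> (1 - z + z\<^sup>2) * (1 + z)" by linarith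
    then have "exp (- z) \<le> 1 - z + z\<^sup>2" using z by (simp add: mult_le_cancel_right)
    then have "exp y - 1 - y \<le> z\<^sup>2 * 1" by (simp add: z_def)
    also have "z\<^sup>2 * 1 \<le> z\<^sup>2 * exp z" using z by (intro mult_left_mono) auto
    finally show ?thesis using z by (simp add: z_def)
  qed
  then show ?thesis using exp_ge_add_one_self[of y] by linarith
qed

section \<open>The stock price and its moments\<close>

locale black_scholes = brownian M F T W
  for M :: "'a measure" and F :: "real \<Rightarrow> 'a measure" and T :: real and W :: "real \<Rightarrow> 'a \<Rightarrow> real" +
  fixes S0 r \<sigma> :: real
  assumes S0_pos: "0 < S0" and sigma_pos: "0 < \<sigma>"
begin

abbreviation "S \<equiv> stock S0 r \<sigma> W"
abbreviation "Avg \<equiv> average S0 r \<sigma> T W"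
abbreviation "Trap \<equiv> trapezoidal S0 r \<sigma> T W"

text \<open>The exact moment of order \<open>q\<close> at time \<open>t\<close> has exponent
  \<open>q * (r - \<sigma>\<^sup>2 / 2) * t + (q * \<sigma>)\<^sup>2 * t / 2\<close>; each summand
  is replaced by its largest possible value on \<open>{0..T}\<close>.\<close>

definition "moment_bound q = S0 ^ q * exp (real q * \<bar>r - \<sigma>\<^sup>2 / 2\<bar> * T + (real q * \<sigma>)\<^sup>2 * T / 2)"

lemma stock_pos: "S t \<omega> > 0"
  using S0_pos by (simp add: stock_def)

lemma measurable_stock_F:
  assumes "0 \<le> t" "t \<le> T" "t \<le> s"
  shows "S t \<in> borel_measurable (F s)"
proof -
  note [measurable] = measurable_W_F[OF assms]
  show ?thesis unfolding stock_def[abs_def] by measurable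
qed

lemma measurable_stock: "0 \<le> t \<Longrightarrow> t \<le> T \<Longrightarrow> S t \<in> borel_measurable M"
  using measurable_stock_F[of t t] measurable_F_imp by auto

lemma continuous_stock: "\<omega> \<in> space M \<Longrightarrow> continuous_on {0..T} (\<lambda>t. S t \<omega>)"
  unfolding stock_def by (intro continuous_intros continuous_W)

lemma stock_moment:
  assumes t: "0 \<le> t" "t \<le> T"
  shows "integrable M (\<lambda>\<omega>. S t \<omega> ^ q)" "expectation (\<lambda>\<omega>. S t \<omega> ^ q) \<le> moment_bound q"
proof -
  have e: "S t \<omega> ^ q = S0 ^ q * exp (real q * (r - \<sigma>\<^sup>2 / 2) * t) * exp ((real q * \<sigma>) * W t \<omega>)" for \<omega>
    by (simp add: stock_def power_mult_distrib exp_of_nat_mult[symmetric] exp_add[symmetric] algebra_simps)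
  show "integrable M (\<lambda>\<omega>. S t \<omega> ^ q)" unfolding e using exp_W_moment(1)[OF t] by simp
  have "expectation (\<lambda>\<omega>. S t \<omega> ^ q) = S0 ^ q * (exp (real q * (r - \<sigma>\<^sup>2 / 2) * t) * exp ((real q * \<sigma>)\<^sup>2 * t / 2))"
    unfolding e using exp_W_moment[OF t, of "real q * \<sigma>"] by simp
  also have "\<dots> = S0 ^ q * exp (real q * (r - \<sigma>\<^sup>2 / 2) * t + (real q * \<sigma>)\<^sup>2 * t / 2)" by (simp add: exp_add)
  also have "\<dots> \<le> moment_bound q" unfolding moment_bound_def
  proof (intro mult_left_mono)
    have "(r - \<sigma>\<^sup>2 / 2) * t \<le> \<bar>r - \<sigma>\<^sup>2 / 2\<bar> * T" using t by (intro mult_mono) auto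
    then have "real q * ((r - \<sigma>\<^sup>2 / 2) * t) \<le> real q * (\<bar>r - \<sigma>\<^sup>2 / 2\<bar> * T)" by (intro mult_left_mono) auto
    moreover have "(real q * \<sigma>)\<^sup>2 * t \<le> (real q * \<sigma>)\<^sup>2 * T" using t by (intro mult_left_mono) auto
    ultimately show "exp (real q * (r - \<sigma>\<^sup>2 / 2) * t + (real q * \<sigma>)\<^sup>2 * t / 2)
      \<le> exp (real q * \<bar>r - \<sigma>\<^sup>2 / 2\<bar> * T + (real q * \<sigma>)\<^sup>2 * T / 2)" by (simp add: mult.assoc)
  qed (use S0_pos in simp)
  finally show "expectation (\<lambda>\<omega>. S t \<omega> ^ q) \<le> moment_bound q" .
qed

lemma moment_bound_nonneg: "0 \<le> moment_bound q"
  using S0_pos by (simp add: moment_bound_def)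

text \<open>With \<open>v = u - s\<close> and \<open>w = W\<^sub>u - W\<^sub>s\<close>, the integrand
  \<open>S\<^sub>s (1 + r v + \<sigma> (W\<^sub>s\<^sub>+\<^sub>d - W\<^sub>s) / 2) - S\<^sub>u\<close> of the error on a step is \<open>S\<^sub>s\<close> times the sum of
  \<open>hA v w + \<sigma> (W\<^sub>s\<^sub>+\<^sub>d - W\<^sub>s) / 2\<close>, \<open>hQ v w\<close> and \<open>1 + r v - exp (r v)\<close>. The first two are centred, of
  orders \<open>d\<^sup>1\<^sup>/\<^sup>2\<close> and \<open>d\<close>; the third is deterministic of order \<open>d\<^sup>2\<close>.\<close>

definition "hA = (\<lambda>(v::real) w. - \<sigma> * w)"
definition "hQ = (\<lambda>v w. exp (r * v) + \<sigma> * w - exp ((r - \<sigma>\<^sup>2 / 2) * v + \<sigma> * w))"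
text \<open>The first summand stems from the second order remainder of
  \<open>exp (\<sigma>\<^sup>2 * v)\<close>, the second from the square of
  \<open>exp (r * v) - 1\<close>; both carry the factor
  \<open>exp (2 * \<bar>r\<bar> * T)\<close>.\<close>

definition "KQ = exp (2 * \<bar>r\<bar> * T) * (\<sigma> ^ 4 * exp (\<sigma>\<^sup>2 * T) + \<sigma>\<^sup>2 * T * r\<^sup>2)"
definition "bias s d = (LBINT u:{s..s+d}. 1 + r * (u - s) - exp (r * (u - s)))"

lemma centered_hA: "centered hA d (\<sigma>\<^sup>2 * d)"
  unfolding centered_def hA_def
proof (intro conjI allI impI)
  fix s u assume "0 \<le> s" "s \<le> u" "u \<le> T" "u - s \<le> d"
  note i = increment_moments(3-6)[OF this(1-3)]
  show "integrable M (\<lambda>\<omega>. (- \<sigma> * (W u \<omega> - W s \<omega>))\<^sup>2)"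
    unfolding power_mult_distrib using i by simp
  show "expectation (\<lambda>\<omega>. - \<sigma> * (W u \<omega> - W s \<omega>)) = 0" 
    unfolding Bochner_Integration.integral_mult_right_zero using i by simp
  show "expectation (\<lambda>\<omega>. (- \<sigma> * (W u \<omega> - W s \<omega>))\<^sup>2) \<le> \<sigma>\<^sup>2 * d"
    unfolding power_mult_distrib Bochner_Integration.integral_mult_right_zero using i \<open>u - s \<le> d\<close>
    by (simp add: mult_left_mono)
qed (simp add: split_beta, intro continuous_intros)

text \<open>The left-hand side is the variance of \<open>hQ v (W\<^sub>s\<^sub>+\<^sub>v - W\<^sub>s)\<close>.\<close>

lemma hQ_variance_bound:
  assumes "0 \<le> v" "v \<le> d" "d \<le> T"
  shows "exp (2 * r * v) * (exp (\<sigma>\<^sup>2 * v) - 1 - \<sigma>\<^sup>2 * v) + \<sigma>\<^sup>2 * v * (exp (r * v) - 1)\<^sup>2 \<le> KQ * d\<^sup>2"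
proof -
  define x where "x = \<sigma>\<^sup>2 * v"
  have x0: "0 \<le> x" using assms by (simp add: x_def)
  have rv: "r * v \<le> \<bar>r\<bar> * T" "\<bar>r * v\<bar> \<le> \<bar>r\<bar> * T"
    using assms by (auto simp: abs_mult intro!: mult_mono)
  have vd: "v\<^sup>2 \<le> d\<^sup>2" using assms by (intro power_mono) auto
  have xT: "x \<le> \<sigma>\<^sup>2 * T" using assms by (simp add: x_def mult_left_mono)
  have "exp x - 1 - x \<le> x\<^sup>2 * exp x" using exp_minus_affine_le[of x] x0 by simp
  also have "\<dots> \<le> x\<^sup>2 * exp (\<sigma>\<^sup>2 * T)" using xT by (intro mult_left_mono) auto
  also have "x\<^sup>2 = \<sigma> ^ 4 * v\<^sup>2" by (simp add: x_def power_mult_distrib flip: power_mult)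
  finally have 1: "exp x - 1 - x \<le> \<sigma> ^ 4 * v\<^sup>2 * exp (\<sigma>\<^sup>2 * T)" .
  have "exp (2 * r * v) * (exp x - 1 - x) \<le> exp (2 * \<bar>r\<bar> * T) * (\<sigma> ^ 4 * v\<^sup>2 * exp (\<sigma>\<^sup>2 * T))"
  proof (rule mult_mono)
    show "0 \<le> exp x - 1 - x" using exp_ge_add_one_self[of x] by linarith
  qed (use 1 rv in auto)
  also have "\<dots> \<le> exp (2 * \<bar>r\<bar> * T) * (\<sigma> ^ 4 * d\<^sup>2 * exp (\<sigma>\<^sup>2 * T))"
    using vd by (intro mult_left_mono mult_right_mono) auto
  finally have A: "exp (2 * r * v) * (exp x - 1 - x) \<le> exp (2 * \<bar>r\<bar> * T) * (\<sigma> ^ 4 * d\<^sup>2 * exp (\<sigma>\<^sup>2 * T))" .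
  have "\<bar>exp (r * v) - 1\<bar> \<le> \<bar>r\<bar> * d * exp (\<bar>r\<bar> * T)"
  proof -
    have "\<bar>exp (r * v) - 1\<bar> \<le> \<bar>r * v\<bar> * exp \<bar>r * v\<bar>" by (rule exp_minus_one_le)
    also have "\<dots> \<le> \<bar>r\<bar> * d * exp (\<bar>r\<bar> * T)"
      using rv assms by (intro mult_mono) (auto simp: abs_mult intro!: mult_left_mono)
    finally show ?thesis .
  qed
  then have "\<bar>exp (r * v) - 1\<bar>\<^sup>2 \<le> (\<bar>r\<bar> * d * exp (\<bar>r\<bar> * T))\<^sup>2" by (intro power_mono) auto
  then have "(exp (r * v) - 1)\<^sup>2 \<le> r\<^sup>2 * d\<^sup>2 * exp (2 * \<bar>r\<bar> * T)"
    by (simp add: power_mult_distrib mult.assoc flip: exp_double)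
  then have "x * (exp (r * v) - 1)\<^sup>2 \<le> \<sigma>\<^sup>2 * T * (r\<^sup>2 * d\<^sup>2 * exp (2 * \<bar>r\<bar> * T))"
    using xT x0 T_pos by (intro mult_mono) auto
  with A show ?thesis unfolding KQ_def x_def[symmetric] by (simp add: algebra_simps)
qed

text \<open>The term \<open>exp (r * v)\<close> is the mean of the exponential in \<open>hQ\<close>,
  which gives the centring. Adding \<open>\<sigma> * w\<close> cancels the part of the exponential
  that is linear in the increment, and what remains has second moment of order
  \<open>v\<^sup>2\<close>.\<close>

lemma centered_hQ:
  assumes d: "d \<le> T"
  shows "centered hQ d (KQ * d\<^sup>2)"
proof -
  have "integrable M (\<lambda>\<omega>. (hQ (u - s) (W u \<omega> - W s \<omega>))\<^sup>2) \<and>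
        expectation (\<lambda>\<omega>. hQ (u - s) (W u \<omega> - W s \<omega>)) = 0 \<and>
        expectation (\<lambda>\<omega>. (hQ (u - s) (W u \<omega> - W s \<omega>))\<^sup>2) \<le> KQ * d\<^sup>2"
    if su: "0 \<le> s" "s \<le> u" "u \<le> T" "u - s \<le> d" for s u
  proof -
    define v where "v = u - s"
    define X where "X \<omega> = W u \<omega> - W s \<omega>" for \<omega>
    define e1 where "e1 = exp (r * v)"
    define ea where "ea = exp ((r - \<sigma>\<^sup>2 / 2) * v)"
    have ea: "ea * exp (\<sigma>\<^sup>2 * v / 2) = e1"
      unfolding ea_def e1_def by (simp add: algebra_simps flip: exp_add)
    have ea2: "ea\<^sup>2 * exp ((2 * \<sigma>)\<^sup>2 * v / 2) = e1\<^sup>2 * exp (\<sigma>\<^sup>2 * v)"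
    proof -
      have "ea\<^sup>2 * exp ((2 * \<sigma>)\<^sup>2 * v / 2) = exp (2 * ((r - \<sigma>\<^sup>2 / 2) * v) + (2 * \<sigma>)\<^sup>2 * v / 2)"
        unfolding ea_def exp_double[symmetric] by (rule exp_add[symmetric])
      also have "2 * ((r - \<sigma>\<^sup>2 / 2) * v) + (2 * \<sigma>)\<^sup>2 * v / 2 = 2 * (r * v) + \<sigma>\<^sup>2 * v"
        by (simp add: algebra_simps power2_eq_square)
      also have "exp (2 * (r * v) + \<sigma>\<^sup>2 * v) = e1\<^sup>2 * exp (\<sigma>\<^sup>2 * v)"
        unfolding e1_def exp_double[symmetric] by (rule exp_add)
      finally show ?thesis .
    qed
    note m = increment_moments[OF su(1-3), folded X_def v_def]
    have h: "hQ v (X \<omega>) = e1 + \<sigma> * X \<omega> - ea * exp (\<sigma> * X \<omega>)" for \<omega>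
      unfolding hQ_def e1_def ea_def by (simp add: exp_add)
    have E0: "expectation (\<lambda>\<omega>. hQ v (X \<omega>)) = 0"
      unfolding h using m(1,2)[of \<sigma>] m(3,4) ea by (simp add: prob_space)
    have e2: "(exp (\<sigma> * X \<omega>))\<^sup>2 = exp ((2 * \<sigma>) * X \<omega>)" for \<omega>
      by (simp flip: exp_double)
    have h2: "(hQ v (X \<omega>))\<^sup>2 = e1\<^sup>2 + \<sigma>\<^sup>2 * (X \<omega>)\<^sup>2 + ea\<^sup>2 * exp ((2 * \<sigma>) * X \<omega>) + 2 * \<sigma> * e1 * X \<omega>
       - 2 * e1 * ea * exp (\<sigma> * X \<omega>) - 2 * \<sigma> * ea * (X \<omega> * exp (\<sigma> * X \<omega>))" for \<omega>
      unfolding h e2[symmetric] by (simp add: power2_eq_square algebra_simps)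
    have i2: "integrable M (\<lambda>\<omega>. (hQ v (X \<omega>))\<^sup>2)"
      unfolding h2 using m(1)[of \<sigma>] m(1)[of "2 * \<sigma>"] m(3,5) m(7)[of \<sigma>] by simp
    have "expectation (\<lambda>\<omega>. (hQ v (X \<omega>))\<^sup>2) = e1\<^sup>2 + \<sigma>\<^sup>2 * v + ea\<^sup>2 * exp ((2 * \<sigma>)\<^sup>2 * v / 2)
       - 2 * e1 * (ea * exp (\<sigma>\<^sup>2 * v / 2)) - 2 * \<sigma>\<^sup>2 * v * (ea * exp (\<sigma>\<^sup>2 * v / 2))"
      unfolding h2 using m(1,2)[of \<sigma>] m(1,2)[of "2 * \<sigma>"] m(3-6) m(7,8)[of \<sigma>]
      by (simp add: prob_space power2_eq_square)
    also have "\<dots> = e1\<^sup>2 * (exp (\<sigma>\<^sup>2 * v) - 1 - \<sigma>\<^sup>2 * v) + \<sigma>\<^sup>2 * v * (e1 - 1)\<^sup>2"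
      unfolding ea ea2 by (simp add: power2_eq_square algebra_simps)
    also have "e1\<^sup>2 = exp (2 * r * v)" unfolding e1_def by (simp add: mult.assoc flip: exp_double)
    also have "exp (2 * r * v) * (exp (\<sigma>\<^sup>2 * v) - 1 - \<sigma>\<^sup>2 * v) + \<sigma>\<^sup>2 * v * (e1 - 1)\<^sup>2 \<le> KQ * d\<^sup>2"
      unfolding e1_def using su d by (intro hQ_variance_bound) (auto simp: v_def)
    finally show ?thesis using i2 E0 unfolding X_def v_def by simp
  qed
  moreover have "continuous_on UNIV (\<lambda>(v, w). hQ v w)"
    unfolding hQ_def split_beta by (intro continuous_intros)
  ultimately show ?thesis unfolding centered_def by blast
qed

definition "KB = r\<^sup>2 * exp (\<bar>r\<bar> * T)"

text \<open>The integrand is a second order Taylor remainder, of size \<open>d\<^sup>2\<close>; the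
  length of the step supplies the third factor.\<close>

lemma bias_le:
  assumes d: "0 \<le> d" "d \<le> T"
  shows "\<bar>bias s d\<bar> \<le> KB * d ^ 3"
proof -
  have i: "set_integrable lborel {s..s+d} (\<lambda>u. 1 + r * (u - s) - exp (r * (u - s)))"
    by (rule borel_integrable_atLeastAtMost') (intro continuous_intros)
  have "\<bar>bias s d\<bar> \<le> (LBINT u:{s..s+d}. \<bar>1 + r * (u - s) - exp (r * (u - s))\<bar>)"
    unfolding bias_def set_lebesgue_integral_def
    by (rule order_trans[OF integral_abs_bound]) (auto simp: abs_mult)
  also have "\<dots> \<le> (LBINT u:{s..s+d}. KB * d\<^sup>2)"
  proof (rule set_integral_mono)
    show "set_integrable lborel {s..s+d} (\<lambda>u. \<bar>1 + r * (u - s) - exp (r * (u - s))\<bar>)"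
      by (rule borel_integrable_atLeastAtMost') (intro continuous_intros)
    show "set_integrable lborel {s..s+d} (\<lambda>u. KB * d\<^sup>2)"
      by (rule borel_integrable_atLeastAtMost') (intro continuous_intros)
    fix u assume u: "u \<in> {s..s+d}"
    have "\<bar>1 + r * (u - s) - exp (r * (u - s))\<bar> \<le> (r * (u - s))\<^sup>2 * exp \<bar>r * (u - s)\<bar>"
      by (rule exp_minus_affine_le)
    also have "\<dots> \<le> (r\<^sup>2 * d\<^sup>2) * exp (\<bar>r\<bar> * T)"
      unfolding power_mult_distrib using u d
      by (intro mult_mono mult_left_mono power_mono) (auto simp: abs_mult intro!: mult_left_mono)
    finally show "\<bar>1 + r * (u - s) - exp (r * (u - s))\<bar> \<le> KB * d\<^sup>2" by (simp add: KB_def mult_ac)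
  qed
  also have "\<dots> = KB * d ^ 3"
    using d by (simp add: set_lebesgue_integral_def power2_eq_square power3_eq_cube)
  finally show ?thesis .
qed

section \<open>Exact decomposition of the error and the size of its parts\<close>

lemma trapezoidal_eq:
  assumes "0 < n" and \<delta>: "\<delta> = T / real n"
  shows "Trap n \<omega> = (\<Sum>k<n. S (real k * \<delta>) \<omega> *
    (1 + r * \<delta> / 2 + \<sigma> * (W (real (Suc k) * \<delta>) \<omega> - W (real k * \<delta>) \<omega>) / 2)) / real n"
proof -
  have "\<delta> / T = 1 / real n" using T_pos by (simp add: \<delta>)
  then show ?thesis unfolding trapezoidal_def Let_def \<delta>[symmetric]
    by (simp only: One_nat_def sum.atLeast1_atMost_eq) simp
qed

text \<open>In the sum of the three integrands \<open>\<sigma> * w\<close> cancels between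
  \<open>hA\<close> and \<open>hQ\<close>, and \<open>exp (r * v)\<close> between \<open>hQ\<close>
  and the bias. There remains \<open>S s * (k + r * (u - s)) - S u\<close>, and the time integral of
  the first term is precisely the trapezoidal weight. The identity is exact, path by path.\<close>

lemma local_error:
  assumes w: "\<omega> \<in> space M" and s: "0 \<le> s" "0 \<le> d" "s + d \<le> T"
  shows "step_integral hA (\<sigma> / 2) s d (S s) \<omega> + step_integral hQ 0 s d (S s) \<omega> + S s \<omega> * bias s d
    = d * (S s \<omega> * (1 + r * d / 2 + \<sigma> * (W (s + d) \<omega> - W s \<omega>) / 2)) - (LBINT u:{s..s+d}. S u \<omega>)"
proof -
  define D where "D = W (s + d) \<omega> - W s \<omega>"
  define k where "k = 1 + \<sigma> * D / 2"
  have cW: "continuous_on {s..s+d} (\<lambda>u. W u \<omega>)"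
    using continuous_on_subset[OF continuous_W[OF w]] s by auto
  have cS: "continuous_on {s..s+d} (\<lambda>u. S u \<omega>)"
    using continuous_on_subset[OF continuous_stock[OF w]] s by auto
  note I = borel_integrable_atLeastAtMost'
  have dT: "d \<le> T" using s by simp
  have iA: "set_integrable lborel {s..s+d} (\<lambda>u. step hA (\<sigma> / 2) s d (S s) u \<omega>)"
    by (rule I, rule step_continuous[OF s(1,3) centered_hA w])
  have iQ: "set_integrable lborel {s..s+d} (\<lambda>u. step hQ 0 s d (S s) u \<omega>)"
    by (rule I, rule step_continuous[OF s(1,3) centered_hQ[OF dT] w])
  have iB: "set_integrable lborel {s..s+d} (\<lambda>u. S s \<omega> * (1 + r * (u - s) - exp (r * (u - s))))"
    by (rule I) (intro continuous_intros)
  have iS: "set_integrable lborel {s..s+d} (\<lambda>u. S u \<omega>)" by (rule I[OF cS])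
  have iL: "set_integrable lborel {s..s+d} (\<lambda>u. S s \<omega> * (k + r * (u - s)))"
    by (rule I) (intro continuous_intros)
  have eq: "step hA (\<sigma> / 2) s d (S s) u \<omega> + step hQ 0 s d (S s) u \<omega> + S s \<omega> * (1 + r * (u - s) - exp (r * (u - s)))
      = S s \<omega> * (k + r * (u - s)) - S u \<omega>" for u
  proof -
    have "S u \<omega> = S s \<omega> * exp ((r - \<sigma>\<^sup>2 / 2) * (u - s) + \<sigma> * (W u \<omega> - W s \<omega>))"
    proof -
      have "c * u + \<sigma> * a = (c * s + \<sigma> * b) + (c * (u - s) + \<sigma> * (a - b))" for c a b :: real
        by (simp add: algebra_simps)
      then show ?thesis unfolding stock_def by (metis exp_add mult.assoc)
    qed
    then show ?thesis unfolding step_def hA_def hQ_def k_def D_def[symmetric] by (simp add: field_simps)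
  qed
  have "step_integral hA (\<sigma> / 2) s d (S s) \<omega> + step_integral hQ 0 s d (S s) \<omega> + S s \<omega> * bias s d
    = (LBINT u:{s..s+d}. step hA (\<sigma> / 2) s d (S s) u \<omega> + step hQ 0 s d (S s) u \<omega> + S s \<omega> * (1 + r * (u - s) - exp (r * (u - s))))"
    unfolding step_integral_def bias_def using iA iQ iB by simp
  also have "\<dots> = (LBINT u:{s..s+d}. S s \<omega> * (k + r * (u - s))) - (LBINT u:{s..s+d}. S u \<omega>)"
    unfolding eq using iL iS by (rule set_integral_diff)
  also have "(LBINT u:{s..s+d}. S s \<omega> * (k + r * (u - s))) = S s \<omega> * (LBINT u:{s..s+d}. k + r * (u - s))" by simp
  also have "(LBINT u:{s..s+d}. k + r * (u - s)) = (k * (s + d) + r * ((s + d) - s)\<^sup>2 / 2) - (k * s + r * (s - s)\<^sup>2 / 2)"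
  proof -
    have "(\<integral>x. (k + r * (x - s)) * indicator {s..s+d} x \<partial>lborel)
      = (k * (s + d) + r * ((s + d) - s)\<^sup>2 / 2) - (k * s + r * (s - s)\<^sup>2 / 2)"
      by (rule integral_FTC_Icc_real) (use s in \<open>auto intro!: derivative_eq_intros\<close>)
    then show ?thesis by (simp add: set_lebesgue_integral_def mult.commute)
  qed
  also have "S s \<omega> * ((k * (s + d) + r * ((s + d) - s)\<^sup>2 / 2) - (k * s + r * (s - s)\<^sup>2 / 2))
    = d * (S s \<omega> * (1 + r * d / 2 + \<sigma> * (W (s + d) \<omega> - W s \<omega>) / 2))"
    unfolding k_def D_def by (simp add: field_simps power2_eq_square)
  finally show ?thesis .
qed

text \<open>Leading part of \<open>T\<close> times the error of the scheme: a sum of martingale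
  differences of order \<open>1 / n\<close> in L2, one from each step. The \<open>remainder\<close>
  below collects the smaller centred terms and the bias.\<close>

definition "mart n \<omega> = (\<Sum>k<n. step_integral hA (\<sigma> / 2) (real k * (T / real n)) (T / real n) (S (real k * (T / real n))) \<omega>)"
definition "remainder n \<omega> = (\<Sum>k<n. step_integral hQ 0 (real k * (T / real n)) (T / real n) (S (real k * (T / real n))) \<omega>)
   + (\<Sum>k<n. S (real k * (T / real n)) \<omega> * bias (real k * (T / real n)) (T / real n))"

lemma grid_le: "k < n \<Longrightarrow> real k * (T / real n) + T / real n \<le> T"
proof -
  assume "k < n"
  then have "real (Suc k) * (T / real n) \<le> real n * (T / real n)"
    using T_pos by (intro mult_right_mono) auto
  then show ?thesis using \<open>k < n\<close> by (simp add: algebra_simps add_divide_distrib)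
qed

lemma error_decomposition:
  assumes n: "0 < n" and w: "\<omega> \<in> space M"
  shows "Trap n \<omega> - Avg \<omega> = (mart n \<omega> + remainder n \<omega>) / T"
proof -
  define \<delta> where "\<delta> = T / real n"
  have n\<delta>: "real n * \<delta> = T" using n by (simp add: \<delta>_def)
  have "\<delta> > 0" using n T_pos by (simp add: \<delta>_def)
  have S1: "real (Suc k) * \<delta> = real k * \<delta> + \<delta>" for k by (simp add: algebra_simps)
  have "mart n \<omega> + remainder n \<omega> = (\<Sum>k<n. \<delta> * (S (real k * \<delta>) \<omega> *
      (1 + r * \<delta> / 2 + \<sigma> * (W (real k * \<delta> + \<delta>) \<omega> - W (real k * \<delta>) \<omega>) / 2))
       - (LBINT u:{real k * \<delta>..real k * \<delta> + \<delta>}. S u \<omega>))"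
    unfolding mart_def remainder_def \<delta>_def[symmetric] add.assoc[symmetric] sum.distrib[symmetric]
    using grid_le[of _ n, folded \<delta>_def] \<open>\<delta> > 0\<close> by (intro sum.cong refl local_error w) auto
  also have "\<dots> = \<delta> * (\<Sum>k<n. S (real k * \<delta>) \<omega> *
      (1 + r * \<delta> / 2 + \<sigma> * (W (real k * \<delta> + \<delta>) \<omega> - W (real k * \<delta>) \<omega>) / 2)) - (LBINT u:{0..T}. S u \<omega>)"
    using LBINT_grid_sum[of \<delta> n "\<lambda>u. S u \<omega>"] continuous_stock[OF w] \<open>\<delta> > 0\<close> n n\<delta>
    by (simp add: sum_subtractf sum_distrib_left)
  also have "(\<Sum>k<n. S (real k * \<delta>) \<omega> *
      (1 + r * \<delta> / 2 + \<sigma> * (W (real k * \<delta> + \<delta>) \<omega> - W (real k * \<delta>) \<omega>) / 2)) = real n * Trap n \<omega>"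
    unfolding trapezoidal_eq[OF n \<delta>_def] S1 using n by simp
  also have "\<delta> * (real n * Trap n \<omega>) - (LBINT u:{0..T}. S u \<omega>) = T * (Trap n \<omega> - Avg \<omega>)"
    using T_pos n\<delta> by (simp add: average_def algebra_simps)
  finally show ?thesis using T_pos by simp
qed

lemma measurable_Avg: "Avg \<in> borel_measurable M"
  unfolding average_def[abs_def]
  by (intro borel_measurable_times borel_measurable_const borel_measurable_integral_continuous_paths
      measurable_stock continuous_stock) auto

lemma measurable_Trap:
  assumes "0 < n" shows "Trap n \<in> borel_measurable M"
proof -
  have g: "0 \<le> real k * (T / real n)" "real k * (T / real n) \<le> T" if "k \<le> n" for k
    using that T_pos assms by (auto simp: field_simps)
  show ?thesis unfolding trapezoidal_eq[OF assms refl, abs_def]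
    by (intro borel_measurable_divide borel_measurable_sum borel_measurable_times borel_measurable_add
        borel_measurable_diff borel_measurable_const measurable_stock measurable_W g) auto
qed

text \<open>\<open>n\<close> orthogonal terms, each with second moment of order
  \<open>\<delta> ^ 3\<close>, give order \<open>1 / n\<^sup>2\<close>. The constant
  \<open>5 / 2\<close> is \<open>2 * (1 + 1 / 4)\<close>, with 1 from \<open>hA\<close> and
  \<open>1 / 4\<close> from \<open>\<gamma> = \<sigma> / 2\<close>.\<close>

lemma mart_L2:
  assumes n: "0 < n"
  shows "mart n \<in> borel_measurable M" "integrable M (\<lambda>\<omega>. (mart n \<omega>)\<^sup>2)"
    "expectation (\<lambda>\<omega>. (mart n \<omega>)\<^sup>2) \<le> (5 / 2 * moment_bound 2 * \<sigma>\<^sup>2 * T ^ 3) / (real n)\<^sup>2"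
proof -
  define \<delta> where "\<delta> = T / real n"
  have \<delta>: "0 < \<delta>" "real n * \<delta> \<le> T" using n T_pos by (auto simp: \<delta>_def)
  have H: "S (real k * \<delta>) \<in> borel_measurable (F (real k * \<delta>))"
      "integrable M (\<lambda>\<omega>. (S (real k * \<delta>) \<omega>)\<^sup>2)" "expectation (\<lambda>\<omega>. (S (real k * \<delta>) \<omega>)\<^sup>2) \<le> moment_bound 2" if "k < n" for k
    using grid_le[OF that] \<delta> by (auto intro!: measurable_stock_F stock_moment simp: \<delta>_def[symmetric])
  note st = step_integral_sum_L2[OF \<delta> centered_hA H, where \<gamma>="\<sigma> / 2", unfolded \<delta>_def, folded mart_def]
  show "mart n \<in> borel_measurable M" using st(1) by simp
  show "integrable M (\<lambda>\<omega>. (mart n \<omega>)\<^sup>2)" using st(2) by simp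
  have "expectation (\<lambda>\<omega>. (mart n \<omega>)\<^sup>2) \<le> real n * ((T / real n)\<^sup>2 * (2 * moment_bound 2 * (\<sigma>\<^sup>2 * (T / real n) + (\<sigma> / 2)\<^sup>2 * (T / real n))))"
    using st(3) by simp
  also have "\<dots> = (5 / 2 * moment_bound 2 * \<sigma>\<^sup>2 * T ^ 3) / (real n)\<^sup>2"
    using n by (simp add: field_simps power2_eq_square power3_eq_cube)
  finally show "expectation (\<lambda>\<omega>. (mart n \<omega>)\<^sup>2) \<le> (5 / 2 * moment_bound 2 * \<sigma>\<^sup>2 * T ^ 3) / (real n)\<^sup>2" .
qed

text \<open>The \<open>hQ\<close> terms are orthogonal and have second moments of order
  \<open>\<delta> ^ 4\<close>, hence \<open>n * \<delta> ^ 4\<close>. The bias terms are not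
  centred, so they are summed by Cauchy-Schwarz with loss of a factor \<open>n\<close>; since each
  is of order \<open>\<delta> ^ 3\<close>, the result \<open>n\<^sup>2 * \<delta> ^ 6\<close> is
  still smaller.\<close>

lemma remainder_L2:
  assumes n: "0 < n"
  shows "remainder n \<in> borel_measurable M" "integrable M (\<lambda>\<omega>. (remainder n \<omega>)\<^sup>2)"
    "expectation (\<lambda>\<omega>. (remainder n \<omega>)\<^sup>2) \<le> (4 * moment_bound 2 * KQ * T ^ 4 + 2 * KB\<^sup>2 * T ^ 6 * moment_bound 2) / real n ^ 3"
proof -
  define \<delta> where "\<delta> = T / real n"
  have \<delta>: "0 < \<delta>" "real n * \<delta> \<le> T" "\<delta> \<le> T" using n T_pos by (auto simp: \<delta>_def field_simps)
  have H: "S (real k * \<delta>) \<in> borel_measurable (F (real k * \<delta>))"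
      "integrable M (\<lambda>\<omega>. (S (real k * \<delta>) \<omega>)\<^sup>2)" "expectation (\<lambda>\<omega>. (S (real k * \<delta>) \<omega>)\<^sup>2) \<le> moment_bound 2" if "k < n" for k
    using grid_le[OF that] \<delta> by (auto intro!: measurable_stock_F stock_moment simp: \<delta>_def[symmetric])
  define Q where "Q \<omega> = (\<Sum>k<n. step_integral hQ 0 (real k * \<delta>) \<delta> (S (real k * \<delta>)) \<omega>)" for \<omega>
  define B where "B \<omega> = (\<Sum>k<n. S (real k * \<delta>) \<omega> * bias (real k * \<delta>) \<delta>)" for \<omega>
  have rem: "remainder n \<omega> = Q \<omega> + B \<omega>" for \<omega> by (simp add: remainder_def Q_def B_def \<delta>_def)
  note st = step_integral_sum_L2[OF \<delta>(1,2) centered_hQ[OF \<delta>(3)] H, where \<gamma>=0, folded Q_def]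
  have Qm: "Q \<in> borel_measurable M" using st(1) by simp
  have Qi: "integrable M (\<lambda>\<omega>. (Q \<omega>)\<^sup>2)" using st(2) by simp
  have Qe: "expectation (\<lambda>\<omega>. (Q \<omega>)\<^sup>2) \<le> real n * (\<delta>\<^sup>2 * (2 * moment_bound 2 * (KQ * \<delta>\<^sup>2)))" using st(3) by simp
  have Hm: "S (real k * \<delta>) \<in> borel_measurable M" if "k < n" for k using H(1)[OF that] by (rule measurable_F_imp)
  have Bm: "B \<in> borel_measurable M" unfolding B_def[abs_def]
    using Hm by (intro borel_measurable_sum borel_measurable_times) auto
  have Bi: "integrable M (\<lambda>\<omega>. (B \<omega>)\<^sup>2)"
    unfolding B_def using H(2) Hm by (intro integrable_sum_L2) (auto simp: power_mult_distrib)
  have "expectation (\<lambda>\<omega>. (B \<omega>)\<^sup>2) \<le> expectation (\<lambda>\<omega>. (\<Sum>k<n. (S (real k * \<delta>) \<omega> * bias (real k * \<delta>) \<delta>)\<^sup>2) * real n)"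
  proof (rule integral_mono[OF Bi])
    show "integrable M (\<lambda>\<omega>. (\<Sum>k<n. (S (real k * \<delta>) \<omega> * bias (real k * \<delta>) \<delta>)\<^sup>2) * real n)"
      using H(2) by (auto simp: power_mult_distrib)
    show "(B \<omega>)\<^sup>2 \<le> (\<Sum>k<n. (S (real k * \<delta>) \<omega> * bias (real k * \<delta>) \<delta>)\<^sup>2) * real n" for \<omega>
      unfolding B_def using sum_squared_le_sum_of_squares[of "\<lambda>k. S (real k * \<delta>) \<omega> * bias (real k * \<delta>) \<delta>" "{..<n}"] by simp
  qed
  also have "\<dots> = (\<Sum>k<n. expectation (\<lambda>\<omega>. (S (real k * \<delta>) \<omega>)\<^sup>2) * (bias (real k * \<delta>) \<delta>)\<^sup>2) * real n"
    using H(2) by (simp add: power_mult_distrib)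
  also have "\<dots> \<le> (\<Sum>k<n. moment_bound 2 * (KB * \<delta> ^ 3)\<^sup>2) * real n"
  proof (intro mult_right_mono sum_mono mult_mono)
    fix k assume "k \<in> {..<n}"
    then show "expectation (\<lambda>\<omega>. (S (real k * \<delta>) \<omega>)\<^sup>2) \<le> moment_bound 2" using H(3) by simp
    have "\<bar>bias (real k * \<delta>) \<delta>\<bar>\<^sup>2 \<le> (KB * \<delta> ^ 3)\<^sup>2" using bias_le[of \<delta>] \<delta> by (intro power_mono) auto
    then show "(bias (real k * \<delta>) \<delta>)\<^sup>2 \<le> (KB * \<delta> ^ 3)\<^sup>2" by simp
  qed (auto simp: moment_bound_nonneg)
  finally have Be: "expectation (\<lambda>\<omega>. (B \<omega>)\<^sup>2) \<le> (real n)\<^sup>2 * (moment_bound 2 * (KB * \<delta> ^ 3)\<^sup>2)"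
    by (simp add: power2_eq_square mult_ac)
  show "remainder n \<in> borel_measurable M" unfolding rem[abs_def] using Qm Bm by simp
  show "integrable M (\<lambda>\<omega>. (remainder n \<omega>)\<^sup>2)" unfolding rem by (rule integrable_add_L2[OF Qm Bm Qi Bi])
  have "expectation (\<lambda>\<omega>. (remainder n \<omega>)\<^sup>2) \<le> 2 * expectation (\<lambda>\<omega>. (Q \<omega>)\<^sup>2) + 2 * expectation (\<lambda>\<omega>. (B \<omega>)\<^sup>2)"
    unfolding rem by (rule integral_square_add_le[OF Qm Bm Qi Bi])
  also have "\<dots> \<le> 2 * (real n * (\<delta>\<^sup>2 * (2 * moment_bound 2 * (KQ * \<delta>\<^sup>2)))) + 2 * ((real n)\<^sup>2 * (moment_bound 2 * (KB * \<delta> ^ 3)\<^sup>2))"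
    using Qe Be by (intro add_mono mult_left_mono) auto
  also have "2 * (real n * (\<delta>\<^sup>2 * (2 * moment_bound 2 * (KQ * \<delta>\<^sup>2)))) = (4 * moment_bound 2 * KQ * T ^ 4) / real n ^ 3"
    using n by (simp add: \<delta>_def field_simps eval_nat_numeral)
  also have "2 * ((real n)\<^sup>2 * (moment_bound 2 * (KB * \<delta> ^ 3)\<^sup>2)) = (2 * KB\<^sup>2 * T ^ 6 * moment_bound 2) / real n ^ 4"
    using n by (simp add: \<delta>_def field_simps eval_nat_numeral)
  also have "\<dots> \<le> (2 * KB\<^sup>2 * T ^ 6 * moment_bound 2) / real n ^ 3"
    using n T_pos by (intro divide_left_mono power_increasing mult_nonneg_nonneg) (auto simp: moment_bound_nonneg)
  finally show "expectation (\<lambda>\<omega>. (remainder n \<omega>)\<^sup>2) \<le> (4 * moment_bound 2 * KQ * T ^ 4 + 2 * KB\<^sup>2 * T ^ 6 * moment_bound 2) / real n ^ 3"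
    by (simp add: add_divide_distrib)
qed

end

section \<open>Weak convergence of the renormalised error\<close>

text \<open>The fourth moment bound makes the squares uniformly integrable:
  \<open>x\<^sup>2 \<le> min (x\<^sup>2) L + x ^ 4 / L\<close>. The truncated part tends to 0 by
  dominated convergence, the other is at most \<open>K / L\<close>.\<close>

lemma (in prob_space) tendsto_L2_of_L4_bounded:
  fixes X :: "nat \<Rightarrow> 'a \<Rightarrow> real"
  assumes m: "\<And>n. X n \<in> borel_measurable M"
    and ae: "AE \<omega> in M. (\<lambda>n. X n \<omega>) \<longlonglongrightarrow> 0"
    and i: "\<And>n. integrable M (\<lambda>\<omega>. (X n \<omega>) ^ 4)" and k: "\<And>n. expectation (\<lambda>\<omega>. (X n \<omega>) ^ 4) \<le> K"
  shows "\<And>n. integrable M (\<lambda>\<omega>. (X n \<omega>)\<^sup>2)" "(\<lambda>n. expectation (\<lambda>\<omega>. (X n \<omega>)\<^sup>2)) \<longlonglongrightarrow> 0"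
proof -
  note [measurable] = m
  have sq: "((X n \<omega>)\<^sup>2)\<^sup>2 = X n \<omega> ^ 4" for n \<omega> by (simp flip: power_mult)
  show i2: "integrable M (\<lambda>\<omega>. (X n \<omega>)\<^sup>2)" for n
    by (rule square_integrable_imp_integrable) (use i in \<open>simp_all add: sq\<close>)
  have K0: "0 \<le> K" using k[of 0] by (rule order_trans[rotated]) (intro Bochner_Integration.integral_nonneg, simp)
  show "(\<lambda>n. expectation (\<lambda>\<omega>. (X n \<omega>)\<^sup>2)) \<longlonglongrightarrow> 0"
  proof (rule LIMSEQ_I)
    fix e :: real assume e: "0 < e"
    \<comment> \<open>Chosen so that \<open>K / L \<le> e / 2\<close>; adding 1 to \<open>K\<close>
      keeps \<open>L\<close> positive when \<open>K = 0\<close>.\<close>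
    define L where "L = 2 * (K + 1) / e"
    have L: "0 < L" using e K0 by (simp add: L_def)
    have "(\<lambda>n. expectation (\<lambda>\<omega>. min ((X n \<omega>)\<^sup>2) L)) \<longlonglongrightarrow> expectation (\<lambda>\<omega>. 0)"
    proof (rule integral_dominated_convergence[where w="\<lambda>_. L"])
      show "AE \<omega> in M. (\<lambda>n. min ((X n \<omega>)\<^sup>2) L) \<longlonglongrightarrow> 0"
        using ae
      proof eventually_elim
        case (elim \<omega>)
        have "(\<lambda>n. min ((X n \<omega>)\<^sup>2) L) \<longlonglongrightarrow> min (0\<^sup>2) L" by (intro tendsto_intros elim)
        then show ?case using L by simp
      qed
    qed (use L in auto)
    then have "(\<lambda>n. expectation (\<lambda>\<omega>. min ((X n \<omega>)\<^sup>2) L)) \<longlonglongrightarrow> 0" by simp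
    then obtain n0 where n0: "\<And>n. n \<ge> n0 \<Longrightarrow> \<bar>expectation (\<lambda>\<omega>. min ((X n \<omega>)\<^sup>2) L)\<bar> < e / 2"
      using e LIMSEQ_D[of _ 0 "e / 2"] by (metis half_gt_zero diff_zero real_norm_def)
    have "expectation (\<lambda>\<omega>. (X n \<omega>)\<^sup>2) < e" if "n \<ge> n0" for n
    proof -
      have im: "integrable M (\<lambda>\<omega>. min ((X n \<omega>)\<^sup>2) L)"
        by (rule integrable_const_bound[where B=L]) (use L in auto)
      have "expectation (\<lambda>\<omega>. (X n \<omega>)\<^sup>2) \<le> expectation (\<lambda>\<omega>. min ((X n \<omega>)\<^sup>2) L + X n \<omega> ^ 4 / L)"
      proof (intro integral_mono i2)
        show "integrable M (\<lambda>\<omega>. min ((X n \<omega>)\<^sup>2) L + X n \<omega> ^ 4 / L)" using im i by simp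
        fix \<omega>
        show "(X n \<omega>)\<^sup>2 \<le> min ((X n \<omega>)\<^sup>2) L + X n \<omega> ^ 4 / L"
        proof (cases "(X n \<omega>)\<^sup>2 \<le> L")
          case False
          then have "(X n \<omega>)\<^sup>2 * L \<le> (X n \<omega>)\<^sup>2 * (X n \<omega>)\<^sup>2" by (intro mult_left_mono) auto
          also have "\<dots> = X n \<omega> ^ 4" using sq[of n \<omega>] by (simp add: power2_eq_square)
          finally have "(X n \<omega>)\<^sup>2 \<le> X n \<omega> ^ 4 / L" using L by (simp add: field_simps)
          then show ?thesis using False L by simp
        qed (use L in simp)
      qed
      also have "\<dots> = expectation (\<lambda>\<omega>. min ((X n \<omega>)\<^sup>2) L) + expectation (\<lambda>\<omega>. X n \<omega> ^ 4) / L"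
        using im i by simp
      also have "expectation (\<lambda>\<omega>. X n \<omega> ^ 4) / L \<le> K / L" using k L by (intro divide_right_mono) auto
      also have "K / L \<le> e / 2" using e K0 by (simp add: L_def field_simps)
      finally show ?thesis using n0[OF that] by linarith
    qed
    then show "\<exists>no. \<forall>n\<ge>no. norm (expectation (\<lambda>\<omega>. (X n \<omega>)\<^sup>2) - 0) < e"
      by (intro exI[of _ n0]) auto
  qed
qed

text \<open>Passes from the real exponent \<open>p\<close> to an even integer exponent, for which
  moments of the stock and of the scheme are available. The constant 1 covers
  \<open>\<bar>x\<bar> \<le> 1\<close>, where raising the exponent decreases the power.\<close>

lemma powr_fourth_le:
  fixes x p :: real
  assumes p: "0 < p" and q: "4 * p \<le> real q" "even q"
  shows "(\<bar>x\<bar> powr p) ^ 4 \<le> 1 + x ^ q"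
proof (cases "\<bar>x\<bar> \<le> 1")
  case True
  have "\<bar>x\<bar> powr p \<le> 1" using True p by (simp add: powr_le1)
  then have "(\<bar>x\<bar> powr p) ^ 4 \<le> 1" by (simp add: power_le_one)
  then show ?thesis using q(2) by (simp add: zero_le_even_power add_increasing2)
next
  case False
  have "(\<bar>x\<bar> powr p) ^ 4 = (\<bar>x\<bar> powr p) powr 4" using False by (subst powr_numeral) auto
  also have "\<dots> = \<bar>x\<bar> powr (4 * p)" by (simp add: powr_powr mult.commute)
  also have "\<dots> \<le> \<bar>x\<bar> powr real q" using False q by (intro powr_mono) auto
  also have "\<dots> = \<bar>x\<bar> ^ q" using False by (intro powr_realpow) auto
  also have "\<dots> = x ^ q" by (rule power_even_abs[OF q(2)])
  finally show ?thesis by simp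
qed

text \<open>The bound \<open>(x + y + z + w)\<^sup>2 \<le> 4 * (x\<^sup>2 + y\<^sup>2 + z\<^sup>2 +
  w\<^sup>2)\<close> is used twice; its constant enters squared the first time, so
  \<open>64 = 16 * 4\<close>.\<close>

lemma sum4_fourth_le:
  fixes a b c d :: real
  shows "(a + b + c + d) ^ 4 \<le> 64 * (a ^ 4 + b ^ 4 + c ^ 4 + d ^ 4)"
proof -
  have q: "(x + y + (z + w))\<^sup>2 \<le> 4 * (x\<^sup>2 + y\<^sup>2 + (z\<^sup>2 + w\<^sup>2))" for x y z w :: real
  proof -
    have "(x + y + (z + w))\<^sup>2 \<le> 2 * (x + y)\<^sup>2 + 2 * (z + w)\<^sup>2" by (rule square_add_le)
    also have "\<dots> \<le> 2 * (2 * x\<^sup>2 + 2 * y\<^sup>2) + 2 * (2 * z\<^sup>2 + 2 * w\<^sup>2)"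
      by (intro add_mono mult_left_mono square_add_le) auto
    finally show ?thesis by simp
  qed
  have "((a + b + (c + d))\<^sup>2)\<^sup>2 \<le> (4 * (a\<^sup>2 + b\<^sup>2 + (c\<^sup>2 + d\<^sup>2)))\<^sup>2"
    by (intro power_mono q) auto
  also have "\<dots> = 16 * (a\<^sup>2 + b\<^sup>2 + (c\<^sup>2 + d\<^sup>2))\<^sup>2"
    unfolding power_mult_distrib by simp
  also have "\<dots> \<le> 16 * (4 * ((a\<^sup>2)\<^sup>2 + (b\<^sup>2)\<^sup>2 + ((c\<^sup>2)\<^sup>2 + (d\<^sup>2)\<^sup>2)))"
    by (intro mult_left_mono q) auto
  finally show ?thesis by (simp add: add.assoc flip: power_mult)
qed

section \<open>Second moments and almost sure convergence of the error\<close>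

context black_scholes
begin

definition "KM = 5 / 2 * moment_bound 2 * \<sigma>\<^sup>2 * T ^ 3"
definition "KR = 4 * moment_bound 2 * KQ * T ^ 4 + 2 * KB\<^sup>2 * T ^ 6 * moment_bound 2"
definition "KE = 2 * (KM + KR) / T\<^sup>2"

lemma K_nonneg: "0 \<le> KM" "0 \<le> KR" "0 \<le> KE"
proof -
  have "0 \<le> KQ" unfolding KQ_def using T_pos by simp
  then show "0 \<le> KM" "0 \<le> KR" using T_pos moment_bound_nonneg[of 2] by (auto simp: KM_def KR_def)
  then show "0 \<le> KE" by (simp add: KE_def)
qed

definition "U n \<omega> = real n * (Trap n \<omega> - Avg \<omega>)"

lemma error_L2:
  assumes n: "0 < n"
  shows "integrable M (\<lambda>\<omega>. (Trap n \<omega> - Avg \<omega>)\<^sup>2)"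
    "expectation (\<lambda>\<omega>. (Trap n \<omega> - Avg \<omega>)\<^sup>2) \<le> KE / (real n)\<^sup>2"
proof -
  note m = mart_L2[OF n] and r = remainder_L2[OF n]
  have eq: "(Trap n \<omega> - Avg \<omega>)\<^sup>2 = (mart n \<omega> + remainder n \<omega>)\<^sup>2 / T\<^sup>2" if "\<omega> \<in> space M" for \<omega>
    unfolding error_decomposition[OF n that] by (simp add: power_divide)
  have "integrable M (\<lambda>\<omega>. (mart n \<omega> + remainder n \<omega>)\<^sup>2 / T\<^sup>2)"
    using integrable_add_L2[OF m(1) r(1) m(2) r(2)] by simp
  then show "integrable M (\<lambda>\<omega>. (Trap n \<omega> - Avg \<omega>)\<^sup>2)"
    by (rule Bochner_Integration.integrable_cong[THEN iffD1, OF refl, rotated]) (simp add: eq)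
  have "expectation (\<lambda>\<omega>. (Trap n \<omega> - Avg \<omega>)\<^sup>2) = expectation (\<lambda>\<omega>. (mart n \<omega> + remainder n \<omega>)\<^sup>2 / T\<^sup>2)"
    by (rule Bochner_Integration.integral_cong) (simp_all add: eq)
  also have "\<dots> = expectation (\<lambda>\<omega>. (mart n \<omega> + remainder n \<omega>)\<^sup>2) / T\<^sup>2" by simp
  also have "\<dots> \<le> (2 * (KM / (real n)\<^sup>2) + 2 * (KR / real n ^ 3)) / T\<^sup>2"
    using integral_square_add_le[OF m(1) r(1) m(2) r(2)] m(3) r(3)
    unfolding KM_def[symmetric] KR_def[symmetric] by (intro divide_right_mono) auto
  also have "\<dots> \<le> (2 * (KM / (real n)\<^sup>2) + 2 * (KR / (real n)\<^sup>2)) / T\<^sup>2"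
    using n K_nonneg by (intro divide_right_mono add_left_mono mult_left_mono divide_left_mono power_increasing) auto
  also have "\<dots> = KE / (real n)\<^sup>2" unfolding KE_def by (simp add: add_divide_distrib mult.commute)
  finally show "expectation (\<lambda>\<omega>. (Trap n \<omega> - Avg \<omega>)\<^sup>2) \<le> KE / (real n)\<^sup>2" .
qed

text \<open>Holds for \<open>n = 0\<close> as well, where the factor \<open>real n\<close>
  annihilates the degenerate scheme; the results on weak convergence take bounds for all
  indices.\<close>

lemma U_L2:
  "U n \<in> borel_measurable M" "integrable M (\<lambda>\<omega>. (U n \<omega>)\<^sup>2)" "expectation (\<lambda>\<omega>. (U n \<omega>)\<^sup>2) \<le> KE"
proof -
  have "U n \<in> borel_measurable M \<and> integrable M (\<lambda>\<omega>. (U n \<omega>)\<^sup>2) \<and> expectation (\<lambda>\<omega>. (U n \<omega>)\<^sup>2) \<le> KE"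
  proof (cases "n = 0")
    case True
    then have "U n = (\<lambda>_. 0)" by (simp add: U_def fun_eq_iff)
    then show ?thesis using K_nonneg by simp
  next
    case False
    then have n: "0 < n" by simp
    have "expectation (\<lambda>\<omega>. (U n \<omega>)\<^sup>2) = (real n)\<^sup>2 * expectation (\<lambda>\<omega>. (Trap n \<omega> - Avg \<omega>)\<^sup>2)"
      by (simp add: U_def power_mult_distrib)
    also have "\<dots> \<le> (real n)\<^sup>2 * (KE / (real n)\<^sup>2)" using error_L2(2)[OF n] by (intro mult_left_mono) auto
    finally show ?thesis using error_L2(1)[OF n] measurable_Trap[OF n] measurable_Avg n
      by (auto simp: U_def[abs_def] power_mult_distrib)
  qed
  then show "U n \<in> borel_measurable M" "integrable M (\<lambda>\<omega>. (U n \<omega>)\<^sup>2)" "expectation (\<lambda>\<omega>. (U n \<omega>)\<^sup>2) \<le> KE" by auto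
qed

text \<open>The second moments of the errors are bounded by \<open>KE / n\<^sup>2\<close>, hence
  summable. The series of squared errors therefore has finite expectation, converges almost surely,
  and its terms tend to 0 along the full sequence.\<close>

lemma AE_Trap_tendsto_Avg: "AE \<omega> in M. (\<lambda>n. Trap n \<omega>) \<longlonglongrightarrow> Avg \<omega>"
proof -
  define d where "d n \<omega> = (Trap (Suc n) \<omega> - Avg \<omega>)\<^sup>2" for n \<omega>
  have [measurable]: "d n \<in> borel_measurable M" for n
    unfolding d_def[abs_def] using measurable_Trap[of "Suc n"] measurable_Avg by simp
  have "(\<integral>\<^sup>+\<omega>. (\<Sum>n. ennreal (d n \<omega>)) \<partial>M) = (\<Sum>n. \<integral>\<^sup>+\<omega>. ennreal (d n \<omega>) \<partial>M)"
    by (rule nn_integral_suminf) simp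
  also have "\<dots> \<le> (\<Sum>n. ennreal (KE * inverse ((real (Suc n))\<^sup>2)))"
  proof (intro suminf_le allI)
    fix n
    have "(\<integral>\<^sup>+\<omega>. ennreal (d n \<omega>) \<partial>M) = ennreal (expectation (d n))"
      using error_L2(1)[of "Suc n"] by (intro nn_integral_eq_integral) (auto simp: d_def[abs_def])
    then show "(\<integral>\<^sup>+\<omega>. ennreal (d n \<omega>) \<partial>M) \<le> ennreal (KE * inverse ((real (Suc n))\<^sup>2))"
      using error_L2(2)[of "Suc n"] by (simp add: d_def[abs_def] divide_inverse ennreal_leI)
  qed auto
  also have "\<dots> < top"
  proof -
    have "summable (\<lambda>n. KE * inverse ((real (Suc n))\<^sup>2))"
      using inverse_power_summable[of 2, where 'a=real]
      by (intro summable_mult) (subst summable_Suc_iff, simp)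
    then have "(\<Sum>n. ennreal (KE * inverse ((real (Suc n))\<^sup>2))) \<noteq> top"
      by (rule ennreal_suminf_neq_top) (simp add: K_nonneg)
    then show ?thesis by (simp only: less_top)
  qed
  finally have "AE \<omega> in M. (\<Sum>n. ennreal (d n \<omega>)) \<noteq> \<infinity>"
    by (intro nn_integral_PInf_AE) (auto simp: less_top)
  then show ?thesis
  proof eventually_elim
    case (elim \<omega>)
    have "summable (\<lambda>n. d n \<omega>)" using elim by (intro summable_suminf_not_top) (auto simp: d_def)
    then have "(\<lambda>n. sqrt (d n \<omega>)) \<longlonglongrightarrow> sqrt 0" by (intro tendsto_real_sqrt summable_LIMSEQ_zero)
    then have "(\<lambda>n. \<bar>Trap (Suc n) \<omega> - Avg \<omega>\<bar>) \<longlonglongrightarrow> 0" by (simp add: d_def)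
    then have "(\<lambda>n. Trap (Suc n) \<omega>) \<longlonglongrightarrow> Avg \<omega>" by (simp add: tendsto_rabs_zero_iff LIM_zero_iff)
    then show ?case by (rule LIMSEQ_imp_Suc)
  qed
qed

section \<open>Testing the error against functions of the grid values\<close>

text \<open>The scheme as a function of the grid values of \<open>W\<close> alone. In this form it
  is measurable on a finite product, as reversal requires, and later on the product space of
  paths.\<close>

definition "trap_functional n y = (\<Sum>k<n. S0 * exp ((r - \<sigma>\<^sup>2 / 2) * (real k * (T / real n)) + \<sigma> * y k) *
    (1 + r * (T / real n) / 2 + \<sigma> * (y (Suc k) - y k) / 2)) / real n"

lemma Trap_eq_functional:
  "0 < n \<Longrightarrow> Trap n \<omega> = trap_functional n (\<lambda>k. W (real k * (T / real n)) \<omega>)"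
  unfolding trap_functional_def by (subst trapezoidal_eq) (auto simp: stock_def)

text \<open>On step \<open>k\<close> the leading error is \<open>\<sigma> * S\<close> at the left
  end times the integral treated in \<open>grid_functional_orthogonal\<close>. That factor is itself
  a function of the grid, so it is merged with \<open>\<phi>\<close> and orthogonality applies to
  each step separately.\<close>

lemma expectation_grid_mart:
  assumes n: "0 < n" and \<phi>: "\<phi> \<in> borel_measurable borel" "\<And>x. \<bar>\<phi> x\<bar> \<le> (1::real)"
  shows "expectation (\<lambda>\<omega>. \<phi> (S T \<omega>, Trap n \<omega>) * mart n \<omega>) = 0"
proof -
  note \<phi>(1)[measurable]
  define \<delta> where "\<delta> = T / real n"
  have \<delta>: "0 < \<delta>" "real n * \<delta> = T" using n T_pos by (auto simp: \<delta>_def)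
  have \<delta>': "real n * \<delta> \<le> T" using \<delta> by simp
  note gl = grid_le[of _ n, folded \<delta>_def]
  have Tm: "Trap n \<in> borel_measurable M" by (rule measurable_Trap[OF n])
  have STm: "S T \<in> borel_measurable M" using T_pos by (intro measurable_stock) auto
  define Z where "Z \<omega> = \<phi> (S T \<omega>, Trap n \<omega>)" for \<omega>
  have Zm: "Z \<in> borel_measurable M"
    unfolding Z_def[abs_def] using Tm STm by measurable
  have Zb: "\<bar>Z \<omega>\<bar> \<le> 1" for \<omega> unfolding Z_def by (rule \<phi>)
  have dT: "\<delta> \<le> T" using gl[of 0] n by simp
  have H: "S (real k * \<delta>) \<in> borel_measurable (F (real k * \<delta>))"
      "integrable M (\<lambda>\<omega>. (S (real k * \<delta>) \<omega>)\<^sup>2)" "expectation (\<lambda>\<omega>. (S (real k * \<delta>) \<omega>)\<^sup>2) \<le> moment_bound 2" if "k < n" for k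
    using gl[OF that] \<delta>(1) by (auto intro!: measurable_stock_F stock_moment)
  have X: "step_integral hA (\<sigma> / 2) (real k * \<delta>) \<delta> (S (real k * \<delta>)) \<in> borel_measurable M"
     "integrable M (\<lambda>\<omega>. (step_integral hA (\<sigma> / 2) (real k * \<delta>) \<delta> (S (real k * \<delta>)) \<omega>)\<^sup>2)" if "k < n" for k
    using step_integral_L2(1,2)[OF _ _ gl[OF that] centered_hA H[OF that]] \<delta> measurable_F_imp by auto
  have zero: "expectation (\<lambda>\<omega>. Z \<omega> * step_integral hA (\<sigma> / 2) (real k * \<delta>) \<delta> (S (real k * \<delta>)) \<omega>) = 0" if k: "k < n" for k
  proof -
    \<comment> \<open>Written in the grid values of \<open>W - W 0\<close>, as the reversal argument
      demands; since \<open>W 0 = 0\<close> only almost surely, the identification with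
      \<open>Z\<close> times the stock is an almost sure one.\<close>
    define \<Phi> where "\<Phi> y = \<phi> (S0 * exp ((r - \<sigma>\<^sup>2 / 2) * T + \<sigma> * y n), trap_functional n y)
       * (S0 * exp ((r - \<sigma>\<^sup>2 / 2) * (real k * \<delta>) + \<sigma> * y k) * \<sigma>)" for y :: "nat \<Rightarrow> real"
    have c: "(\<lambda>y. y j) \<in> borel_measurable (\<Pi>\<^sub>M i\<in>{..n}. (borel :: real measure))" if "j \<le> n" for j
      using that by (intro measurable_component_singleton) auto
    have tm: "trap_functional n \<in> borel_measurable (\<Pi>\<^sub>M i\<in>{..n}. (borel :: real measure))"
      unfolding trap_functional_def[abs_def]
      by (intro borel_measurable_divide borel_measurable_sum borel_measurable_times borel_measurable_add
          borel_measurable_diff borel_measurable_const borel_measurable_exp c) auto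
    have em: "(\<lambda>y. S0 * exp (b + \<sigma> * y j)) \<in> borel_measurable (\<Pi>\<^sub>M i\<in>{..n}. (borel :: real measure))" if "j \<le> n" for j b
      by (intro borel_measurable_times borel_measurable_add borel_measurable_const c that
          measurable_compose[OF _ borel_measurable_exp])
    have "(\<lambda>y. \<phi> (S0 * exp ((r - \<sigma>\<^sup>2 / 2) * T + \<sigma> * y n), trap_functional n y)) \<in> borel_measurable (\<Pi>\<^sub>M i\<in>{..n}. (borel :: real measure))"
      by (rule measurable_compose[OF _ \<phi>(1)]) (intro borel_measurable_Pair em tm order_refl)
    then have \<Phi>m: "\<Phi> \<in> borel_measurable (\<Pi>\<^sub>M i\<in>{..n}. borel)"
      unfolding \<Phi>_def[abs_def] using em[of k] k by (intro borel_measurable_times) auto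
    define Z' where "Z' \<omega> = \<Phi> (\<lambda>j\<in>{..n}. W (real j * \<delta>) \<omega> - W 0 \<omega>)" for \<omega>
    have Z'm: "Z' \<in> borel_measurable M"
    proof -
      have "real j * \<delta> \<le> T" if "j \<le> n" for j
      proof -
        have "real j * \<delta> \<le> real n * \<delta>" using that \<delta>(1) by (intro mult_right_mono) auto
        then show ?thesis using \<delta>(2) by simp
      qed
      then have "(\<lambda>\<omega>. \<lambda>j\<in>{..n}. W (real j * \<delta>) \<omega> - W 0 \<omega>) \<in> M \<rightarrow>\<^sub>M (\<Pi>\<^sub>M i\<in>{..n}. borel)"
        using \<delta> T_pos by (intro measurable_restrict borel_measurable_diff measurable_W) auto
      from measurable_compose[OF this \<Phi>m] show ?thesis unfolding Z'_def[abs_def] .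
    qed
    have Z'ae: "AE \<omega> in M. Z' \<omega> = Z \<omega> * S (real k * \<delta>) \<omega> * \<sigma>"
      using AE_W_0
    proof eventually_elim
      case (elim \<omega>)
      have "trap_functional n (\<lambda>j\<in>{..n}. W (real j * \<delta>) \<omega> - W 0 \<omega>) = Trap n \<omega>"
        unfolding Trap_eq_functional[OF n] trap_functional_def \<delta>_def[symmetric]
        by (intro arg_cong2[where f="(/)"] refl sum.cong) (auto simp: elim)
      moreover have "S0 * exp ((r - \<sigma>\<^sup>2 / 2) * (real j * \<delta>) + \<sigma> * (\<lambda>j\<in>{..n}. W (real j * \<delta>) \<omega> - W 0 \<omega>) j) = S (real j * \<delta>) \<omega>" if "j \<le> n" for j
        using that elim by (simp add: stock_def)
      from this[of n] this[of k] have "S0 * exp ((r - \<sigma>\<^sup>2 / 2) * T + \<sigma> * (\<lambda>j\<in>{..n}. W (real j * \<delta>) \<omega> - W 0 \<omega>) n) = S T \<omega>"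
        "S0 * exp ((r - \<sigma>\<^sup>2 / 2) * (real k * \<delta>) + \<sigma> * (\<lambda>j\<in>{..n}. W (real j * \<delta>) \<omega> - W 0 \<omega>) k) = S (real k * \<delta>) \<omega>"
        using k by (simp_all only: \<delta>(2) order_refl less_imp_le)
      ultimately show ?case unfolding Z'_def \<Phi>_def Z_def by (simp only: mult.assoc)
    qed
    have "integrable M (\<lambda>\<omega>. (Z \<omega> * S (real k * \<delta>) \<omega> * \<sigma>)\<^sup>2)"
    proof (rule Bochner_Integration.integrable_bound)
      show "integrable M (\<lambda>\<omega>. \<sigma>\<^sup>2 * (S (real k * \<delta>) \<omega>)\<^sup>2)" using H(2)[OF k] by simp
      show "AE \<omega> in M. norm ((Z \<omega> * S (real k * \<delta>) \<omega> * \<sigma>)\<^sup>2) \<le> norm (\<sigma>\<^sup>2 * (S (real k * \<delta>) \<omega>)\<^sup>2)"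
      proof (intro AE_I2)
        fix \<omega>
        have "(Z \<omega>)\<^sup>2 \<le> 1" using Zb[of \<omega>] by (simp add: abs_square_le_1)
        then have "(Z \<omega>)\<^sup>2 * (\<sigma>\<^sup>2 * (S (real k * \<delta>) \<omega>)\<^sup>2) \<le> 1 * (\<sigma>\<^sup>2 * (S (real k * \<delta>) \<omega>)\<^sup>2)"
          by (intro mult_right_mono) auto
        then show "norm ((Z \<omega> * S (real k * \<delta>) \<omega> * \<sigma>)\<^sup>2) \<le> norm (\<sigma>\<^sup>2 * (S (real k * \<delta>) \<omega>)\<^sup>2)"
          by (simp add: power_mult_distrib mult_ac)
      qed
      show "(\<lambda>\<omega>. (Z \<omega> * S (real k * \<delta>) \<omega> * \<sigma>)\<^sup>2) \<in> borel_measurable M"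
        using Zm measurable_F_imp[OF H(1)[OF k]] by measurable
    qed
    then have Z'2: "integrable M (\<lambda>\<omega>. (Z' \<omega>)\<^sup>2)"
      by (rule Bochner_Integration.integrable_cong_AE_imp) (use Z'm Z'ae in auto)
    define c where "c u \<omega> = (W (real k * \<delta> + \<delta>) \<omega> - W (real k * \<delta>) \<omega>) / 2 - (W u \<omega> - W (real k * \<delta>) \<omega>)" for u \<omega>
    have si: "step_integral hA (\<sigma> / 2) (real k * \<delta>) \<delta> (S (real k * \<delta>)) \<omega>
      = (S (real k * \<delta>) \<omega> * \<sigma>) * (LBINT u:{real k * \<delta>..real k * \<delta> + \<delta>}. c u \<omega>)" for \<omega>
    proof -
      have "step hA (\<sigma> / 2) (real k * \<delta>) \<delta> (S (real k * \<delta>)) u \<omega> = (S (real k * \<delta>) \<omega> * \<sigma>) * c u \<omega>" for u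
        by (simp add: step_def hA_def c_def field_simps)
      then show ?thesis unfolding step_integral_def by (simp only: set_integral_mult_right)
    qed
    have cm: "(\<lambda>\<omega>. LBINT u:{real k * \<delta>..real k * \<delta> + \<delta>}. c u \<omega>) \<in> borel_measurable M"
    proof (rule borel_measurable_integral_continuous_paths)
      have s: "0 \<le> real k * \<delta>" "real k * \<delta> + \<delta> \<le> T" using gl[OF k] \<delta> by auto
      show "c u \<in> borel_measurable M" if "u \<in> {real k * \<delta>..real k * \<delta> + \<delta>}" for u
      proof -
        have "0 \<le> u" "u \<le> T" using that s unfolding atLeastAtMost_iff by linarith+
        then show ?thesis unfolding c_def[abs_def] using s \<delta>(1)
          by (intro borel_measurable_diff borel_measurable_divide measurable_W borel_measurable_const) linarith+
      qed
      show "continuous_on {real k * \<delta>..real k * \<delta> + \<delta>} (\<lambda>u. c u \<omega>)" if "\<omega> \<in> space M" for \<omega>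
        unfolding c_def using continuous_on_subset[OF continuous_W[OF that], of "{real k * \<delta>..real k * \<delta> + \<delta>}"] s
        by (intro continuous_intros) auto
    qed
    have "expectation (\<lambda>\<omega>. Z \<omega> * step_integral hA (\<sigma> / 2) (real k * \<delta>) \<delta> (S (real k * \<delta>)) \<omega>)
      = expectation (\<lambda>\<omega>. Z' \<omega> * (LBINT u:{real k * \<delta>..real k * \<delta> + \<delta>}. c u \<omega>))"
    proof (rule integral_cong_AE)
      show "AE \<omega> in M. Z \<omega> * step_integral hA (\<sigma> / 2) (real k * \<delta>) \<delta> (S (real k * \<delta>)) \<omega> = Z' \<omega> * (LBINT u:{real k * \<delta>..real k * \<delta> + \<delta>}. c u \<omega>)"
        using Z'ae by eventually_elim (simp only: si mult.assoc)
    qed (use Zm X(1)[OF k] Z'm cm in auto)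
    also have "\<dots> = 0"
      unfolding c_def by (rule grid_functional_orthogonal[OF \<delta>(1) \<delta>' k \<Phi>m Z'_def Z'2])
    finally show ?thesis .
  qed
  have Z2: "integrable M (\<lambda>\<omega>. (Z \<omega>)\<^sup>2)"
    using Zm Zb by (intro integrable_const_bound[where B=1]) (auto simp: abs_square_le_1)
  have "expectation (\<lambda>\<omega>. Z \<omega> * mart n \<omega>)
     = (\<Sum>k<n. expectation (\<lambda>\<omega>. Z \<omega> * step_integral hA (\<sigma> / 2) (real k * \<delta>) \<delta> (S (real k * \<delta>)) \<omega>))"
    unfolding mart_def \<delta>_def[symmetric] sum_distrib_left
    by (intro Bochner_Integration.integral_sum integrable_mult_L2 Zm X Z2) auto
  also have "\<dots> = 0" using zero by simp
  finally show ?thesis unfolding Z_def .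
qed

text \<open>The leading part contributes exactly 0, and the remainder, of order
  \<open>n powr (-3/2)\<close> in L2, is multiplied only by \<open>n / T\<close>.\<close>

lemma expectation_grid_U_tendsto:
  assumes \<phi>: "continuous_on UNIV \<phi>" "\<And>x. \<bar>\<phi> x\<bar> \<le> (1::real)"
  shows "(\<lambda>n. expectation (\<lambda>\<omega>. \<phi> (S T \<omega>, Trap n \<omega>) * U n \<omega>)) \<longlonglongrightarrow> 0"
proof (rule Lim_null_comparison)
  have \<phi>m[measurable]: "\<phi> \<in> borel_measurable borel" using \<phi>(1) by (rule borel_measurable_continuous_onI)
  have STm: "S T \<in> borel_measurable M" using T_pos by (intro measurable_stock) auto
  show "\<forall>\<^sub>F n in sequentially. norm (expectation (\<lambda>\<omega>. \<phi> (S T \<omega>, Trap n \<omega>) * U n \<omega>)) \<le> sqrt (KR * inverse (real n)) / T"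
    using eventually_gt_at_top[of 0]
  proof eventually_elim
    case (elim n)
    then have n: "0 < n" by simp
    note m = mart_L2[OF n] and r = remainder_L2[OF n, folded KR_def]
    have Tm: "Trap n \<in> borel_measurable M" by (rule measurable_Trap[OF n])
    define Z where "Z \<omega> = \<phi> (S T \<omega>, Trap n \<omega>)" for \<omega>
    have Zm: "Z \<in> borel_measurable M"
      unfolding Z_def[abs_def] using Tm STm by measurable
    have Zb: "\<bar>Z \<omega>\<bar> \<le> 1" for \<omega> unfolding Z_def by (rule \<phi>)
    have Z2: "integrable M (\<lambda>\<omega>. (Z \<omega>)\<^sup>2)"
      using Zm Zb by (intro integrable_const_bound[where B=1]) (auto simp: abs_square_le_1)
    have "expectation (\<lambda>\<omega>. (Z \<omega>)\<^sup>2) \<le> expectation (\<lambda>\<omega>. 1)"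
      using Z2 Zb by (intro integral_mono) (auto simp: abs_square_le_1)
    then have Z1: "expectation (\<lambda>\<omega>. (Z \<omega>)\<^sup>2) \<le> 1" by (simp add: prob_space)
    have "expectation (\<lambda>\<omega>. Z \<omega> * U n \<omega>) = expectation (\<lambda>\<omega>. (real n / T) * (Z \<omega> * mart n \<omega> + Z \<omega> * remainder n \<omega>))"
      by (rule Bochner_Integration.integral_cong) (auto simp: U_def error_decomposition[OF n] field_simps)
    also have "\<dots> = (real n / T) * (expectation (\<lambda>\<omega>. Z \<omega> * mart n \<omega>) + expectation (\<lambda>\<omega>. Z \<omega> * remainder n \<omega>))"
      using integrable_mult_L2[OF Zm m(1) Z2 m(2)] integrable_mult_L2[OF Zm r(1) Z2 r(2)] by simp
    also have "expectation (\<lambda>\<omega>. Z \<omega> * mart n \<omega>) = 0"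
      unfolding Z_def by (rule expectation_grid_mart[OF n \<phi>m \<phi>(2)])
    finally have "\<bar>expectation (\<lambda>\<omega>. Z \<omega> * U n \<omega>)\<bar> = (real n / T) * \<bar>expectation (\<lambda>\<omega>. Z \<omega> * remainder n \<omega>)\<bar>"
      using T_pos by (simp add: abs_mult)
    also have "\<dots> \<le> (real n / T) * (sqrt 1 * sqrt (KR / real n ^ 3))"
      using T_pos by (intro mult_left_mono cauchy_schwarz_integral_bound Zm r Z2 Z1) auto
    also have "\<dots> = sqrt ((real n)\<^sup>2) * sqrt (KR / real n ^ 3) / T" by simp
    also have "\<dots> = sqrt (KR * inverse (real n)) / T"
      unfolding real_sqrt_mult[symmetric] using n by (simp add: field_simps eval_nat_numeral)
    finally show ?case by (simp add: Z_def)
  qed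
  have "(\<lambda>n. sqrt (KR * inverse (real n)) / T) \<longlonglongrightarrow> sqrt (KR * 0) / T"
    by (intro tendsto_intros lim_inverse_n) (use T_pos in simp)
  then show "(\<lambda>n. sqrt (KR * inverse (real n)) / T) \<longlonglongrightarrow> 0" by simp
qed

text \<open>The average is not a function of the grid, so it is replaced by the scheme. By
  continuity of \<open>\<phi>\<close> the change \<open>D n\<close> tends to 0 almost surely; being
  bounded by 2 it does so in L2, which suffices against \<open>U n\<close>. Indices are shifted by
  one to stay within the range where the scheme is defined properly.\<close>

lemma weak_null_continuous:
  assumes \<phi>: "continuous_on UNIV \<phi>" "\<And>x. \<bar>\<phi> x\<bar> \<le> (1::real)"
  shows "(\<lambda>n. expectation (\<lambda>\<omega>. \<phi> (S T \<omega>, Avg \<omega>) * U n \<omega>)) \<longlonglongrightarrow> 0"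
proof -
  have \<phi>m[measurable]: "\<phi> \<in> borel_measurable borel" using \<phi>(1) by (rule borel_measurable_continuous_onI)
  have STm: "S T \<in> borel_measurable M" using T_pos by (intro measurable_stock) auto
  define D where "D n \<omega> = \<phi> (S T \<omega>, Avg \<omega>) - \<phi> (S T \<omega>, Trap n \<omega>)" for n \<omega>
  have Am: "(\<lambda>\<omega>. \<phi> (S T \<omega>, Avg \<omega>)) \<in> borel_measurable M"
    using STm measurable_Avg by measurable
  have Tm: "(\<lambda>\<omega>. \<phi> (S T \<omega>, Trap n \<omega>)) \<in> borel_measurable M" if "0 < n" for n
    using STm measurable_Trap[OF that] by measurable
  have Dm: "D n \<in> borel_measurable M" if "0 < n" for n
    unfolding D_def[abs_def] using Am Tm[OF that] by measurable
  have Db: "\<bar>D n \<omega>\<bar> \<le> 2" for n \<omega>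
    unfolding D_def using \<phi>(2)[of "(S T \<omega>, Avg \<omega>)"] \<phi>(2)[of "(S T \<omega>, Trap n \<omega>)"] by linarith
  have D4: "(D n \<omega>)\<^sup>2 \<le> 4" for n \<omega> using power_mono[OF Db[of n \<omega>], of 2] by simp
  have D2: "integrable M (\<lambda>\<omega>. (D n \<omega>)\<^sup>2)" if "0 < n" for n
    using Dm[OF that] D4 by (intro integrable_const_bound[where B=4]) auto
  have Dlim: "(\<lambda>n. expectation (\<lambda>\<omega>. (D (Suc n) \<omega>)\<^sup>2)) \<longlonglongrightarrow> expectation (\<lambda>\<omega>. 0)"
  proof (rule integral_dominated_convergence[where w="\<lambda>_. 4"])
    show "AE \<omega> in M. (\<lambda>n. (D (Suc n) \<omega>)\<^sup>2) \<longlonglongrightarrow> 0"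
      using AE_Trap_tendsto_Avg
    proof eventually_elim
      case (elim \<omega>)
      have "isCont \<phi> (S T \<omega>, Avg \<omega>)" using \<phi>(1) by (simp add: continuous_on_eq_continuous_at)
      then have "(\<lambda>n. \<phi> (S T \<omega>, Trap n \<omega>)) \<longlonglongrightarrow> \<phi> (S T \<omega>, Avg \<omega>)"
        by (rule isCont_tendsto_compose) (intro tendsto_intros elim)
      then have "(\<lambda>n. (D n \<omega>)\<^sup>2) \<longlonglongrightarrow> (\<phi> (S T \<omega>, Avg \<omega>) - \<phi> (S T \<omega>, Avg \<omega>))\<^sup>2"
        unfolding D_def by (intro tendsto_intros)
      then have "(\<lambda>n. (D n \<omega>)\<^sup>2) \<longlonglongrightarrow> 0" by simp
      then show ?case by (rule LIMSEQ_Suc)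
    qed
  qed (use Dm D4 in auto)
  have lim1: "(\<lambda>n. expectation (\<lambda>\<omega>. \<phi> (S T \<omega>, Trap (Suc n) \<omega>) * U (Suc n) \<omega>)) \<longlonglongrightarrow> 0"
    using expectation_grid_U_tendsto[OF \<phi>] by (rule LIMSEQ_Suc)
  have lim2: "(\<lambda>n. expectation (\<lambda>\<omega>. D (Suc n) \<omega> * U (Suc n) \<omega>)) \<longlonglongrightarrow> 0"
  proof (rule Lim_null_comparison)
    show "\<forall>\<^sub>F n in sequentially. norm (expectation (\<lambda>\<omega>. D (Suc n) \<omega> * U (Suc n) \<omega>))
      \<le> sqrt (expectation (\<lambda>\<omega>. (D (Suc n) \<omega>)\<^sup>2)) * sqrt KE"
      unfolding real_norm_def by (intro always_eventually allI cauchy_schwarz_integral_bound U_L2 Dm D2 order_refl) auto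
    have "(\<lambda>n. sqrt (expectation (\<lambda>\<omega>. (D (Suc n) \<omega>)\<^sup>2)) * sqrt KE) \<longlonglongrightarrow> sqrt (expectation (\<lambda>\<omega>. 0)) * sqrt KE"
      by (intro tendsto_intros Dlim)
    then show "(\<lambda>n. sqrt (expectation (\<lambda>\<omega>. (D (Suc n) \<omega>)\<^sup>2)) * sqrt KE) \<longlonglongrightarrow> 0" by simp
  qed
  have "expectation (\<lambda>\<omega>. \<phi> (S T \<omega>, Avg \<omega>) * U (Suc n) \<omega>)
    = expectation (\<lambda>\<omega>. \<phi> (S T \<omega>, Trap (Suc n) \<omega>) * U (Suc n) \<omega>) + expectation (\<lambda>\<omega>. D (Suc n) \<omega> * U (Suc n) \<omega>)" for n
  proof -
    have "integrable M (\<lambda>\<omega>. (\<phi> (S T \<omega>, Trap (Suc n) \<omega>))\<^sup>2)"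
      using Tm[of "Suc n"] \<phi>(2) by (intro integrable_const_bound[where B=1]) (auto simp: abs_square_le_1)
    then have "integrable M (\<lambda>\<omega>. \<phi> (S T \<omega>, Trap (Suc n) \<omega>) * U (Suc n) \<omega>)"
      by (intro integrable_mult_L2 U_L2 Tm) auto
    moreover have "integrable M (\<lambda>\<omega>. D (Suc n) \<omega> * U (Suc n) \<omega>)"
      by (intro integrable_mult_L2 U_L2 Dm D2) auto
    ultimately show ?thesis
      by (subst Bochner_Integration.integral_add[symmetric]) (auto simp: D_def algebra_simps)
  qed
  with tendsto_add[OF lim1 lim2] have "(\<lambda>n. expectation (\<lambda>\<omega>. \<phi> (S T \<omega>, Avg \<omega>) * U (Suc n) \<omega>)) \<longlonglongrightarrow> 0" by simp
  then show ?thesis by (rule LIMSEQ_imp_Suc)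
qed

lemma weak_null_L2:
  assumes "g \<in> borel_measurable borel" "integrable M (\<lambda>\<omega>. (g (S T \<omega>, Avg \<omega>))\<^sup>2)"
  shows "(\<lambda>n. expectation (\<lambda>\<omega>. g (S T \<omega>, Avg \<omega>) * U n \<omega>)) \<longlonglongrightarrow> 0"
proof (rule weak_null_of_continuous[where X="\<lambda>\<omega>. (S T \<omega>, Avg \<omega>)", OF U_L2])
  show "(\<lambda>\<omega>. (S T \<omega>, Avg \<omega>)) \<in> borel_measurable M"
    using T_pos by (intro borel_measurable_Pair measurable_stock measurable_Avg) auto
qed (use assms weak_null_continuous in auto)

end

section \<open>Moments and the expansion of the payoff\<close>

context black_scholes
begin

definition "trap_moment_bound q = exp (real q * \<bar>r\<bar> * T / 2) * (moment_bound (2 * q) + 2 * exp ((real q * \<sigma>)\<^sup>2 * T / 2))"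

text \<open>The scheme is the mean of \<open>n\<close> terms \<open>y k\<close>, possibly negative,
  so convexity of an even power bounds its moment by the mean of the moments of the
  \<open>y k\<close>. Each of these is controlled independently of \<open>n\<close>, because steps
  have length at most \<open>T\<close>.\<close>

lemma Trap_moment:
  assumes n: "0 < n" and q: "even q"
  shows "integrable M (\<lambda>\<omega>. Trap n \<omega> ^ q)" "expectation (\<lambda>\<omega>. Trap n \<omega> ^ q) \<le> trap_moment_bound q"
proof -
  define \<delta> where "\<delta> = T / real n"
  have \<delta>: "0 < \<delta>" "\<delta> \<le> T" using n T_pos by (auto simp: \<delta>_def field_simps)
  have S1: "real (Suc k) * \<delta> = real k * \<delta> + \<delta>" for k by (simp add: algebra_simps)
  define d where "d k \<omega> = W (real k * \<delta> + \<delta>) \<omega> - W (real k * \<delta>) \<omega>" for k \<omega>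
  define y where "y k \<omega> = S (real k * \<delta>) \<omega> * (1 + r * \<delta> / 2 + \<sigma> * d k \<omega> / 2)" for k \<omega>
  define c where "c = exp (real q * \<bar>r\<bar> * T / 2)"
  \<comment> \<open>Arises from \<open>1 + x \<le> exp x\<close> for the weight, from
    \<open>a * e \<le> a\<^sup>2 + e\<^sup>2\<close> to separate stock and increment, and from
    \<open>exp \<bar>x\<bar> \<le> exp x + exp (- x)\<close> to remove the modulus.\<close>
  define b where "b k \<omega> = c * (S (real k * \<delta>) \<omega> ^ (2 * q) + (exp (real q * \<sigma> * d k \<omega>) + exp (- (real q * \<sigma>) * d k \<omega>)))" for k \<omega>
  have Trap: "Trap n \<omega> = (\<Sum>k<n. (1 / real n) *\<^sub>R y k \<omega>)" for \<omega>
    unfolding trapezoidal_eq[OF n \<delta>_def] S1 y_def d_def by (simp add: sum_divide_distrib)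
  have yb: "y k \<omega> ^ q \<le> b k \<omega>" for k \<omega>
  proof -
    let ?D = "\<sigma> * \<bar>d k \<omega>\<bar> / 2"
    have "\<bar>1 + r * \<delta> / 2 + \<sigma> * d k \<omega> / 2\<bar> \<le> 1 + \<bar>r * \<delta> / 2\<bar> + \<bar>\<sigma> * d k \<omega> / 2\<bar>" by linarith
    also have "\<bar>r * \<delta> / 2\<bar> \<le> \<bar>r\<bar> * T / 2" using \<delta> by (auto simp: abs_mult intro!: mult_left_mono)
    also have "\<bar>\<sigma> * d k \<omega> / 2\<bar> = ?D" using sigma_pos by (simp add: abs_mult)
    also have "1 + \<bar>r\<bar> * T / 2 + ?D \<le> exp (\<bar>r\<bar> * T / 2 + ?D)"
      using exp_ge_add_one_self[of "\<bar>r\<bar> * T / 2 + ?D"] by linarith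
    finally have "\<bar>y k \<omega>\<bar> \<le> S (real k * \<delta>) \<omega> * exp (\<bar>r\<bar> * T / 2 + ?D)"
      unfolding y_def using stock_pos[of "real k * \<delta>" \<omega>] by (simp add: abs_mult mult_left_mono)
    then have "\<bar>y k \<omega>\<bar> ^ q \<le> (S (real k * \<delta>) \<omega> * exp (\<bar>r\<bar> * T / 2 + ?D)) ^ q" by (intro power_mono) auto
    also have "\<dots> = S (real k * \<delta>) \<omega> ^ q * exp (real q * (\<bar>r\<bar> * T / 2 + ?D))"
      by (simp add: power_mult_distrib exp_of_nat_mult)
    also have "exp (real q * (\<bar>r\<bar> * T / 2 + ?D)) = c * exp (real q * ?D)"
      unfolding c_def by (simp add: algebra_simps flip: exp_add)
    also have "S (real k * \<delta>) \<omega> ^ q * (c * exp (real q * ?D)) = c * (S (real k * \<delta>) \<omega> ^ q * exp (real q * ?D))" by simp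
    also have "\<dots> \<le> c * ((S (real k * \<delta>) \<omega> ^ q)\<^sup>2 + (exp (real q * ?D))\<^sup>2)"
    proof (intro mult_left_mono)
      let ?a = "S (real k * \<delta>) \<omega> ^ q" and ?e = "exp (real q * ?D)"
      have "2 * (?a * ?e) \<le> ?a\<^sup>2 + ?e\<^sup>2" using sum_squares_bound[of ?a ?e] by (simp add: mult.assoc)
      moreover have "0 \<le> ?a * ?e" using stock_pos[of "real k * \<delta>" \<omega>] by simp
      ultimately show "?a * ?e \<le> ?a\<^sup>2 + ?e\<^sup>2" by linarith
    qed (simp add: c_def)
    also have "\<dots> \<le> b k \<omega>" unfolding b_def
    proof (intro mult_left_mono add_mono)
      show "(S (real k * \<delta>) \<omega> ^ q)\<^sup>2 \<le> S (real k * \<delta>) \<omega> ^ (2 * q)" by (simp add: power_mult[symmetric] mult.commute)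
      have "(exp (real q * ?D))\<^sup>2 = exp (real q * \<sigma> * \<bar>d k \<omega>\<bar>)" by (simp flip: exp_double)
      also have "\<dots> \<le> exp (real q * \<sigma> * d k \<omega>) + exp (- (real q * \<sigma>) * d k \<omega>)"
        by (cases "0 \<le> d k \<omega>") auto
      finally show "(exp (real q * ?D))\<^sup>2 \<le> exp (real q * \<sigma> * d k \<omega>) + exp (- (real q * \<sigma>) * d k \<omega>)" .
    qed (simp add: c_def)
    finally show ?thesis using q by (simp add: power_even_abs)
  qed
  have bi: "integrable M (b k)" "expectation (b k) \<le> trap_moment_bound q" if "k < n" for k
  proof -
    have s: "0 \<le> real k * \<delta>" "real k * \<delta> \<le> real k * \<delta> + \<delta>" "real k * \<delta> + \<delta> \<le> T" "real k * \<delta> \<le> T"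
      using grid_le[OF that, folded \<delta>_def] \<delta> mult_nonneg_nonneg[of "real k" \<delta>] by linarith+
    note m = increment_moments(1,2)[OF s(1-3), folded d_def]
    note sm = stock_moment[OF s(1,4), of "2 * q"]
    show "integrable M (b k)" unfolding b_def[abs_def]
      using m(1)[of "real q * \<sigma>"] m(1)[of "- (real q * \<sigma>)"] sm(1) by (intro integrable_mult_right Bochner_Integration.integrable_add) auto
    have "expectation (b k) = c * (expectation (\<lambda>\<omega>. S (real k * \<delta>) \<omega> ^ (2 * q)) + (exp ((real q * \<sigma>)\<^sup>2 * \<delta> / 2) + exp ((- (real q * \<sigma>))\<^sup>2 * \<delta> / 2)))"
      unfolding b_def[abs_def] using m[of "real q * \<sigma>"] m[of "- (real q * \<sigma>)"] sm(1) by simp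
    also have "\<dots> \<le> c * (moment_bound (2 * q) + (exp ((real q * \<sigma>)\<^sup>2 * T / 2) + exp ((- (real q * \<sigma>))\<^sup>2 * T / 2)))"
      using \<delta> sm(2) by (intro mult_left_mono add_mono) (auto simp: c_def intro!: mult_left_mono)
    finally show "expectation (b k) \<le> trap_moment_bound q" by (simp add: trap_moment_bound_def c_def)
  qed
  have conv: "Trap n \<omega> ^ q \<le> (\<Sum>k<n. b k \<omega> / real n)" for \<omega>
  proof -
    have "Trap n \<omega> ^ q \<le> (\<Sum>k<n. (1 / real n) * y k \<omega> ^ q)"
      unfolding Trap using n by (intro convex_on_sum[OF _ _ convex_power_even[OF q]]) auto
    also have "\<dots> \<le> (\<Sum>k<n. b k \<omega> / real n)"
      using yb by (intro sum_mono) (simp add: divide_right_mono)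
    finally show ?thesis .
  qed
  have T0: "0 \<le> Trap n \<omega> ^ q" for \<omega> using q by (rule zero_le_even_power)
  show i: "integrable M (\<lambda>\<omega>. Trap n \<omega> ^ q)"
  proof (rule Bochner_Integration.integrable_bound)
    show "integrable M (\<lambda>\<omega>. \<Sum>k<n. b k \<omega> / real n)" using bi by auto
    show "AE \<omega> in M. norm (Trap n \<omega> ^ q) \<le> norm (\<Sum>k<n. b k \<omega> / real n)"
      using conv T0 by (intro AE_I2) (smt (verit) real_norm_def)
    show "(\<lambda>\<omega>. Trap n \<omega> ^ q) \<in> borel_measurable M" using measurable_Trap[OF n] by simp
  qed
  have "expectation (\<lambda>\<omega>. Trap n \<omega> ^ q) \<le> expectation (\<lambda>\<omega>. \<Sum>k<n. b k \<omega> / real n)"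
    using bi conv by (intro integral_mono i) auto
  also have "\<dots> = (\<Sum>k<n. expectation (b k) / real n)" using bi by simp
  also have "\<dots> \<le> (\<Sum>k<n. trap_moment_bound q / real n)" using bi by (intro sum_mono divide_right_mono) auto
  also have "\<dots> = trap_moment_bound q" using n by simp
  finally show "expectation (\<lambda>\<omega>. Trap n \<omega> ^ q) \<le> trap_moment_bound q" .
qed

text \<open>Fatou's lemma along the almost surely convergent scheme, so the average inherits the
  same bound.\<close>

lemma Avg_moment:
  assumes q: "even q"
  shows "integrable M (\<lambda>\<omega>. Avg \<omega> ^ q)" "expectation (\<lambda>\<omega>. Avg \<omega> ^ q) \<le> trap_moment_bound q"
proof -
  have Tm: "(\<lambda>\<omega>. ennreal (Trap (Suc n) \<omega> ^ q)) \<in> borel_measurable M" for n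
    using measurable_Trap[of "Suc n"] by simp
  have b0: "0 \<le> trap_moment_bound q" unfolding trap_moment_bound_def using moment_bound_nonneg by simp
  have "(\<integral>\<^sup>+\<omega>. ennreal (Avg \<omega> ^ q) \<partial>M) = (\<integral>\<^sup>+\<omega>. liminf (\<lambda>n. ennreal (Trap (Suc n) \<omega> ^ q)) \<partial>M)"
  proof (rule nn_integral_cong_AE)
    show "AE \<omega> in M. ennreal (Avg \<omega> ^ q) = liminf (\<lambda>n. ennreal (Trap (Suc n) \<omega> ^ q))"
      using AE_Trap_tendsto_Avg
    proof eventually_elim
      case (elim \<omega>)
      have "(\<lambda>n. ennreal (Trap (Suc n) \<omega> ^ q)) \<longlonglongrightarrow> ennreal (Avg \<omega> ^ q)"
        by (intro tendsto_ennrealI tendsto_power LIMSEQ_Suc elim)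
      then show ?case by (simp add: lim_imp_Liminf)
    qed
  qed
  also have "\<dots> \<le> liminf (\<lambda>n. \<integral>\<^sup>+\<omega>. ennreal (Trap (Suc n) \<omega> ^ q) \<partial>M)"
    by (rule nn_integral_liminf) (rule Tm)
  also have "\<dots> \<le> liminf (\<lambda>n::nat. ennreal (trap_moment_bound q))"
  proof (intro Liminf_mono always_eventually allI)
    fix n
    have "(\<integral>\<^sup>+\<omega>. ennreal (Trap (Suc n) \<omega> ^ q) \<partial>M) = ennreal (expectation (\<lambda>\<omega>. Trap (Suc n) \<omega> ^ q))"
      using Trap_moment(1)[of "Suc n" q] q by (intro nn_integral_eq_integral) (auto simp: zero_le_even_power)
    then show "(\<integral>\<^sup>+\<omega>. ennreal (Trap (Suc n) \<omega> ^ q) \<partial>M) \<le> ennreal (trap_moment_bound q)"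
      using Trap_moment(2)[of "Suc n" q] q by (simp add: ennreal_leI)
  qed
  also have "\<dots> = ennreal (trap_moment_bound q)" by (simp add: Liminf_const)
  finally have le: "(\<integral>\<^sup>+\<omega>. ennreal (Avg \<omega> ^ q) \<partial>M) \<le> ennreal (trap_moment_bound q)" .
  show "integrable M (\<lambda>\<omega>. Avg \<omega> ^ q)" "expectation (\<lambda>\<omega>. Avg \<omega> ^ q) \<le> trap_moment_bound q"
    using measurable_Avg q le b0
    by (auto intro!: integrable_nn_bound[where K="trap_moment_bound q"] simp: zero_le_even_power)
qed

end

section \<open>First order expansion of the payoff\<close>

locale payoff = black_scholes M F T W S0 r \<sigma>
  for M :: "'a measure" and F :: "real \<Rightarrow> 'a measure" and T :: real and W :: "real \<Rightarrow> 'a \<Rightarrow> real"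
    and S0 r \<sigma> :: real +
  fixes f :: "real \<times> real \<Rightarrow> real" and C p :: real
  assumes f_measurable: "f \<in> borel_measurable borel"
    and C_pos: "0 < C" and p_pos: "0 < p"
    and f_lipschitz: "\<And>x y1 y2. \<bar>f (x, y1) - f (x, y2)\<bar>
           \<le> C * (1 + \<bar>x\<bar> powr p + \<bar>y1\<bar> powr p + \<bar>y2\<bar> powr p) * \<bar>y1 - y2\<bar>"
    and f_domain: "AE \<omega> in M. (S T \<omega>, Avg \<omega>) \<in> partial2_domain f"
begin

definition "G x y1 y2 = C * (1 + \<bar>x\<bar> powr p + \<bar>y1\<bar> powr p + \<bar>y2\<bar> powr p)"

lemma G_nonneg: "0 \<le> G x y1 y2"
  using C_pos by (simp add: G_def)

lemma f_lipschitz_G: "\<bar>f (x, y1) - f (x, y2)\<bar> \<le> G x y1 y2 * \<bar>y1 - y2\<bar>"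
  using f_lipschitz by (simp add: G_def)

text \<open>The Lipschitz factor stays bounded near \<open>y\<close>. Continuity in the second
  variable is what lets the measurability of \<open>partial2 f\<close> be decided by rational
  increments.\<close>

lemma f_continuous: "continuous_on UNIV (\<lambda>y. f (x, y))"
proof (rule continuous_at_imp_continuous_on, intro ballI)
  fix y :: real
  have "(\<lambda>z. f (x, z) - f (x, y)) \<midarrow>y\<rightarrow> 0"
  proof (rule Lim_null_comparison)
    show "\<forall>\<^sub>F z in at y. norm (f (x, z) - f (x, y)) \<le> G x z y * \<bar>z - y\<bar>"
      using f_lipschitz[of x _ y] by (auto simp: G_def)
    have "((\<lambda>z. G x z y * \<bar>z - y\<bar>) \<longlongrightarrow> G x y y * \<bar>y - y\<bar>) (at y)"
      unfolding G_def using p_pos by (intro tendsto_intros) (auto intro!: always_eventually)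
    then show "((\<lambda>z. G x z y * \<bar>z - y\<bar>) \<longlongrightarrow> 0) (at y)" by simp
  qed
  then show "isCont (\<lambda>y. f (x, y)) y" by (simp add: isCont_def LIM_zero_iff)
qed

lemma partial2_measurable: "partial2 f \<in> borel_measurable borel"
  by (rule borel_measurable_partial2[OF f_measurable f_continuous])

lemma partial2_DERIV:
  assumes "(x, y) \<in> partial2_domain f"
  shows "DERIV (\<lambda>v. f (x, v)) y :> partial2 f (x, y)"
proof -
  have "(\<lambda>v. f (x, v)) differentiable (at y)" using assms by (simp add: partial2_domain_def)
  then show ?thesis by (simp add: partial2_def DERIV_deriv_iff_real_differentiable)
qed

text \<open>Difference quotients at \<open>y\<close> are bounded by \<open>G x (y + h) y\<close>,
  which tends to \<open>G x y y\<close> as \<open>h\<close> tends to 0. Hence the derivative has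
  polynomial growth and finite moments along the model.\<close>

lemma partial2_bound:
  assumes "(x, y) \<in> partial2_domain f"
  shows "\<bar>partial2 f (x, y)\<bar> \<le> G x y y"
proof (rule tendsto_le)
  show "((\<lambda>h. \<bar>(f (x, y + h) - f (x, y)) / h\<bar>) \<longlongrightarrow> \<bar>partial2 f (x, y)\<bar>) (at 0)"
    using partial2_DERIV[OF assms] unfolding DERIV_def by (rule tendsto_rabs)
  have "((\<lambda>h. G x (y + h) y) \<longlongrightarrow> G x (y + 0) y) (at 0)"
    unfolding G_def using p_pos by (intro tendsto_intros) (auto intro!: always_eventually)
  then show "((\<lambda>h. G x (y + h) y) \<longlongrightarrow> G x y y) (at 0)" by simp
  show "\<forall>\<^sub>F h in at 0. \<bar>(f (x, y + h) - f (x, y)) / h\<bar> \<le> G x (y + h) y"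
  proof -
    have "\<bar>(f (x, y + h) - f (x, y)) / h\<bar> \<le> G x (y + h) y" if "h \<noteq> 0" for h
      using f_lipschitz[of x "y + h" y] that by (simp add: G_def divide_le_eq abs_divide)
    then show ?thesis by (auto simp: eventually_at_filter)
  qed
qed simp

text \<open>An even integer that is at least \<open>4 * p\<close>: the quotient errors are estimated
  in L4, where \<open>\<bar>x\<bar> powr p\<close> appears to the fourth power.\<close>

definition "q0 = 2 * nat \<lceil>2 * p\<rceil>"

lemma q0: "4 * p \<le> real q0" "even q0"
  using real_nat_ceiling_ge[of "2 * p"] unfolding q0_def by auto

lemma G_fourth_le: "G x y1 y2 ^ 4 \<le> 64 * C ^ 4 * (4 + x ^ q0 + y1 ^ q0 + y2 ^ q0)"
proof -
  have "G x y1 y2 ^ 4 = C ^ 4 * (1 + \<bar>x\<bar> powr p + \<bar>y1\<bar> powr p + \<bar>y2\<bar> powr p) ^ 4"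
    by (simp add: G_def power_mult_distrib)
  also have "\<dots> \<le> C ^ 4 * (64 * (1 ^ 4 + (\<bar>x\<bar> powr p) ^ 4 + (\<bar>y1\<bar> powr p) ^ 4 + (\<bar>y2\<bar> powr p) ^ 4))"
    by (intro mult_left_mono sum4_fourth_le) simp
  also have "\<dots> \<le> C ^ 4 * (64 * (1 + (1 + x ^ q0) + (1 + y1 ^ q0) + (1 + y2 ^ q0)))"
    using powr_fourth_le[OF p_pos q0] by (intro mult_left_mono add_mono) auto
  finally show ?thesis by (simp add: algebra_simps)
qed

definition "KG = 64 * C ^ 4 * (4 + moment_bound q0 + trap_moment_bound q0 + trap_moment_bound q0)"

lemma ST_measurable: "S T \<in> borel_measurable M"
  using T_pos by (intro measurable_stock) auto

lemma G_measurable: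
  assumes "X \<in> borel_measurable M" "Y \<in> borel_measurable M" "Z \<in> borel_measurable M"
  shows "(\<lambda>\<omega>. G (X \<omega>) (Y \<omega>) (Z \<omega>)) \<in> borel_measurable M"
  unfolding G_def using assms by measurable

text \<open>The middle argument is left free because the bound is used both with
  \<open>Trap n\<close> in that place and with \<open>Avg\<close>; the two share the moment bound
  \<open>trap_moment_bound q0\<close>, so the constant does not depend on \<open>n\<close>.\<close>

lemma G_moment:
  assumes Y: "Y \<in> borel_measurable M" "integrable M (\<lambda>\<omega>. Y \<omega> ^ q0)" "expectation (\<lambda>\<omega>. Y \<omega> ^ q0) \<le> trap_moment_bound q0"
  shows "integrable M (\<lambda>\<omega>. G (S T \<omega>) (Y \<omega>) (Avg \<omega>) ^ 4)"
    "expectation (\<lambda>\<omega>. G (S T \<omega>) (Y \<omega>) (Avg \<omega>) ^ 4) \<le> KG"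
    "integrable M (\<lambda>\<omega>. (G (S T \<omega>) (Y \<omega>) (Avg \<omega>))\<^sup>2)"
proof -
  have s: "integrable M (\<lambda>\<omega>. S T \<omega> ^ q0)" "expectation (\<lambda>\<omega>. S T \<omega> ^ q0) \<le> moment_bound q0"
    using stock_moment[of T q0] T_pos by auto
  note a = Avg_moment[OF q0(2)]
  have i: "integrable M (\<lambda>\<omega>. 64 * C ^ 4 * (4 + S T \<omega> ^ q0 + Y \<omega> ^ q0 + Avg \<omega> ^ q0))"
    using s a Y by simp
  have Gm: "(\<lambda>\<omega>. G (S T \<omega>) (Y \<omega>) (Avg \<omega>)) \<in> borel_measurable M"
    by (intro G_measurable ST_measurable Y measurable_Avg)
  show g4: "integrable M (\<lambda>\<omega>. G (S T \<omega>) (Y \<omega>) (Avg \<omega>) ^ 4)"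
  proof (rule Bochner_Integration.integrable_bound[OF i])
    show "AE \<omega> in M. norm (G (S T \<omega>) (Y \<omega>) (Avg \<omega>) ^ 4) \<le> norm (64 * C ^ 4 * (4 + S T \<omega> ^ q0 + Y \<omega> ^ q0 + Avg \<omega> ^ q0))"
      using G_fourth_le G_nonneg by (intro AE_I2) (smt (verit) real_norm_def zero_le_power)
  qed (use Gm in simp)
  have "expectation (\<lambda>\<omega>. G (S T \<omega>) (Y \<omega>) (Avg \<omega>) ^ 4) \<le> expectation (\<lambda>\<omega>. 64 * C ^ 4 * (4 + S T \<omega> ^ q0 + Y \<omega> ^ q0 + Avg \<omega> ^ q0))"
    by (intro integral_mono g4 i G_fourth_le)
  also have "\<dots> = 64 * C ^ 4 * (4 + expectation (\<lambda>\<omega>. S T \<omega> ^ q0) + expectation (\<lambda>\<omega>. Y \<omega> ^ q0) + expectation (\<lambda>\<omega>. Avg \<omega> ^ q0))"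
    using s a Y by (simp add: prob_space)
  also have "\<dots> \<le> KG" unfolding KG_def using s(2) a(2) Y(3) by (intro mult_left_mono add_mono) auto
  finally show "expectation (\<lambda>\<omega>. G (S T \<omega>) (Y \<omega>) (Avg \<omega>) ^ 4) \<le> KG" .
  show "integrable M (\<lambda>\<omega>. (G (S T \<omega>) (Y \<omega>) (Avg \<omega>))\<^sup>2)"
    by (rule square_integrable_imp_integrable) (use Gm g4 in \<open>simp_all flip: power_mult\<close>)
qed

definition "Y \<omega> = partial2 f (S T \<omega>, Avg \<omega>)"

lemma Y_measurable: "Y \<in> borel_measurable M"
  unfolding Y_def[abs_def] using partial2_measurable ST_measurable measurable_Avg by measurable

lemma Y_bound: "AE \<omega> in M. \<bar>Y \<omega>\<bar> \<le> G (S T \<omega>) (Avg \<omega>) (Avg \<omega>)"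
  using f_domain by eventually_elim (simp add: Y_def partial2_bound)

lemma Y_L2: "integrable M (\<lambda>\<omega>. (Y \<omega>)\<^sup>2)"
proof (rule Bochner_Integration.integrable_bound)
  show "integrable M (\<lambda>\<omega>. (G (S T \<omega>) (Avg \<omega>) (Avg \<omega>))\<^sup>2)"
    using Avg_moment[OF q0(2)] measurable_Avg by (intro G_moment) auto
  show "AE \<omega> in M. norm ((Y \<omega>)\<^sup>2) \<le> norm ((G (S T \<omega>) (Avg \<omega>) (Avg \<omega>))\<^sup>2)"
    using Y_bound by eventually_elim (use G_nonneg in \<open>simp flip: abs_le_square_iff\<close>)
qed (use Y_measurable in simp)

lemma f_diff_measurable:
  assumes "0 < n" shows "(\<lambda>\<omega>. f (S T \<omega>, Trap n \<omega>) - f (S T \<omega>, Avg \<omega>)) \<in> borel_measurable M"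
  using f_measurable ST_measurable measurable_Trap[OF assms] measurable_Avg by measurable

lemma f_diff_integrable:
  assumes n: "0 < n"
  shows "integrable M (\<lambda>\<omega>. f (S T \<omega>, Trap n \<omega>) - f (S T \<omega>, Avg \<omega>))"
proof (rule Bochner_Integration.integrable_bound)
  note Tm = measurable_Trap[OF n]
  show "integrable M (\<lambda>\<omega>. G (S T \<omega>) (Trap n \<omega>) (Avg \<omega>) * (Trap n \<omega> - Avg \<omega>))"
    using Tm measurable_Avg error_L2(1)[OF n] G_moment(3)[OF Tm Trap_moment[OF n q0(2)]]
    by (intro integrable_mult_L2 G_measurable ST_measurable) auto
  show "AE \<omega> in M. norm (f (S T \<omega>, Trap n \<omega>) - f (S T \<omega>, Avg \<omega>)) \<le> norm (G (S T \<omega>) (Trap n \<omega>) (Avg \<omega>) * (Trap n \<omega> - Avg \<omega>))"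
    using f_lipschitz_G G_nonneg by (intro AE_I2) (simp add: abs_mult)
qed (rule f_diff_measurable[OF n])

text \<open>Difference quotient minus derivative. With the value 0 where the scheme hits the
  average, the increment of \<open>f\<close> equals \<open>(\<rho> n + Y) * (Trap n - Avg)\<close>
  at every point, without exceptional set.\<close>

definition "\<rho> n \<omega> = (if Trap n \<omega> = Avg \<omega> then 0
  else (f (S T \<omega>, Trap n \<omega>) - f (S T \<omega>, Avg \<omega>)) / (Trap n \<omega> - Avg \<omega>) - Y \<omega>)"

lemma rho_measurable: "0 < n \<Longrightarrow> \<rho> n \<in> borel_measurable M"
proof -
  assume n: "0 < n"
  note [measurable] = measurable_Trap[OF n] measurable_Avg f_diff_measurable[OF n] Y_measurable
  show ?thesis unfolding \<rho>_def[abs_def] by measurable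
qed

text \<open>As a function of the displacement \<open>h\<close>, extended by 0 at
  \<open>h = 0\<close>, the quotient error is continuous at 0 by differentiability. It is composed
  with \<open>Trap n - Avg\<close>, which tends to 0; the extension covers indices at which this
  difference is 0.\<close>

lemma rho_tendsto: "AE \<omega> in M. (\<lambda>n. \<rho> n \<omega>) \<longlonglongrightarrow> 0"
  using AE_Trap_tendsto_Avg f_domain
proof eventually_elim
  case (elim \<omega>)
  let ?x = "S T \<omega>" and ?y = "Avg \<omega>"
  define R where "R h = (if h = 0 then 0 else (f (?x, ?y + h) - f (?x, ?y)) / h - Y \<omega>)" for h
  have lim: "((\<lambda>h. (f (?x, ?y + h) - f (?x, ?y)) / h - Y \<omega>) \<longlongrightarrow> Y \<omega> - Y \<omega>) (at 0)"
    using partial2_DERIV[OF elim(2)] unfolding DERIV_def Y_def by (intro tendsto_diff tendsto_const)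
  have "(R \<longlongrightarrow> Y \<omega> - Y \<omega>) (at 0)"
    by (rule Lim_transform_eventually[OF lim]) (auto simp: R_def eventually_at_filter)
  then have "isCont R 0" by (simp add: isCont_def R_def)
  moreover have "(\<lambda>n. Trap n \<omega> - Avg \<omega>) \<longlonglongrightarrow> 0" using elim(1) by (simp add: LIM_zero)
  ultimately have "(\<lambda>n. R (Trap n \<omega> - Avg \<omega>)) \<longlonglongrightarrow> R 0" by (rule isCont_tendsto_compose)
  moreover have "R (Trap n \<omega> - Avg \<omega>) = \<rho> n \<omega>" for n by (simp add: R_def \<rho>_def)
  ultimately show ?case by (simp add: R_def)
qed

lemma rho_bound: "AE \<omega> in M. \<bar>\<rho> n \<omega>\<bar> \<le> G (S T \<omega>) (Trap n \<omega>) (Avg \<omega>) + G (S T \<omega>) (Avg \<omega>) (Avg \<omega>)"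
  using Y_bound
proof eventually_elim
  case (elim \<omega>)
  show ?case
  proof (cases "Trap n \<omega> = Avg \<omega>")
    case True then show ?thesis using G_nonneg by (simp add: \<rho>_def add_nonneg_nonneg)
  next
    case False
    have "\<bar>(f (S T \<omega>, Trap n \<omega>) - f (S T \<omega>, Avg \<omega>)) / (Trap n \<omega> - Avg \<omega>)\<bar> \<le> G (S T \<omega>) (Trap n \<omega>) (Avg \<omega>)"
      using f_lipschitz[of "S T \<omega>" "Trap n \<omega>" "Avg \<omega>"] False by (simp add: G_def divide_le_eq abs_divide)
    then show ?thesis using elim unfolding \<rho>_def if_not_P[OF False] by linarith
  qed
qed

text \<open>The quotient and the derivative are both bounded by values of \<open>G\<close>. The
  constant is 64 from \<open>sum4_fourth_le\<close>, applied with two zero summands, times two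
  copies of \<open>KG\<close>.\<close>

lemma rho_fourth:
  assumes n: "0 < n"
  shows "integrable M (\<lambda>\<omega>. \<rho> n \<omega> ^ 4)" "expectation (\<lambda>\<omega>. \<rho> n \<omega> ^ 4) \<le> 128 * KG"
proof -
  note Tm = measurable_Trap[OF n]
  let ?g = "\<lambda>\<omega>. G (S T \<omega>) (Trap n \<omega>) (Avg \<omega>)" and ?h = "\<lambda>\<omega>. G (S T \<omega>) (Avg \<omega>) (Avg \<omega>)"
  note g = G_moment[OF Tm Trap_moment[OF n q0(2)]]
  note h = G_moment[OF measurable_Avg Avg_moment[OF q0(2)]]
  have ae: "AE \<omega> in M. \<rho> n \<omega> ^ 4 \<le> 64 * (?g \<omega> ^ 4 + ?h \<omega> ^ 4)"
    using rho_bound[of n]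
  proof eventually_elim
    case (elim \<omega>)
    have "\<rho> n \<omega> ^ 4 = \<bar>\<rho> n \<omega>\<bar> ^ 4" by simp
    also have "\<dots> \<le> (?g \<omega> + ?h \<omega> + 0 + 0) ^ 4" using elim by (intro power_mono) auto
    also have "\<dots> \<le> 64 * (?g \<omega> ^ 4 + ?h \<omega> ^ 4 + 0 ^ 4 + 0 ^ 4)" by (rule sum4_fourth_le)
    finally show ?case by simp
  qed
  have i: "integrable M (\<lambda>\<omega>. 64 * (?g \<omega> ^ 4 + ?h \<omega> ^ 4))" using g h by simp
  show r: "integrable M (\<lambda>\<omega>. \<rho> n \<omega> ^ 4)"
  proof (rule Bochner_Integration.integrable_bound[OF i])
    show "AE \<omega> in M. norm (\<rho> n \<omega> ^ 4) \<le> norm (64 * (?g \<omega> ^ 4 + ?h \<omega> ^ 4))"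
      using ae by eventually_elim simp
  qed (use rho_measurable[OF n] in simp)
  have "expectation (\<lambda>\<omega>. \<rho> n \<omega> ^ 4) \<le> expectation (\<lambda>\<omega>. 64 * (?g \<omega> ^ 4 + ?h \<omega> ^ 4))"
    by (intro integral_mono_AE r i ae)
  also have "\<dots> \<le> 128 * KG" using g h by simp
  finally show "expectation (\<lambda>\<omega>. \<rho> n \<omega> ^ 4) \<le> 128 * KG" .
qed

text \<open>The scaled increment of \<open>f\<close> equals \<open>\<rho> n * U n + Y * U n\<close>
  pointwise. In the first product one factor tends to 0 in L2 and the other is bounded there; in the
  second the fixed variable \<open>Y\<close> is tested against the weakly null sequence
  \<open>U n\<close>.\<close>

theorem discretization_error_tendsto:
  "(\<lambda>n. real n * expectation (\<lambda>\<omega>. f (S T \<omega>, Trap n \<omega>) - f (S T \<omega>, Avg \<omega>))) \<longlonglongrightarrow> 0"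
proof -
  have r2: "\<And>n. integrable M (\<lambda>\<omega>. (\<rho> (Suc n) \<omega>)\<^sup>2)"
    and rlim: "(\<lambda>n. expectation (\<lambda>\<omega>. (\<rho> (Suc n) \<omega>)\<^sup>2)) \<longlonglongrightarrow> 0"
  proof -
    have ae: "AE \<omega> in M. (\<lambda>n. \<rho> (Suc n) \<omega>) \<longlonglongrightarrow> 0"
      using rho_tendsto by eventually_elim (rule LIMSEQ_Suc)
    note t = tendsto_L2_of_L4_bounded[where X="\<lambda>n. \<rho> (Suc n)", OF rho_measurable ae rho_fourth]
    show "integrable M (\<lambda>\<omega>. (\<rho> (Suc n) \<omega>)\<^sup>2)" for n by (rule t(1)) auto
    show "(\<lambda>n. expectation (\<lambda>\<omega>. (\<rho> (Suc n) \<omega>)\<^sup>2)) \<longlonglongrightarrow> 0" by (rule t(2)) auto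
  qed
  have rm: "\<rho> (Suc n) \<in> borel_measurable M" for n by (rule rho_measurable) simp
  have lim1: "(\<lambda>n. expectation (\<lambda>\<omega>. \<rho> (Suc n) \<omega> * U (Suc n) \<omega>)) \<longlonglongrightarrow> 0"
  proof (rule Lim_null_comparison)
    show "\<forall>\<^sub>F n in sequentially. norm (expectation (\<lambda>\<omega>. \<rho> (Suc n) \<omega> * U (Suc n) \<omega>))
      \<le> sqrt (expectation (\<lambda>\<omega>. (\<rho> (Suc n) \<omega>)\<^sup>2)) * sqrt KE"
      unfolding real_norm_def by (intro always_eventually allI cauchy_schwarz_integral_bound U_L2 rm r2 order_refl)
    have "(\<lambda>n. sqrt (expectation (\<lambda>\<omega>. (\<rho> (Suc n) \<omega>)\<^sup>2)) * sqrt KE) \<longlonglongrightarrow> sqrt 0 * sqrt KE"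
      by (intro tendsto_intros rlim)
    then show "(\<lambda>n. sqrt (expectation (\<lambda>\<omega>. (\<rho> (Suc n) \<omega>)\<^sup>2)) * sqrt KE) \<longlonglongrightarrow> 0" by simp
  qed
  have "(\<lambda>n. expectation (\<lambda>\<omega>. Y \<omega> * U n \<omega>)) \<longlonglongrightarrow> 0"
    unfolding Y_def by (rule weak_null_L2[OF partial2_measurable]) (use Y_L2 in \<open>simp add: Y_def\<close>)
  then have lim2: "(\<lambda>n. expectation (\<lambda>\<omega>. Y \<omega> * U (Suc n) \<omega>)) \<longlonglongrightarrow> 0" by (rule LIMSEQ_Suc)
  have "real (Suc n) * expectation (\<lambda>\<omega>. f (S T \<omega>, Trap (Suc n) \<omega>) - f (S T \<omega>, Avg \<omega>))
    = expectation (\<lambda>\<omega>. \<rho> (Suc n) \<omega> * U (Suc n) \<omega>) + expectation (\<lambda>\<omega>. Y \<omega> * U (Suc n) \<omega>)" for n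
  proof -
    have i: "integrable M (\<lambda>\<omega>. \<rho> (Suc n) \<omega> * U (Suc n) \<omega>)" "integrable M (\<lambda>\<omega>. Y \<omega> * U (Suc n) \<omega>)"
      by (intro integrable_mult_L2 U_L2 rm r2 Y_measurable Y_L2)+
    have "real (Suc n) * (f (S T \<omega>, Trap (Suc n) \<omega>) - f (S T \<omega>, Avg \<omega>)) = \<rho> (Suc n) \<omega> * U (Suc n) \<omega> + Y \<omega> * U (Suc n) \<omega>" for \<omega>
    proof (cases "Trap (Suc n) \<omega> = Avg \<omega>")
      case False
      have "\<rho> (Suc n) \<omega> * U (Suc n) \<omega> + Y \<omega> * U (Suc n) \<omega>
        = (f (S T \<omega>, Trap (Suc n) \<omega>) - f (S T \<omega>, Avg \<omega>)) / (Trap (Suc n) \<omega> - Avg \<omega>) * U (Suc n) \<omega>"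
        unfolding \<rho>_def if_not_P[OF False] by (simp add: left_diff_distrib)
      then show ?thesis using False by (simp add: U_def del: of_nat_Suc)
    qed (simp add: \<rho>_def U_def)
    then have "real (Suc n) * expectation (\<lambda>\<omega>. f (S T \<omega>, Trap (Suc n) \<omega>) - f (S T \<omega>, Avg \<omega>))
      = expectation (\<lambda>\<omega>. \<rho> (Suc n) \<omega> * U (Suc n) \<omega> + Y \<omega> * U (Suc n) \<omega>)"
      by (simp only: Bochner_Integration.integral_mult_right_zero[symmetric])
    then show ?thesis using i by simp
  qed
  with tendsto_add[OF lim1 lim2]
  have "(\<lambda>n. real (Suc n) * expectation (\<lambda>\<omega>. f (S T \<omega>, Trap (Suc n) \<omega>) - f (S T \<omega>, Avg \<omega>))) \<longlonglongrightarrow> 0"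
    by (simp del: of_nat_Suc)
  then show ?thesis by (rule LIMSEQ_imp_Suc)
qed

end

section \<open>The Ito isometry\<close>

context brownian
begin

lemma expectation_mult_increment_zero:
  assumes "0 \<le> s" "s \<le> t" "t \<le> T" "X \<in> borel_measurable (F s)" "integrable M X"
  shows "integrable M (\<lambda>\<omega>. X \<omega> * (W t \<omega> - W s \<omega>))" "expectation (\<lambda>\<omega>. X \<omega> * (W t \<omega> - W s \<omega>)) = 0"
  using expectation_indep_increment[OF assms, of "\<lambda>x. x"] increment_moments(3,4)[OF assms(1-3)] by auto

lemma bounded_mult_increment_L2:
  assumes st: "0 \<le> s" "s \<le> t" "t \<le> T"
    and X: "X \<in> borel_measurable M" "\<And>\<omega>. \<omega> \<in> space M \<Longrightarrow> \<bar>X \<omega>\<bar> \<le> K"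
  shows "(\<lambda>\<omega>. X \<omega> * (W t \<omega> - W s \<omega>)) \<in> borel_measurable M"
    "integrable M (\<lambda>\<omega>. (X \<omega> * (W t \<omega> - W s \<omega>))\<^sup>2)"
proof -
  have [measurable]: "W t \<in> borel_measurable M" "W s \<in> borel_measurable M" "X \<in> borel_measurable M"
    using st X by (auto intro: measurable_W)
  show "(\<lambda>\<omega>. X \<omega> * (W t \<omega> - W s \<omega>)) \<in> borel_measurable M" by measurable
  show "integrable M (\<lambda>\<omega>. (X \<omega> * (W t \<omega> - W s \<omega>))\<^sup>2)"
  proof (rule Bochner_Integration.integrable_bound)
    show "integrable M (\<lambda>\<omega>. K\<^sup>2 * (W t \<omega> - W s \<omega>)\<^sup>2)" using increment_moments(5)[OF st] by simp
    show "AE \<omega> in M. norm ((X \<omega> * (W t \<omega> - W s \<omega>))\<^sup>2) \<le> norm (K\<^sup>2 * (W t \<omega> - W s \<omega>)\<^sup>2)"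
    proof (intro AE_I2)
      fix \<omega> assume "\<omega> \<in> space M"
      then have "\<bar>X \<omega>\<bar>\<^sup>2 \<le> K\<^sup>2" by (intro power_mono X) auto
      then show "norm ((X \<omega> * (W t \<omega> - W s \<omega>))\<^sup>2) \<le> norm (K\<^sup>2 * (W t \<omega> - W s \<omega>)\<^sup>2)"
        by (simp add: power_mult_distrib mult_right_mono)
    qed
  qed measurable
qed

text \<open>If the second interval starts after the first has ended, its increment is centred given
  everything else. Otherwise the product is split along the overlap: its square contributes the
  common length, and in each other term the increment over the latest interval is centred given the
  remaining factors.\<close>

lemma increment_inner_aux:
  assumes ab: "0 \<le> a" "a \<le> b" "b \<le> T" and cd: "c \<le> d" "d \<le> T" and ac: "a \<le> c"
    and x: "\<xi> \<in> borel_measurable (F a)" "\<And>\<omega>. \<omega> \<in> space M \<Longrightarrow> \<bar>\<xi> \<omega>\<bar> \<le> K"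
    and y: "\<eta> \<in> borel_measurable (F c)" "\<And>\<omega>. \<omega> \<in> space M \<Longrightarrow> \<bar>\<eta> \<omega>\<bar> \<le> L"
  shows "expectation (\<lambda>\<omega>. (\<xi> \<omega> * (W b \<omega> - W a \<omega>)) * (\<eta> \<omega> * (W d \<omega> - W c \<omega>)))
    = expectation (\<lambda>\<omega>. \<xi> \<omega> * \<eta> \<omega>) * max 0 (min b d - max a c)"
proof -
  have c0: "0 \<le> c" "c \<le> T" using ab ac cd by auto
  have xc: "\<xi> \<in> borel_measurable (F c)" using measurable_F_mono[OF x(1) ac] .
  note xm = measurable_F_imp[OF x(1)] and ym = measurable_F_imp[OF y(1)]
  have bdd: "\<bar>\<xi> \<omega> * \<eta> \<omega>\<bar> \<le> K * L" if "\<omega> \<in> space M" for \<omega>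
  proof -
    have "0 \<le> K" using x(2)[OF that] by linarith
    then show ?thesis unfolding abs_mult using x(2)[OF that] y(2)[OF that] by (intro mult_mono) auto
  qed
  have xyF: "(\<lambda>\<omega>. \<xi> \<omega> * \<eta> \<omega>) \<in> borel_measurable (F c)" using xc y(1) by (rule borel_measurable_times)
  have xym: "(\<lambda>\<omega>. \<xi> \<omega> * \<eta> \<omega>) \<in> borel_measurable M" using xyF by (rule measurable_F_imp)
  have xyi: "integrable M (\<lambda>\<omega>. \<xi> \<omega> * \<eta> \<omega>)"
    using xym bdd by (intro integrable_const_bound[where B="K * L"]) auto
  have prod_int: "integrable M (\<lambda>\<omega>. \<xi> \<omega> * \<eta> \<omega> * (W t \<omega> - W s \<omega>))" if "0 \<le> s" "s \<le> t" "t \<le> T" for s t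
    using bounded_mult_increment_L2[OF that xym bdd] by (rule square_integrable_imp_integrable)
  show ?thesis
  proof (cases "b \<le> c")
    case True
    have "(\<lambda>\<omega>. \<xi> \<omega> * \<eta> \<omega> * (W b \<omega> - W a \<omega>)) \<in> borel_measurable (F c)"
      using xyF measurable_W_F[of b c] measurable_W_F[of a c] ab True ac
      by (intro borel_measurable_times[where f="\<lambda>\<omega>. \<xi> \<omega> * \<eta> \<omega>"] borel_measurable_diff) auto
    from expectation_mult_increment_zero(2)[OF c0(1) cd this prod_int[OF ab]] True ac
    show ?thesis by (simp add: mult_ac max_def)
  next
    case False
    \<comment> \<open>\<open>{c..e}\<close> is the overlap, and \<open>{e..m}\<close> is the part
      after it that belongs to whichever interval ends last.\<close>
    define e m where "e = min b d" and "m = max b d"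
    have em: "c \<le> e" "e \<le> m" "m \<le> T" "0 \<le> e" "e \<le> T" using False ab cd c0 by (auto simp: e_def m_def)
    have eq: "(\<xi> \<omega> * (W b \<omega> - W a \<omega>)) * (\<eta> \<omega> * (W d \<omega> - W c \<omega>))
      = \<xi> \<omega> * \<eta> \<omega> * (W c \<omega> - W a \<omega>) * (W d \<omega> - W c \<omega>) + \<xi> \<omega> * \<eta> \<omega> * (W e \<omega> - W c \<omega>)\<^sup>2
        + \<xi> \<omega> * \<eta> \<omega> * (W e \<omega> - W c \<omega>) * (W m \<omega> - W e \<omega>)" for \<omega>
    proof -
      have "(W b \<omega> - W c \<omega>) * (W d \<omega> - W c \<omega>) = (W e \<omega> - W c \<omega>)\<^sup>2 + (W e \<omega> - W c \<omega>) * (W m \<omega> - W e \<omega>)"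
        by (cases "b \<le> d") (auto simp: e_def m_def min_def max_def power2_eq_square algebra_simps)
      then have "\<xi> \<omega> * \<eta> \<omega> * ((W b \<omega> - W c \<omega>) * (W d \<omega> - W c \<omega>))
        = \<xi> \<omega> * \<eta> \<omega> * ((W e \<omega> - W c \<omega>)\<^sup>2 + (W e \<omega> - W c \<omega>) * (W m \<omega> - W e \<omega>))" by simp
      then show ?thesis by (simp add: algebra_simps)
    qed
    have 1: "integrable M (\<lambda>\<omega>. \<xi> \<omega> * \<eta> \<omega> * (W c \<omega> - W a \<omega>) * (W d \<omega> - W c \<omega>))"
      "expectation (\<lambda>\<omega>. \<xi> \<omega> * \<eta> \<omega> * (W c \<omega> - W a \<omega>) * (W d \<omega> - W c \<omega>)) = 0"
    proof -
      have "(\<lambda>\<omega>. \<xi> \<omega> * \<eta> \<omega> * (W c \<omega> - W a \<omega>)) \<in> borel_measurable (F c)"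
        using xyF measurable_W_F[of c c] measurable_W_F[of a c] ab ac c0
        by (intro borel_measurable_times[where f="\<lambda>\<omega>. \<xi> \<omega> * \<eta> \<omega>"] borel_measurable_diff) auto
      from expectation_mult_increment_zero[OF c0(1) cd this prod_int[OF ab(1) ac c0(2)]]
      show "integrable M (\<lambda>\<omega>. \<xi> \<omega> * \<eta> \<omega> * (W c \<omega> - W a \<omega>) * (W d \<omega> - W c \<omega>))"
        "expectation (\<lambda>\<omega>. \<xi> \<omega> * \<eta> \<omega> * (W c \<omega> - W a \<omega>) * (W d \<omega> - W c \<omega>)) = 0" by auto
    qed
    have 2: "integrable M (\<lambda>\<omega>. \<xi> \<omega> * \<eta> \<omega> * (W e \<omega> - W c \<omega>)\<^sup>2)"
      "expectation (\<lambda>\<omega>. \<xi> \<omega> * \<eta> \<omega> * (W e \<omega> - W c \<omega>)\<^sup>2) = expectation (\<lambda>\<omega>. \<xi> \<omega> * \<eta> \<omega>) * (e - c)"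
      using expectation_indep_increment[OF c0(1) em(1,5) xyF xyi, of "\<lambda>x. x\<^sup>2"] increment_moments(5,6)[OF c0(1) em(1,5)]
      by auto
    have 3: "integrable M (\<lambda>\<omega>. \<xi> \<omega> * \<eta> \<omega> * (W e \<omega> - W c \<omega>) * (W m \<omega> - W e \<omega>))"
      "expectation (\<lambda>\<omega>. \<xi> \<omega> * \<eta> \<omega> * (W e \<omega> - W c \<omega>) * (W m \<omega> - W e \<omega>)) = 0"
    proof -
      have "(\<lambda>\<omega>. \<xi> \<omega> * \<eta> \<omega> * (W e \<omega> - W c \<omega>)) \<in> borel_measurable (F e)"
        using measurable_F_mono[OF xyF em(1)] measurable_W_F[of e e] measurable_W_F[of c e] em c0
        by (intro borel_measurable_times[where f="\<lambda>\<omega>. \<xi> \<omega> * \<eta> \<omega>"] borel_measurable_diff) auto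
      from expectation_mult_increment_zero[OF em(4,2,3) this prod_int[OF c0(1) em(1,5)]]
      show "integrable M (\<lambda>\<omega>. \<xi> \<omega> * \<eta> \<omega> * (W e \<omega> - W c \<omega>) * (W m \<omega> - W e \<omega>))"
        "expectation (\<lambda>\<omega>. \<xi> \<omega> * \<eta> \<omega> * (W e \<omega> - W c \<omega>) * (W m \<omega> - W e \<omega>)) = 0" by auto
    qed
    have "max 0 (min b d - max a c) = e - c" using ac em(1) by (simp add: e_def max_def)
    then show ?thesis unfolding eq using 1 2 3 by simp
  qed
qed

lemma increment_inner:
  assumes ab: "0 \<le> a" "a \<le> b" "b \<le> T" and cd: "0 \<le> c" "c \<le> d" "d \<le> T"
    and x: "\<xi> \<in> borel_measurable (F a)" "\<And>\<omega>. \<omega> \<in> space M \<Longrightarrow> \<bar>\<xi> \<omega>\<bar> \<le> K"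
    and y: "\<eta> \<in> borel_measurable (F c)" "\<And>\<omega>. \<omega> \<in> space M \<Longrightarrow> \<bar>\<eta> \<omega>\<bar> \<le> L"
  shows "expectation (\<lambda>\<omega>. (\<xi> \<omega> * (W b \<omega> - W a \<omega>)) * (\<eta> \<omega> * (W d \<omega> - W c \<omega>)))
    = expectation (\<lambda>\<omega>. \<xi> \<omega> * \<eta> \<omega>) * max 0 (min b d - max a c)"
proof (cases "a \<le> c")
  case True
  show ?thesis by (rule increment_inner_aux[OF ab cd(2,3) True x y])
next
  case False
  then have "c \<le> a" by simp
  from increment_inner_aux[OF cd ab(2,3) this y x] show ?thesis
    by (simp add: mult.commute min.commute max.commute)
qed

text \<open>The intervals may overlap, so the difference of two simple processes on different partitions
  is covered without passing to a common refinement.\<close>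

lemma simple_isometry:
  fixes \<xi> :: "'i \<Rightarrow> 'a \<Rightarrow> real" and lo hi :: "'i \<Rightarrow> real"
  assumes I: "finite I"
    and t: "\<And>i. i \<in> I \<Longrightarrow> 0 \<le> lo i" "\<And>i. i \<in> I \<Longrightarrow> lo i \<le> hi i" "\<And>i. i \<in> I \<Longrightarrow> hi i \<le> T"
    and x: "\<And>i. i \<in> I \<Longrightarrow> \<xi> i \<in> borel_measurable (F (lo i))"
      "\<And>i. i \<in> I \<Longrightarrow> \<exists>K. \<forall>\<omega>\<in>space M. \<bar>\<xi> i \<omega>\<bar> \<le> K"
  shows "integrable M (\<lambda>\<omega>. (\<Sum>i\<in>I. \<xi> i \<omega> * (W (hi i) \<omega> - W (lo i) \<omega>))\<^sup>2)"
    "(\<integral>\<^sup>+(t, \<omega>). ennreal ((\<Sum>i\<in>I. \<xi> i \<omega> * indicator {lo i<..hi i} t)\<^sup>2) \<partial>(restrict_space lborel {0..T} \<Otimes>\<^sub>M M))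
      = ennreal (expectation (\<lambda>\<omega>. (\<Sum>i\<in>I. \<xi> i \<omega> * (W (hi i) \<omega> - W (lo i) \<omega>))\<^sup>2))"
proof -
  let ?R = "restrict_space lborel {0..T}"
  obtain K where K: "\<And>i \<omega>. i \<in> I \<Longrightarrow> \<omega> \<in> space M \<Longrightarrow> \<bar>\<xi> i \<omega>\<bar> \<le> K i" using x(2) by metis
  have xm: "\<xi> i \<in> borel_measurable M" if "i \<in> I" for i using x(1)[OF that] by (rule measurable_F_imp)
  note L2 = bounded_mult_increment_L2[OF t xm K]
  show "integrable M (\<lambda>\<omega>. (\<Sum>i\<in>I. \<xi> i \<omega> * (W (hi i) \<omega> - W (lo i) \<omega>))\<^sup>2)"
    using L2 by (intro integrable_sum_L2 I) auto
  define len where "len i j = max 0 (min (hi i) (hi j) - max (lo i) (lo j))" for i j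
  have "expectation (\<lambda>\<omega>. (\<Sum>i\<in>I. \<xi> i \<omega> * (W (hi i) \<omega> - W (lo i) \<omega>))\<^sup>2)
    = expectation (\<lambda>\<omega>. \<Sum>i\<in>I. \<Sum>j\<in>I. (\<xi> i \<omega> * (W (hi i) \<omega> - W (lo i) \<omega>)) * (\<xi> j \<omega> * (W (hi j) \<omega> - W (lo j) \<omega>)))"
    by (simp add: power2_eq_square sum_product)
  also have "\<dots> = (\<Sum>i\<in>I. \<Sum>j\<in>I. expectation (\<lambda>\<omega>. (\<xi> i \<omega> * (W (hi i) \<omega> - W (lo i) \<omega>)) * (\<xi> j \<omega> * (W (hi j) \<omega> - W (lo j) \<omega>))))"
    using L2 by (subst Bochner_Integration.integral_sum)
      (auto intro!: Bochner_Integration.integrable_sum integrable_mult_L2 sum.cong Bochner_Integration.integral_sum)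
  also have "\<dots> = (\<Sum>i\<in>I. \<Sum>j\<in>I. expectation (\<lambda>\<omega>. \<xi> i \<omega> * \<xi> j \<omega>) * len i j)"
    unfolding len_def by (intro sum.cong refl increment_inner[OF t t x(1) K x(1) K])
  finally have E: "expectation (\<lambda>\<omega>. (\<Sum>i\<in>I. \<xi> i \<omega> * (W (hi i) \<omega> - W (lo i) \<omega>))\<^sup>2)
    = (\<Sum>i\<in>I. \<Sum>j\<in>I. expectation (\<lambda>\<omega>. \<xi> i \<omega> * \<xi> j \<omega>) * len i j)" .
  interpret R: finite_measure ?R
    by (rule finite_measureI) (simp add: emeasure_restrict_space emeasure_lborel_Icc_eq)
  interpret P: pair_sigma_finite ?R M ..
  interpret PF: finite_measure "?R \<Otimes>\<^sub>M M"
    by (rule finite_measure_pair_measure) unfold_locales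
  have pair: "integrable (?R \<Otimes>\<^sub>M M) (\<lambda>z. (\<xi> i (snd z) * indicator {lo i<..hi i} (fst z)) * (\<xi> j (snd z) * indicator {lo j<..hi j} (fst z)))"
    (is "integrable _ ?g")
    "(\<integral>z. (\<xi> i (snd z) * indicator {lo i<..hi i} (fst z)) * (\<xi> j (snd z) * indicator {lo j<..hi j} (fst z)) \<partial>(?R \<Otimes>\<^sub>M M))
      = expectation (\<lambda>\<omega>. \<xi> i \<omega> * \<xi> j \<omega>) * len i j" if ij: "i \<in> I" "j \<in> I" for i j
  proof -
    note [measurable] = xm[OF ij(1)] xm[OF ij(2)]
    have [measurable]: "indicator {lo k<..hi k} \<in> borel_measurable ?R" for k
      by (intro measurable_restrict_space1) measurable
    show int: "integrable (?R \<Otimes>\<^sub>M M) ?g"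
    proof (rule PF.integrable_const_bound[where B="K i * K j"])
      show "AE z in ?R \<Otimes>\<^sub>M M. norm (?g z) \<le> K i * K j"
      proof (intro AE_I2)
        fix z assume "z \<in> space (?R \<Otimes>\<^sub>M M)"
        then have w: "snd z \<in> space M" by (auto simp: space_pair_measure)
        have K0: "0 \<le> K i" "0 \<le> K j" using K[OF ij(1) w] K[OF ij(2) w] by linarith+
        have "\<bar>\<xi> i (snd z)\<bar> * \<bar>\<xi> j (snd z)\<bar> \<le> K i * K j" using K ij w K0 by (intro mult_mono) auto
        then show "norm (?g z) \<le> K i * K j" using K0 by (auto simp: abs_mult indicator_def)
      qed
    qed measurable
    have meas: "(\<integral>t. indicator {lo i<..hi i} t * (indicator {lo j<..hi j} t :: real) \<partial>?R) = len i j"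
    proof -
      have "(\<integral>t. indicator {lo i<..hi i} t * (indicator {lo j<..hi j} t :: real) \<partial>?R)
        = (\<integral>t. indicator {0..T} t *\<^sub>R (indicator {lo i<..hi i} t * indicator {lo j<..hi j} t) \<partial>lborel)"
        by (rule integral_restrict_space) simp
      also have "\<dots> = (\<integral>t. indicator {max (lo i) (lo j)<..min (hi i) (hi j)} t \<partial>lborel)"
        using t[OF ij(1)] t[OF ij(2)] by (intro Bochner_Integration.integral_cong) (auto simp: indicator_def)
      also have "\<dots> = len i j" by (auto simp: len_def max_def)
      finally show ?thesis .
    qed
    have "(\<integral>z. ?g z \<partial>(?R \<Otimes>\<^sub>M M)) = (\<integral>t. (\<integral>\<omega>. ?g (t, \<omega>) \<partial>M) \<partial>?R)"
      by (rule P.integral_fst'[OF int, symmetric])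
    also have "\<dots> = (\<integral>t. (indicator {lo i<..hi i} t * indicator {lo j<..hi j} t) * expectation (\<lambda>\<omega>. \<xi> i \<omega> * \<xi> j \<omega>) \<partial>?R)"
    proof (rule Bochner_Integration.integral_cong[OF refl])
      fix t
      have "?g (t, \<omega>) = (indicator {lo i<..hi i} t * indicator {lo j<..hi j} t) * (\<xi> i \<omega> * \<xi> j \<omega>)" for \<omega> by simp
      then show "(\<integral>\<omega>. ?g (t, \<omega>) \<partial>M) = (indicator {lo i<..hi i} t * indicator {lo j<..hi j} t) * expectation (\<lambda>\<omega>. \<xi> i \<omega> * \<xi> j \<omega>)"
        by (simp only: Bochner_Integration.integral_mult_right_zero)
    qed
    also have "\<dots> = expectation (\<lambda>\<omega>. \<xi> i \<omega> * \<xi> j \<omega>) * len i j"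
      unfolding Bochner_Integration.integral_mult_left_zero meas by simp
    finally show "(\<integral>z. ?g z \<partial>(?R \<Otimes>\<^sub>M M)) = expectation (\<lambda>\<omega>. \<xi> i \<omega> * \<xi> j \<omega>) * len i j" .
  qed
  have sq: "(\<Sum>i\<in>I. \<xi> i (snd z) * indicator {lo i<..hi i} (fst z))\<^sup>2
    = (\<Sum>i\<in>I. \<Sum>j\<in>I. (\<xi> i (snd z) * indicator {lo i<..hi i} (fst z)) * (\<xi> j (snd z) * indicator {lo j<..hi j} (fst z)))" for z
    by (simp add: power2_eq_square sum_product)
  have "(\<integral>\<^sup>+z. ennreal ((\<Sum>i\<in>I. \<xi> i (snd z) * indicator {lo i<..hi i} (fst z))\<^sup>2) \<partial>(?R \<Otimes>\<^sub>M M))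
    = ennreal (\<integral>z. (\<Sum>i\<in>I. \<xi> i (snd z) * indicator {lo i<..hi i} (fst z))\<^sup>2 \<partial>(?R \<Otimes>\<^sub>M M))"
  proof (rule nn_integral_eq_integral)
    show "integrable (?R \<Otimes>\<^sub>M M) (\<lambda>z. (\<Sum>i\<in>I. \<xi> i (snd z) * indicator {lo i<..hi i} (fst z))\<^sup>2)"
      unfolding sq by (intro Bochner_Integration.integrable_sum pair)
  qed simp
  also have "(\<integral>z. (\<Sum>i\<in>I. \<xi> i (snd z) * indicator {lo i<..hi i} (fst z))\<^sup>2 \<partial>(?R \<Otimes>\<^sub>M M))
    = (\<Sum>i\<in>I. \<Sum>j\<in>I. expectation (\<lambda>\<omega>. \<xi> i \<omega> * \<xi> j \<omega>) * len i j)"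
    unfolding sq using pair by (subst Bochner_Integration.integral_sum)
      (auto intro!: Bochner_Integration.integrable_sum sum.cong simp: Bochner_Integration.integral_sum)
  finally show "(\<integral>\<^sup>+(t, \<omega>). ennreal ((\<Sum>i\<in>I. \<xi> i \<omega> * indicator {lo i<..hi i} t)\<^sup>2) \<partial>(?R \<Otimes>\<^sub>M M))
      = ennreal (expectation (\<lambda>\<omega>. (\<Sum>i\<in>I. \<xi> i \<omega> * (W (hi i) \<omega> - W (lo i) \<omega>))\<^sup>2))"
    unfolding E by (simp add: split_beta')
qed

lemma simple_integrandD:
  assumes "simple_integrand M F T m \<tau> \<xi>" "i < m"
  shows "0 \<le> \<tau> i" "\<tau> i \<le> \<tau> (Suc i)" "\<tau> (Suc i) \<le> T" "\<xi> i \<in> borel_measurable (F (\<tau> i))"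
    "\<exists>K. \<forall>\<omega>\<in>space M. \<bar>\<xi> i \<omega>\<bar> \<le> K"
proof -
  have s: "0 \<le> \<tau> 0" "\<tau> m \<le> T" and mono: "\<And>i. i < m \<Longrightarrow> \<tau> i \<le> \<tau> (Suc i)"
    using assms(1) by (auto simp: simple_integrand_def)
  have "\<tau> k \<le> \<tau> l" if "k \<le> l" "l \<le> m" for k l
    using that
  proof (induction l rule: dec_induct)
    case (step n) then show ?case using mono[of n] by linarith
  qed simp
  from this[of 0 i] this[of "Suc i" m] assms(2) s mono[OF assms(2)]
  show "0 \<le> \<tau> i" "\<tau> i \<le> \<tau> (Suc i)" "\<tau> (Suc i) \<le> T" by auto
  show "\<xi> i \<in> borel_measurable (F (\<tau> i))" "\<exists>K. \<forall>\<omega>\<in>space M. \<bar>\<xi> i \<omega>\<bar> \<le> K"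
    using assms by (auto simp: simple_integrand_def)
qed

lemma simple_integral_L2:
  assumes "simple_integrand M F T m \<tau> \<xi>"
  shows "simple_integral W m \<tau> \<xi> \<in> borel_measurable M"
    "integrable M (\<lambda>\<omega>. (simple_integral W m \<tau> \<xi> \<omega>)\<^sup>2)"
proof -
  note D = simple_integrandD[OF assms]
  show "integrable M (\<lambda>\<omega>. (simple_integral W m \<tau> \<xi> \<omega>)\<^sup>2)"
    unfolding simple_integral_def by (rule simple_isometry(1)) (use D in auto)
  show "simple_integral W m \<tau> \<xi> \<in> borel_measurable M"
    unfolding simple_integral_def[abs_def]
  proof (intro borel_measurable_sum borel_measurable_times borel_measurable_diff)
    fix i assume "i \<in> {..<m}"
    then have i: "i < m" by simp
    show "\<xi> i \<in> borel_measurable M" using D(4)[OF i] by (rule measurable_F_imp)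
    show "W (\<tau> (Suc i)) \<in> borel_measurable M" "W (\<tau> i) \<in> borel_measurable M"
      using D(1-3)[OF i] by (auto intro!: measurable_W)
  qed
qed

text \<open>The difference of two simple processes is again a sum of bounded adapted coefficients on
  intervals, indexed by the disjoint union with the second coefficients negated; the general
  isometry then applies.\<close>

lemma simple_integral_isometry:
  assumes s: "simple_integrand M F T m \<tau> \<xi>" and s': "simple_integrand M F T m' \<tau>' \<xi>'"
  shows "(\<integral>\<^sup>+\<omega>. ennreal ((simple_integral W m \<tau> \<xi> \<omega> - simple_integral W m' \<tau>' \<xi>' \<omega>)\<^sup>2) \<partial>M)
    = (\<integral>\<^sup>+(t, \<omega>). ennreal ((simple_process m \<tau> \<xi> t \<omega> - simple_process m' \<tau>' \<xi>' t \<omega>)\<^sup>2) \<partial>(restrict_space lborel {0..T} \<Otimes>\<^sub>M M))"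
proof -
  define I where "I = {..<m} <+> {..<m'}"
  define lo where "lo = case_sum \<tau> \<tau>'"
  define hi where "hi = case_sum (\<lambda>i. \<tau> (Suc i)) (\<lambda>i. \<tau>' (Suc i))"
  define x where "x = case_sum \<xi> (\<lambda>i \<omega>. - \<xi>' i \<omega>)"
  note D = simple_integrandD[OF s] and D' = simple_integrandD[OF s']
  have I: "finite I" by (simp add: I_def)
  have t: "0 \<le> lo i" "lo i \<le> hi i" "hi i \<le> T" "x i \<in> borel_measurable (F (lo i))" "\<exists>K. \<forall>\<omega>\<in>space M. \<bar>x i \<omega>\<bar> \<le> K" if "i \<in> I" for i
    using that D D' unfolding I_def lo_def hi_def x_def by auto
  have a: "(\<Sum>i\<in>I. x i \<omega> * (W (hi i) \<omega> - W (lo i) \<omega>)) = simple_integral W m \<tau> \<xi> \<omega> - simple_integral W m' \<tau>' \<xi>' \<omega>" for \<omega>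
    unfolding I_def simple_integral_def by (subst sum.Plus) (auto simp: lo_def hi_def x_def sum_negf)
  have b: "(\<Sum>i\<in>I. x i \<omega> * indicator {lo i<..hi i} t) = simple_process m \<tau> \<xi> t \<omega> - simple_process m' \<tau>' \<xi>' t \<omega>" for t \<omega>
    unfolding I_def simple_process_def by (subst sum.Plus) (auto simp: lo_def hi_def x_def sum_negf)
  note iso = simple_isometry[where I=I and lo=lo and hi=hi and \<xi>=x, OF I t, unfolded a b]
  have "(\<integral>\<^sup>+\<omega>. ennreal ((simple_integral W m \<tau> \<xi> \<omega> - simple_integral W m' \<tau>' \<xi>' \<omega>)\<^sup>2) \<partial>M)
    = ennreal (expectation (\<lambda>\<omega>. (simple_integral W m \<tau> \<xi> \<omega> - simple_integral W m' \<tau>' \<xi>' \<omega>)\<^sup>2))"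
    using iso(1) by (intro nn_integral_eq_integral) auto
  then show ?thesis using iso(2) by (rule trans[OF _ sym])
qed

lemma simple_process_measurable:
  assumes "simple_integrand M F T m \<tau> \<xi>"
  shows "(\<lambda>(t, \<omega>). simple_process m \<tau> \<xi> t \<omega>) \<in> borel_measurable (restrict_space lborel {0..T} \<Otimes>\<^sub>M M)"
proof -
  have "(\<lambda>z. \<Sum>i<m. \<xi> i (snd z) * indicator {\<tau> i<..\<tau> (Suc i)} (fst z)) \<in> borel_measurable (restrict_space lborel {0..T} \<Otimes>\<^sub>M M)"
  proof (intro borel_measurable_sum borel_measurable_times)
    fix i assume "i \<in> {..<m}"
    then have "\<xi> i \<in> borel_measurable M" using simple_integrandD(4)[OF assms] measurable_F_imp by auto
    then show "(\<lambda>z. \<xi> i (snd z)) \<in> borel_measurable (restrict_space lborel {0..T} \<Otimes>\<^sub>M M)"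
      by (rule measurable_compose[OF measurable_snd])
    have "indicator {\<tau> i<..\<tau> (Suc i)} \<in> borel_measurable (restrict_space lborel {0..T})"
      by (intro measurable_restrict_space1) measurable
    then show "(\<lambda>z. indicator {\<tau> i<..\<tau> (Suc i)} (fst z)) \<in> borel_measurable (restrict_space lborel {0..T} \<Otimes>\<^sub>M M)"
      by (rule measurable_compose[OF measurable_fst])
  qed
  then show ?thesis by (simp add: simple_process_def split_beta')
qed

lemma nn_integral_square_add_le:
  fixes f g :: "'b \<Rightarrow> real"
  assumes [measurable]: "f \<in> borel_measurable N" "g \<in> borel_measurable N"
  shows "(\<integral>\<^sup>+x. ennreal ((f x + g x)\<^sup>2) \<partial>N) \<le> 2 * (\<integral>\<^sup>+x. ennreal ((f x)\<^sup>2) \<partial>N) + 2 * (\<integral>\<^sup>+x. ennreal ((g x)\<^sup>2) \<partial>N)"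
proof -
  have "(\<integral>\<^sup>+x. ennreal ((f x + g x)\<^sup>2) \<partial>N) \<le> (\<integral>\<^sup>+x. 2 * ennreal ((f x)\<^sup>2) + 2 * ennreal ((g x)\<^sup>2) \<partial>N)"
  proof (rule nn_integral_mono)
    fix x
    have "ennreal ((f x + g x)\<^sup>2) \<le> ennreal (2 * (f x)\<^sup>2 + 2 * (g x)\<^sup>2)" by (intro ennreal_leI square_add_le)
    also have "\<dots> = 2 * ennreal ((f x)\<^sup>2) + 2 * ennreal ((g x)\<^sup>2)" by (simp add: ennreal_plus ennreal_mult)
    finally show "ennreal ((f x + g x)\<^sup>2) \<le> 2 * ennreal ((f x)\<^sup>2) + 2 * ennreal ((g x)\<^sup>2)" .
  qed
  also have "\<dots> = 2 * (\<integral>\<^sup>+x. ennreal ((f x)\<^sup>2) \<partial>N) + 2 * (\<integral>\<^sup>+x. ennreal ((g x)\<^sup>2) \<partial>N)"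
    by (subst nn_integral_add) (auto simp: nn_integral_cmult)
  finally show ?thesis .
qed

text \<open>\<open>X\<close> comes with some approximating sequence of which nothing else is known,
  while orthogonality is known for the sequence given by \<open>m'\<close>, \<open>\<tau>'\<close>
  and \<open>\<xi>'\<close>. Both sequences approximate \<open>H\<close>, so by the isometry their
  integrals have the same limit \<open>X\<close> in L2, and orthogonality to \<open>V\<close>
  survives the limit.\<close>

theorem ito_integral_orthogonal:
  assumes ito: "has_ito_integral M F T W H X"
    and V: "V \<in> borel_measurable M" "integrable M (\<lambda>\<omega>. (V \<omega>)\<^sup>2)"
    and s': "\<And>l::nat. simple_integrand M F T (m' l) (\<tau>' l) (\<xi>' l)"
    and c: "(\<lambda>l. \<integral>\<^sup>+ (t, \<omega>). ennreal ((simple_process (m' l) (\<tau>' l) (\<xi>' l) t \<omega> - H t \<omega>)\<^sup>2)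
               \<partial>(restrict_space lborel {0..T} \<Otimes>\<^sub>M M)) \<longlonglongrightarrow> 0"
    and z: "\<And>l. expectation (\<lambda>\<omega>. V \<omega> * simple_integral W (m' l) (\<tau>' l) (\<xi>' l) \<omega>) = 0"
  shows "X \<in> borel_measurable M" "integrable M (\<lambda>\<omega>. (X \<omega>)\<^sup>2)" "expectation (\<lambda>\<omega>. V \<omega> * X \<omega>) = 0"
proof -
  let ?P = "restrict_space lborel {0..T} \<Otimes>\<^sub>M M"
  from ito have Hm: "(\<lambda>(t, \<omega>). H t \<omega>) \<in> borel_measurable ?P" and Xm: "X \<in> borel_measurable M"
    by (auto simp: has_ito_integral_def)
  from ito obtain m \<tau> \<xi> where s: "\<And>k::nat. simple_integrand M F T (m k) (\<tau> k) (\<xi> k)"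
    and a: "(\<lambda>k. \<integral>\<^sup>+ (t, \<omega>). ennreal ((simple_process (m k) (\<tau> k) (\<xi> k) t \<omega> - H t \<omega>)\<^sup>2) \<partial>?P) \<longlonglongrightarrow> 0"
    and b: "(\<lambda>k. \<integral>\<^sup>+ \<omega>. ennreal ((simple_integral W (m k) (\<tau> k) (\<xi> k) \<omega> - X \<omega>)\<^sup>2) \<partial>M) \<longlonglongrightarrow> 0"
    unfolding has_ito_integral_def by blast
  show "X \<in> borel_measurable M" by (rule Xm)
  define h where "h k z = simple_process (m k) (\<tau> k) (\<xi> k) (fst z) (snd z)" for k z
  define h' where "h' l z = simple_process (m' l) (\<tau>' l) (\<xi>' l) (fst z) (snd z)" for l z
  define Y where "Y k = simple_integral W (m k) (\<tau> k) (\<xi> k)" for k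
  define Y' where "Y' l = simple_integral W (m' l) (\<tau>' l) (\<xi>' l)" for l
  define H' where "H' z = H (fst z) (snd z)" for z
  have [measurable]: "h k \<in> borel_measurable ?P" "h' l \<in> borel_measurable ?P" "H' \<in> borel_measurable ?P" for k l
    using simple_process_measurable[OF s] simple_process_measurable[OF s'] Hm
    by (simp_all add: h_def[abs_def] h'_def[abs_def] H'_def[abs_def] split_beta')
  note Y = simple_integral_L2[OF s, folded Y_def] and Y' = simple_integral_L2[OF s', folded Y'_def]
  note [measurable] = Y(1) Y'(1) Xm
  define \<alpha> where "\<alpha> k = (\<integral>\<^sup>+z. ennreal ((h k z - H' z)\<^sup>2) \<partial>?P)" for k
  define \<beta> where "\<beta> k = (\<integral>\<^sup>+\<omega>. ennreal ((Y k \<omega> - X \<omega>)\<^sup>2) \<partial>M)" for k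
  define \<gamma> where "\<gamma> l = (\<integral>\<^sup>+z. ennreal ((h' l z - H' z)\<^sup>2) \<partial>?P)" for l
  have a: "\<alpha> \<longlonglongrightarrow> 0" using a by (simp add: \<alpha>_def[abs_def] h_def H'_def split_beta')
  have b: "\<beta> \<longlonglongrightarrow> 0" using b by (simp add: \<beta>_def[abs_def] Y_def)
  have c: "\<gamma> \<longlonglongrightarrow> 0" using c by (simp add: \<gamma>_def[abs_def] h'_def H'_def split_beta')
  have iso: "(\<integral>\<^sup>+\<omega>. ennreal ((Y k \<omega> - Y' l \<omega>)\<^sup>2) \<partial>M) = (\<integral>\<^sup>+z. ennreal ((h k z - h' l z)\<^sup>2) \<partial>?P)" for k l
    using simple_integral_isometry[OF s s', of k l] by (simp add: Y_def Y'_def h_def h'_def split_beta')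
  \<comment> \<open>The distance from \<open>X\<close> to \<open>Y' l\<close> is estimated through
    \<open>Y k\<close> and, after the isometry, through \<open>H'\<close>. Letting \<open>k\<close>
    tend to infinity removes \<open>\<alpha> k\<close> and \<open>\<beta> k\<close> and leaves
    \<open>4 * \<gamma> l\<close>.\<close>
  have le: "(\<integral>\<^sup>+\<omega>. ennreal ((X \<omega> - Y' l \<omega>)\<^sup>2) \<partial>M) \<le> 4 * \<gamma> l" for l
  proof (rule LIMSEQ_le_const)
    have "(\<lambda>k. 2 * \<beta> k + 2 * (2 * \<alpha> k + 2 * \<gamma> l)) \<longlonglongrightarrow> 2 * 0 + 2 * (2 * 0 + 2 * \<gamma> l)"
      by (intro tendsto_add ennreal_tendsto_cmult a b tendsto_const) auto
    then show "(\<lambda>k. 2 * \<beta> k + 2 * (2 * \<alpha> k + 2 * \<gamma> l)) \<longlonglongrightarrow> 4 * \<gamma> l"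
      by (simp add: mult.assoc[symmetric])
    have "(\<integral>\<^sup>+\<omega>. ennreal ((X \<omega> - Y' l \<omega>)\<^sup>2) \<partial>M) \<le> 2 * \<beta> k + 2 * (2 * \<alpha> k + 2 * \<gamma> l)" for k
    proof -
      have "(\<integral>\<^sup>+\<omega>. ennreal ((X \<omega> - Y' l \<omega>)\<^sup>2) \<partial>M) = (\<integral>\<^sup>+\<omega>. ennreal (((X \<omega> - Y k \<omega>) + (Y k \<omega> - Y' l \<omega>))\<^sup>2) \<partial>M)"
        by simp
      also have "\<dots> \<le> 2 * (\<integral>\<^sup>+\<omega>. ennreal ((X \<omega> - Y k \<omega>)\<^sup>2) \<partial>M) + 2 * (\<integral>\<^sup>+\<omega>. ennreal ((Y k \<omega> - Y' l \<omega>)\<^sup>2) \<partial>M)"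
        by (rule nn_integral_square_add_le) measurable
      also have "(\<integral>\<^sup>+\<omega>. ennreal ((X \<omega> - Y k \<omega>)\<^sup>2) \<partial>M) = \<beta> k"
        by (simp add: \<beta>_def power2_commute)
      also have "(\<integral>\<^sup>+\<omega>. ennreal ((Y k \<omega> - Y' l \<omega>)\<^sup>2) \<partial>M) = (\<integral>\<^sup>+z. ennreal (((h k z - H' z) + (H' z - h' l z))\<^sup>2) \<partial>?P)"
        unfolding iso by simp
      also have "\<dots> \<le> 2 * (\<integral>\<^sup>+z. ennreal ((h k z - H' z)\<^sup>2) \<partial>?P) + 2 * (\<integral>\<^sup>+z. ennreal ((H' z - h' l z)\<^sup>2) \<partial>?P)"
        by (rule nn_integral_square_add_le) measurable
      also have "\<dots> = 2 * \<alpha> k + 2 * \<gamma> l" by (simp add: \<alpha>_def \<gamma>_def power2_commute)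
      finally show ?thesis by (simp add: add_left_mono mult_left_mono)
    qed
    then show "\<exists>N. \<forall>k\<ge>N. (\<integral>\<^sup>+\<omega>. ennreal ((X \<omega> - Y' l \<omega>)\<^sup>2) \<partial>M) \<le> 2 * \<beta> k + 2 * (2 * \<alpha> k + 2 * \<gamma> l)" by blast
  qed
  have fin: "\<forall>\<^sub>F l in sequentially. \<gamma> l < e" if "0 < e" for e
    using c that by (rule order_tendstoD(2))
  have dif: "integrable M (\<lambda>\<omega>. (X \<omega> - Y' l \<omega>)\<^sup>2)" "expectation (\<lambda>\<omega>. (X \<omega> - Y' l \<omega>)\<^sup>2) \<le> 4 * e"
    if "\<gamma> l < ennreal e" "0 \<le> e" for l e
  proof -
    have "4 * \<gamma> l \<le> 4 * ennreal e" using that(1) by (intro mult_left_mono) auto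
    also have "4 * ennreal e = ennreal (4 * e)" using that(2) by (simp add: ennreal_mult)
    finally have "(\<integral>\<^sup>+\<omega>. ennreal ((X \<omega> - Y' l \<omega>)\<^sup>2) \<partial>M) \<le> ennreal (4 * e)" using le[of l] by (rule order_trans[rotated])
    then show "integrable M (\<lambda>\<omega>. (X \<omega> - Y' l \<omega>)\<^sup>2)" "expectation (\<lambda>\<omega>. (X \<omega> - Y' l \<omega>)\<^sup>2) \<le> 4 * e"
      using that(2) by (auto intro!: integrable_nn_bound[where K="4 * e"])
  qed
  \<comment> \<open>A single approximation at finite distance places \<open>X\<close> in L2.\<close>
  obtain l where "\<gamma> l < ennreal 1" using fin[of "ennreal 1"] by (auto dest: eventually_happens)
  note d = dif(1)[OF this]
  show X2: "integrable M (\<lambda>\<omega>. (X \<omega>)\<^sup>2)"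
    using integrable_add_L2[where g="Y' l", OF _ Y'(1) d Y'(2)] by simp
  show "expectation (\<lambda>\<omega>. V \<omega> * X \<omega>) = 0"
  proof (rule ccontr)
    assume nz: "expectation (\<lambda>\<omega>. V \<omega> * X \<omega>) \<noteq> 0"
    define E where "E = \<bar>expectation (\<lambda>\<omega>. V \<omega> * X \<omega>)\<bar>"
    define A where "A = expectation (\<lambda>\<omega>. (V \<omega>)\<^sup>2) + 1"
    have E: "0 < E" using nz by (simp add: E_def)
    have "0 \<le> expectation (\<lambda>\<omega>. (V \<omega>)\<^sup>2)" by simp
    then have A: "0 < A" "expectation (\<lambda>\<omega>. (V \<omega>)\<^sup>2) \<le> A" unfolding A_def by linarith+
    \<comment> \<open>With this choice the Cauchy-Schwarz bound \<open>sqrt A * sqrt (4 * e)\<close>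
      equals \<open>E / sqrt 2\<close>, which is strictly below \<open>E\<close>. Adding 1 in
      \<open>A\<close> makes the division legitimate.\<close>
    define e where "e = E\<^sup>2 / (8 * A)"
    have e: "0 < e" using E A by (simp add: e_def)
    obtain l where l: "\<gamma> l < ennreal e" using fin[of "ennreal e"] e by (auto dest: eventually_happens)
    note d = dif[OF l less_imp_le[OF e]]
    have "expectation (\<lambda>\<omega>. V \<omega> * X \<omega>) = expectation (\<lambda>\<omega>. V \<omega> * (X \<omega> - Y' l \<omega>) + V \<omega> * Y' l \<omega>)"
      by (simp add: algebra_simps)
    also have "\<dots> = expectation (\<lambda>\<omega>. V \<omega> * (X \<omega> - Y' l \<omega>)) + expectation (\<lambda>\<omega>. V \<omega> * Y' l \<omega>)"
      using V d Y' by (intro Bochner_Integration.integral_add integrable_mult_L2) auto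
    also have "expectation (\<lambda>\<omega>. V \<omega> * Y' l \<omega>) = 0" unfolding Y'_def by (rule z)
    finally have "E \<le> sqrt A * sqrt (4 * e)"
      unfolding E_def using cauchy_schwarz_integral_bound[OF V(1) _ V(2) d(1) A(2) d(2)] by simp
    also have "\<dots> = sqrt (E\<^sup>2 / 2)" using A by (simp add: e_def flip: real_sqrt_mult)
    also have "\<dots> < sqrt (E\<^sup>2)" using E by (subst real_sqrt_less_iff) simp
    finally show False using E by simp
  qed
qed

end

section \<open>The stochastic integral on the extension\<close>

text \<open>The intervals are open on the left, as in \<open>simple_process\<close>, so the index is
  the ceiling of \<open>t / \<delta>\<close> minus 1 and the time 0 belongs to none of them.\<close>

lemma grid_locate:
  fixes t \<delta> :: real
  assumes \<delta>: "0 < \<delta>" and t: "0 < t" "t \<le> real m * \<delta>"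
  obtains i where "i < m" "\<And>j. t \<in> {real j * \<delta><..real (Suc j) * \<delta>} \<longleftrightarrow> j = i"
proof -
  define i where "i = nat (\<lceil>t / \<delta>\<rceil> - 1)"
  have pos: "0 < \<lceil>t / \<delta>\<rceil>" using \<delta> t by simp
  have c: "real i < t / \<delta>" "t / \<delta> \<le> real (Suc i)"
    using pos ceiling_correct[of "t / \<delta>"] by (auto simp: i_def of_nat_nat)
  have iff: "t \<in> {real j * \<delta><..real (Suc j) * \<delta>} \<longleftrightarrow> real j < t / \<delta> \<and> t / \<delta> \<le> real (Suc j)" for j
    using \<delta> by (simp add: pos_less_divide_eq pos_divide_le_eq del: of_nat_Suc)
  have u: "t \<in> {real j * \<delta><..real (Suc j) * \<delta>} \<longleftrightarrow> j = i" for j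
  proof
    assume "t \<in> {real j * \<delta><..real (Suc j) * \<delta>}"
    then have "real j < real (Suc i)" "real i < real (Suc j)" using c unfolding iff by linarith+
    then show "j = i" by simp
  qed (use c iff in auto)
  have "t / \<delta> \<le> real m" using t \<delta> by (simp add: pos_divide_le_eq)
  then have "i < m" using c(1) by linarith
  then show ?thesis using that u by blast
qed

section \<open>Approximation of the stock by bounded step processes\<close>

context black_scholes
begin

definition "KS = moment_bound 2 * (\<bar>2 * r + \<sigma>\<^sup>2\<bar> * exp (\<bar>2 * r + \<sigma>\<^sup>2\<bar> * T) + 2 * (\<bar>r\<bar> * exp (\<bar>r\<bar> * T)))"

text \<open>The relative increment is independent of \<open>S s\<close>, and its second moment is
  \<open>exp ((2 * r + \<sigma>\<^sup>2) * v) - 2 * exp (r * v) + 1\<close>. At \<open>v = 0\<close>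
  this vanishes, and the deviation of each exponential from 1 is linear in \<open>v\<close>; the two
  deviations make up \<open>KS\<close>.\<close>

lemma stock_increment_L2:
  assumes st: "0 \<le> s" "s \<le> t" "t \<le> T"
  shows "integrable M (\<lambda>\<omega>. (S t \<omega> - S s \<omega>)\<^sup>2)" "expectation (\<lambda>\<omega>. (S t \<omega> - S s \<omega>)\<^sup>2) \<le> KS * (t - s)"
proof -
  define v where "v = t - s"
  have v: "0 \<le> v" "v \<le> T" using st by (auto simp: v_def)
  define ea where "ea = exp ((r - \<sigma>\<^sup>2 / 2) * v)"
  define h where "h w = (ea * exp (\<sigma> * w) - 1)\<^sup>2" for w
  have eq: "(S t \<omega> - S s \<omega>)\<^sup>2 = (S s \<omega>)\<^sup>2 * h (W t \<omega> - W s \<omega>)" for \<omega>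
  proof -
    have "c * t + \<sigma> * a = (c * s + \<sigma> * b) + (c * (t - s) + \<sigma> * (a - b))" for c a b :: real
      by (simp add: algebra_simps)
    then have "S t \<omega> = S s \<omega> * (ea * exp (\<sigma> * (W t \<omega> - W s \<omega>)))"
      unfolding stock_def ea_def v_def by (metis exp_add mult.assoc)
    then have "S t \<omega> - S s \<omega> = S s \<omega> * (ea * exp (\<sigma> * (W t \<omega> - W s \<omega>)) - 1)" by (simp add: algebra_simps)
    then show ?thesis by (simp add: h_def power_mult_distrib)
  qed
  have h: "h w = ea\<^sup>2 * exp ((2 * \<sigma>) * w) - 2 * ea * exp (\<sigma> * w) + 1" for w
  proof -
    have "exp ((2 * \<sigma>) * w) = (exp (\<sigma> * w))\<^sup>2" by (simp flip: exp_double)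
    then show ?thesis by (simp add: h_def power2_eq_square algebra_simps)
  qed
  note m = increment_moments(1,2)[OF st, folded v_def]
  have hi: "integrable M (\<lambda>\<omega>. h (W t \<omega> - W s \<omega>))" unfolding h using m by simp
  have "expectation (\<lambda>\<omega>. h (W t \<omega> - W s \<omega>)) = ea\<^sup>2 * exp ((2 * \<sigma>)\<^sup>2 * v / 2) - 2 * (ea * exp (\<sigma>\<^sup>2 * v / 2)) + 1"
    unfolding h using m(1)[of \<sigma>] m(1)[of "2 * \<sigma>"] m(2)[of \<sigma>] m(2)[of "2 * \<sigma>"] by (simp add: prob_space)
  also have "ea * exp (\<sigma>\<^sup>2 * v / 2) = exp (r * v)" unfolding ea_def by (simp add: algebra_simps flip: exp_add)
  also have "ea\<^sup>2 * exp ((2 * \<sigma>)\<^sup>2 * v / 2) = exp ((2 * r + \<sigma>\<^sup>2) * v)"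
  proof -
    have "ea\<^sup>2 * exp ((2 * \<sigma>)\<^sup>2 * v / 2) = exp (2 * ((r - \<sigma>\<^sup>2 / 2) * v) + (2 * \<sigma>)\<^sup>2 * v / 2)"
      unfolding ea_def exp_double[symmetric] by (rule exp_add[symmetric])
    also have "2 * ((r - \<sigma>\<^sup>2 / 2) * v) + (2 * \<sigma>)\<^sup>2 * v / 2 = (2 * r + \<sigma>\<^sup>2) * v"
      by (simp add: algebra_simps power2_eq_square)
    finally show ?thesis .
  qed
  also have "exp ((2 * r + \<sigma>\<^sup>2) * v) - 2 * exp (r * v) + 1
    \<le> (\<bar>2 * r + \<sigma>\<^sup>2\<bar> * exp (\<bar>2 * r + \<sigma>\<^sup>2\<bar> * T) + 2 * (\<bar>r\<bar> * exp (\<bar>r\<bar> * T))) * v"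
  proof -
    have b: "\<bar>exp (c * v) - 1\<bar> \<le> \<bar>c\<bar> * exp (\<bar>c\<bar> * T) * v" for c
    proof -
      have "\<bar>exp (c * v) - 1\<bar> \<le> \<bar>c * v\<bar> * exp \<bar>c * v\<bar>" by (rule exp_minus_one_le)
      also have "\<dots> \<le> (\<bar>c\<bar> * v) * exp (\<bar>c\<bar> * T)"
        using v by (intro mult_mono) (auto simp: abs_mult intro!: mult_left_mono)
      finally show ?thesis by (simp add: mult_ac)
    qed
    show ?thesis using b[of "2 * r + \<sigma>\<^sup>2"] b[of r] by (simp add: algebra_simps abs_le_iff)
  qed
  finally have Eh: "expectation (\<lambda>\<omega>. h (W t \<omega> - W s \<omega>))
    \<le> (\<bar>2 * r + \<sigma>\<^sup>2\<bar> * exp (\<bar>2 * r + \<sigma>\<^sup>2\<bar> * T) + 2 * (\<bar>r\<bar> * exp (\<bar>r\<bar> * T))) * v" .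
  have hm: "h \<in> borel_measurable borel" unfolding h_def[abs_def] by measurable
  have S2: "(\<lambda>\<omega>. (S s \<omega>)\<^sup>2) \<in> borel_measurable (F s)" "integrable M (\<lambda>\<omega>. (S s \<omega>)\<^sup>2)"
    "expectation (\<lambda>\<omega>. (S s \<omega>)\<^sup>2) \<le> moment_bound 2"
    using st measurable_stock_F[of s s] by (auto intro!: stock_moment borel_measurable_power)
  note ind = expectation_indep_increment[OF st S2(1,2) hm hi]
  show "integrable M (\<lambda>\<omega>. (S t \<omega> - S s \<omega>)\<^sup>2)" unfolding eq by (rule ind(1))
  have "0 \<le> expectation (\<lambda>\<omega>. h (W t \<omega> - W s \<omega>))" by (simp add: h_def)
  then show "expectation (\<lambda>\<omega>. (S t \<omega> - S s \<omega>)\<^sup>2) \<le> KS * (t - s)"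
    unfolding eq ind(2) KS_def v_def[symmetric] mult.assoc using S2(3) Eh moment_bound_nonneg[of 2]
    by (intro mult_mono) (auto simp: mult.assoc)
qed

text \<open>Simple integrands must be bounded, so the stock is cut off at \<open>L\<close>. The loss
  occurs only where \<open>S s\<close> exceeds \<open>L\<close>, and there its square is at most
  \<open>S s ^ 4 / L\<^sup>2\<close>; freezing the time at \<open>s\<close> costs the increment
  bound.\<close>

lemma truncated_stock_L2:
  assumes st: "0 \<le> s" "s \<le> t" "t \<le> T" and L: "0 < L"
  shows "integrable M (\<lambda>\<omega>. (min (S s \<omega>) L - S t \<omega>)\<^sup>2)"
    "expectation (\<lambda>\<omega>. (min (S s \<omega>) L - S t \<omega>)\<^sup>2) \<le> 2 * (moment_bound 4 / L\<^sup>2) + 2 * (KS * (t - s))"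
proof -
  have [measurable]: "S s \<in> borel_measurable M" "S t \<in> borel_measurable M" using st by (auto intro!: measurable_stock)
  define g where "g \<omega> = min (S s \<omega>) L - S s \<omega>" for \<omega>
  have [measurable]: "g \<in> borel_measurable M" unfolding g_def[abs_def] by measurable
  have m4: "integrable M (\<lambda>\<omega>. S s \<omega> ^ 4)" "expectation (\<lambda>\<omega>. S s \<omega> ^ 4) \<le> moment_bound 4"
    using st by (auto intro!: stock_moment)
  have le: "(g \<omega>)\<^sup>2 \<le> S s \<omega> ^ 4 / L\<^sup>2" for \<omega>
  proof (cases "S s \<omega> \<le> L")
    case False
    have "(g \<omega>)\<^sup>2 \<le> (S s \<omega>)\<^sup>2" using False L by (intro power2_le_iff_abs_le[THEN iffD2]) (auto simp: g_def)
    also have "\<dots> * L\<^sup>2 \<le> (S s \<omega>)\<^sup>2 * (S s \<omega>)\<^sup>2" using False L by (intro mult_left_mono power_mono) auto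
    then have "(S s \<omega>)\<^sup>2 \<le> S s \<omega> ^ 4 / L\<^sup>2" using L by (simp add: field_simps eval_nat_numeral)
    finally show ?thesis .
  qed (simp add: g_def)
  have i4: "integrable M (\<lambda>\<omega>. S s \<omega> ^ 4 / L\<^sup>2)" using m4 by simp
  have g2: "integrable M (\<lambda>\<omega>. (g \<omega>)\<^sup>2)"
    by (rule Bochner_Integration.integrable_bound[OF i4]) (use le in auto)
  have "expectation (\<lambda>\<omega>. (g \<omega>)\<^sup>2) \<le> expectation (\<lambda>\<omega>. S s \<omega> ^ 4 / L\<^sup>2)" by (intro integral_mono g2 i4 le)
  also have "\<dots> \<le> moment_bound 4 / L\<^sup>2" using m4(2) by (simp add: divide_right_mono)
  finally have Eg: "expectation (\<lambda>\<omega>. (g \<omega>)\<^sup>2) \<le> moment_bound 4 / L\<^sup>2" .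
  note d = stock_increment_L2[OF st, unfolded power2_commute[of "S t _"]]
  have eq: "min (S s \<omega>) L - S t \<omega> = g \<omega> + (S s \<omega> - S t \<omega>)" for \<omega> by (simp add: g_def)
  show "integrable M (\<lambda>\<omega>. (min (S s \<omega>) L - S t \<omega>)\<^sup>2)" unfolding eq
    using g2 d by (intro integrable_add_L2) auto
  have "expectation (\<lambda>\<omega>. (min (S s \<omega>) L - S t \<omega>)\<^sup>2) \<le> 2 * expectation (\<lambda>\<omega>. (g \<omega>)\<^sup>2) + 2 * expectation (\<lambda>\<omega>. (S s \<omega> - S t \<omega>)\<^sup>2)"
    unfolding eq using g2 d by (intro integral_square_add_le) auto
  also have "\<dots> \<le> 2 * (moment_bound 4 / L\<^sup>2) + 2 * (KS * (t - s))" using Eg d(2) by (intro add_mono mult_left_mono) auto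
  finally show "expectation (\<lambda>\<omega>. (min (S s \<omega>) L - S t \<omega>)\<^sup>2) \<le> 2 * (moment_bound 4 / L\<^sup>2) + 2 * (KS * (t - s))" .
qed

lemma trap_functional_cong:
  assumes "\<And>k. k \<le> n \<Longrightarrow> y k = z k"
  shows "trap_functional n y = trap_functional n z"
  unfolding trap_functional_def using assms by (intro arg_cong2[where f="(/)"] refl sum.cong) auto

end

section \<open>The derivative as a functional of the path and its independence from the second
  Brownian motion\<close>

context payoff
begin

text \<open>A version of \<open>Y\<close> defined on the product space of all functions on
  \<open>{0..T}\<close>. The average appears as a limit of trapezoidal sums, which involve only
  countably many coordinates and are therefore measurable there.\<close>

definition "path_functional w = partial2 f (S0 * exp ((r - \<sigma>\<^sup>2 / 2) * T + \<sigma> * w T),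
   lim (\<lambda>n. trap_functional (Suc n) (\<lambda>k. w (real k * (T / real (Suc n))))))"

lemma path_component_measurable:
  "0 \<le> t \<Longrightarrow> t \<le> T \<Longrightarrow> (\<lambda>w. w t) \<in> borel_measurable (\<Pi>\<^sub>M t\<in>{0..T}. (borel :: real measure))"
  by (intro measurable_component_singleton) auto

lemma grid_point:
  assumes "k \<le> Suc n"
  shows "0 \<le> real k * (T / real (Suc n))" "real k * (T / real (Suc n)) \<le> T"
proof -
  have "real k * (T / real (Suc n)) \<le> real (Suc n) * (T / real (Suc n))"
    using T_pos assms by (intro mult_right_mono) auto
  then show "real k * (T / real (Suc n)) \<le> T" by simp
  show "0 \<le> real k * (T / real (Suc n))" using T_pos by simp
qed

lemma path_functional_measurable:
  "path_functional \<in> borel_measurable (\<Pi>\<^sub>M t\<in>{0..T}. borel)"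
proof -
  have t: "(\<lambda>w. trap_functional (Suc n) (\<lambda>k. w (real k * (T / real (Suc n))))) \<in> borel_measurable (\<Pi>\<^sub>M t\<in>{0..T}. (borel :: real measure))" for n
    unfolding trap_functional_def
    by (intro borel_measurable_divide borel_measurable_sum borel_measurable_times borel_measurable_add
          borel_measurable_diff borel_measurable_const measurable_compose[OF _ borel_measurable_exp] path_component_measurable)
      (rule grid_point, simp)+
  have l: "(\<lambda>w. lim (\<lambda>n. trap_functional (Suc n) (\<lambda>k. w (real k * (T / real (Suc n)))))) \<in> borel_measurable (\<Pi>\<^sub>M t\<in>{0..T}. (borel :: real measure))"
    by (rule borel_measurable_lim_metric) (rule t)
  have e: "(\<lambda>w. S0 * exp ((r - \<sigma>\<^sup>2 / 2) * T + \<sigma> * w T)) \<in> borel_measurable (\<Pi>\<^sub>M t\<in>{0..T}. (borel :: real measure))"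
    by (intro borel_measurable_times borel_measurable_add borel_measurable_const
        measurable_compose[OF _ borel_measurable_exp] path_component_measurable) (use T_pos in auto)
  show ?thesis unfolding path_functional_def[abs_def]
    by (rule measurable_compose[OF _ partial2_measurable]) (intro borel_measurable_Pair e l)
qed

lemma AE_Y_eq_path_functional: "AE \<omega> in M. Y \<omega> = path_functional (\<lambda>t\<in>{0..T}. W t \<omega>)"
  using AE_Trap_tendsto_Avg
proof eventually_elim
  case (elim \<omega>)
  have "trap_functional (Suc n) (\<lambda>k. (\<lambda>t\<in>{0..T}. W t \<omega>) (real k * (T / real (Suc n)))) = Trap (Suc n) \<omega>" for n
    unfolding Trap_eq_functional[OF zero_less_Suc]
    by (rule trap_functional_cong) (use grid_point[of _ n] in auto)
  moreover have "lim (\<lambda>n. Trap (Suc n) \<omega>) = Avg \<omega>" using LIMSEQ_Suc[OF elim] by (rule limI)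
  ultimately show ?case using T_pos by (simp add: path_functional_def Y_def stock_def)
qed

text \<open>\<open>Y\<close> depends on the whole path up to \<open>T\<close>, so it is not adapted,
  and independence of increments of \<open>B\<close> from the filtration does not apply to it.
  Independence of the two paths does: \<open>Y\<close> times a truncated stock value is a functional
  of \<open>W\<close>, and the increment of \<open>B\<close> is centred. Mesh and truncation level
  are tied to the same index \<open>l\<close>, giving a squared distance of order
  \<open>1 / Suc l\<close>.\<close>

lemma extension_expectation_zero:
  fixes N :: "'b measure" and G' :: "real \<Rightarrow> 'b measure"
  assumes ext: "basis_extension M F N G' \<pi>"
    and B: "brownian_motion N G' T B"
    and ind: "indep_processes N T (\<lambda>t \<omega>. W t (\<pi> \<omega>)) B"
    and ito: "has_ito_integral N G' T B (\<lambda>t \<omega>. S t (\<pi> \<omega>)) J"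
  shows "integrable N (\<lambda>\<omega>. Y (\<pi> \<omega>) * J \<omega>)" "(\<integral>\<omega>. Y (\<pi> \<omega>) * J \<omega> \<partial>N) = 0"
proof -
  interpret B: brownian N G' T B using B T_pos by unfold_locales auto
  have \<pi>: "\<pi> \<in> N \<rightarrow>\<^sub>M M" and dist: "distr N M \<pi> = M" and \<pi>F: "\<And>t. \<pi> \<in> G' t \<rightarrow>\<^sub>M F t"
    using ext by (auto simp: basis_extension_def)
  define V where "V \<omega> = Y (\<pi> \<omega>)" for \<omega>
  have Vm: "V \<in> borel_measurable N" unfolding V_def[abs_def] by (rule measurable_compose[OF \<pi> Y_measurable])
  have pull: "integrable N (\<lambda>\<omega>. g (\<pi> \<omega>))" if "integrable M g" for g :: "'a \<Rightarrow> real"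
    using that integrable_distr_eq[OF \<pi>, of g] dist by auto
  have pullnn: "(\<integral>\<^sup>+\<omega>. g (\<pi> \<omega>) \<partial>N) = (\<integral>\<^sup>+\<omega>. g \<omega> \<partial>M)" if "g \<in> borel_measurable M" for g
    using nn_integral_distr[OF \<pi>, of g] that dist by simp
  have V2: "integrable N (\<lambda>\<omega>. (V \<omega>)\<^sup>2)" unfolding V_def by (rule pull[OF Y_L2])
  \<comment> \<open>The simple integrands witnessing \<open>ito\<close> need not be functionals of \<open>W\<close>; these are.\<close>
  define \<tau> where "\<tau> l i = real i * (T / real (Suc l))" for l i :: nat
  define \<xi> where "\<xi> l i \<omega> = min (S (\<tau> l i) (\<pi> \<omega>)) (real (Suc l))" for l i \<omega>
  have \<tau>: "0 \<le> \<tau> l i" "\<tau> l i \<le> T" if "i \<le> Suc l" for l i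
    using grid_point[OF that] by (auto simp: \<tau>_def)
  have \<tau>mono: "\<tau> l i \<le> \<tau> l (Suc i)" for l i
    unfolding \<tau>_def using T_pos by (intro mult_right_mono) auto
  have \<tau>T: "\<tau> l (Suc l) = T" for l unfolding \<tau>_def by simp
  have xG: "\<xi> l i \<in> borel_measurable (G' (\<tau> l i))" if "i \<le> Suc l" for l i
    unfolding \<xi>_def[abs_def]
    by (intro borel_measurable_min borel_measurable_const measurable_compose[OF \<pi>F measurable_stock_F] \<tau> that order_refl)
  have xb: "\<bar>\<xi> l i \<omega>\<bar> \<le> real (Suc l)" for l i \<omega>
    unfolding \<xi>_def using stock_pos[of "\<tau> l i" "\<pi> \<omega>"] by auto
  have simple: "simple_integrand N G' T (Suc l) (\<tau> l) (\<xi> l)" for l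
    unfolding simple_integrand_def
  proof (intro conjI allI impI)
    show "\<exists>K. \<forall>\<omega>\<in>space N. \<bar>\<xi> l i \<omega>\<bar> \<le> K" for i using xb by blast
  qed (use \<tau>mono \<tau>T xG \<tau>[of 0 l] in auto)
  let ?R = "restrict_space lborel {0..T}"
  define K where "K = 2 * moment_bound 4 + 2 * (\<bar>KS\<bar> * T)"
  have K0: "0 \<le> K" using moment_bound_nonneg[of 4] T_pos by (simp add: K_def)
  have bound: "(\<integral>\<^sup>+ (t, \<omega>). ennreal ((simple_process (Suc l) (\<tau> l) (\<xi> l) t \<omega> - S t (\<pi> \<omega>))\<^sup>2) \<partial>(?R \<Otimes>\<^sub>M N))
    \<le> ennreal (K * T * inverse (real (Suc l)))" for l
  proof -
    have L: "0 < real (Suc l)" by simp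
    have meas: "(\<lambda>(t, \<omega>). ennreal ((simple_process (Suc l) (\<tau> l) (\<xi> l) t \<omega> - S t (\<pi> \<omega>))\<^sup>2)) \<in> borel_measurable (?R \<Otimes>\<^sub>M N)"
    proof -
      have "(\<lambda>(t, \<omega>). S t (\<pi> \<omega>)) \<in> borel_measurable (?R \<Otimes>\<^sub>M N)" using ito by (simp add: has_ito_integral_def)
      then show ?thesis using B.simple_process_measurable[OF simple, of l] by (simp add: split_beta')
    qed
    \<comment> \<open>For a fixed positive time the step process reduces to one truncated stock
      value; the estimate is then moved to the original basis, where the image law of
      \<open>\<pi>\<close> is \<open>M\<close>.\<close>
    have inner: "(\<integral>\<^sup>+\<omega>. ennreal ((simple_process (Suc l) (\<tau> l) (\<xi> l) t \<omega> - S t (\<pi> \<omega>))\<^sup>2) \<partial>N) \<le> ennreal (K * inverse (real (Suc l)))"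
      if t: "0 < t" "t \<le> T" for t
    proof -
      have d: "0 < T / real (Suc l)" using T_pos by simp
      have "t \<le> real (Suc l) * (T / real (Suc l))" using t by simp
      then obtain i where i: "i < Suc l" "\<And>j. t \<in> {real j * (T / real (Suc l))<..real (Suc j) * (T / real (Suc l))} \<longleftrightarrow> j = i"
        using grid_locate[OF d t(1)] by blast
      have ti: "\<tau> l i \<le> t" "t - \<tau> l i \<le> T / real (Suc l)"
        using i(2)[of i] unfolding \<tau>_def by (auto simp: algebra_simps add_divide_distrib)
      have ij: "(indicator {\<tau> l j<..\<tau> l (Suc j)} t :: real) = (if j = i then 1 else 0)" for j
        using i(2)[of j] unfolding \<tau>_def indicator_def by auto
      have sp: "simple_process (Suc l) (\<tau> l) (\<xi> l) t \<omega> = \<xi> l i \<omega>" for \<omega>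
        unfolding simple_process_def ij using i(1)
        by (simp add: if_distrib[of "(*) _"] sum.delta del: sum.lessThan_Suc cong: if_cong)
      have st: "0 \<le> \<tau> l i" "\<tau> l i \<le> t" "t \<le> T" using \<tau>[of i l] i(1) ti t by auto
      note tr = truncated_stock_L2[OF st L]
      have [measurable]: "S (\<tau> l i) \<in> borel_measurable M" "S t \<in> borel_measurable M"
        using st by (auto intro!: measurable_stock)
      have "(\<integral>\<^sup>+\<omega>. ennreal ((simple_process (Suc l) (\<tau> l) (\<xi> l) t \<omega> - S t (\<pi> \<omega>))\<^sup>2) \<partial>N)
        = (\<integral>\<^sup>+\<omega>. ennreal ((min (S (\<tau> l i) \<omega>) (real (Suc l)) - S t \<omega>)\<^sup>2) \<partial>M)"
        unfolding sp \<xi>_def by (rule pullnn[of "\<lambda>\<omega>. ennreal ((min (S (\<tau> l i) \<omega>) (real (Suc l)) - S t \<omega>)\<^sup>2)"]) measurable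
      also have "\<dots> = ennreal (expectation (\<lambda>\<omega>. (min (S (\<tau> l i) \<omega>) (real (Suc l)) - S t \<omega>)\<^sup>2))"
        using tr(1) by (intro nn_integral_eq_integral) auto
      also have "\<dots> \<le> ennreal (K * inverse (real (Suc l)))"
      proof (rule ennreal_leI)
        have "moment_bound 4 / (real (Suc l))\<^sup>2 \<le> moment_bound 4 / real (Suc l)"
          using moment_bound_nonneg[of 4] by (intro divide_left_mono) (auto simp: power2_eq_square)
        moreover have "KS * (t - \<tau> l i) \<le> \<bar>KS\<bar> * (T / real (Suc l))" using ti by (intro mult_mono) auto
        ultimately have "2 * (moment_bound 4 / (real (Suc l))\<^sup>2) + 2 * (KS * (t - \<tau> l i))
          \<le> 2 * (moment_bound 4 / real (Suc l)) + 2 * (\<bar>KS\<bar> * (T / real (Suc l)))" by linarith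
        also have "\<dots> = K * inverse (real (Suc l))" by (simp add: K_def divide_inverse algebra_simps del: of_nat_Suc)
        finally show "expectation (\<lambda>\<omega>. (min (S (\<tau> l i) \<omega>) (real (Suc l)) - S t \<omega>)\<^sup>2) \<le> K * inverse (real (Suc l))"
          using tr(2) by linarith
      qed
      finally show ?thesis .
    qed
    have "(\<integral>\<^sup>+ (t, \<omega>). ennreal ((simple_process (Suc l) (\<tau> l) (\<xi> l) t \<omega> - S t (\<pi> \<omega>))\<^sup>2) \<partial>(?R \<Otimes>\<^sub>M N))
      = (\<integral>\<^sup>+t. (\<integral>\<^sup>+\<omega>. ennreal ((simple_process (Suc l) (\<tau> l) (\<xi> l) t \<omega> - S t (\<pi> \<omega>))\<^sup>2) \<partial>N) \<partial>?R)"
      using B.nn_integral_fst[OF meas] by simp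
    also have "\<dots> = (\<integral>\<^sup>+t. (\<integral>\<^sup>+\<omega>. ennreal ((simple_process (Suc l) (\<tau> l) (\<xi> l) t \<omega> - S t (\<pi> \<omega>))\<^sup>2) \<partial>N) * indicator {0..T} t \<partial>lborel)"
      by (rule nn_integral_restrict_space) simp
    also have "\<dots> \<le> (\<integral>\<^sup>+t. ennreal (K * inverse (real (Suc l))) * indicator {0..T} t \<partial>lborel)"
    \<comment> \<open>Time 0 lies in no left-open grid interval and is discarded as a null
      set.\<close>
    proof (rule nn_integral_mono_AE)
      show "AE t in lborel. (\<integral>\<^sup>+\<omega>. ennreal ((simple_process (Suc l) (\<tau> l) (\<xi> l) t \<omega> - S t (\<pi> \<omega>))\<^sup>2) \<partial>N) * indicator {0..T} t
        \<le> ennreal (K * inverse (real (Suc l))) * indicator {0..T} t"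
        using AE_lborel_singleton[of "0::real"]
      proof eventually_elim
        case (elim t)
        then show ?case using inner[of t] by (cases "t \<in> {0..T}") auto
      qed
    qed
    also have "\<dots> = ennreal (K * inverse (real (Suc l))) * ennreal T"
      using T_pos by (simp add: nn_integral_cmult_indicator emeasure_lborel_Icc_eq)
    also have "\<dots> = ennreal (K * T * inverse (real (Suc l)))"
      using K0 T_pos by (subst ennreal_mult[symmetric]) (auto simp: mult_ac)
    finally show ?thesis .
  qed
  have lim: "(\<lambda>l. \<integral>\<^sup>+ (t, \<omega>). ennreal ((simple_process (Suc l) (\<tau> l) (\<xi> l) t \<omega> - S t (\<pi> \<omega>))\<^sup>2) \<partial>(?R \<Otimes>\<^sub>M N)) \<longlonglongrightarrow> 0"
  proof (rule tendsto_sandwich[where f="\<lambda>_. 0" and h="\<lambda>l. ennreal (K * T * inverse (real (Suc l)))"])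
    have "(\<lambda>l. ennreal (K * T * inverse (real (Suc l)))) \<longlonglongrightarrow> ennreal (K * T * 0)"
      by (intro tendsto_ennrealI tendsto_mult tendsto_const LIMSEQ_inverse_real_of_nat)
    then show "(\<lambda>l. ennreal (K * T * inverse (real (Suc l)))) \<longlonglongrightarrow> 0" by simp
  qed (use bound in auto)
  define P where "P \<omega> = (\<lambda>t\<in>{0..T}. W t (\<pi> \<omega>))" for \<omega>
  have indep: "B.indep_var (\<Pi>\<^sub>M t\<in>{0..T}. borel) P (\<Pi>\<^sub>M t\<in>{0..T}. borel) (\<lambda>\<omega>. \<lambda>t\<in>{0..T}. B t \<omega>)"
    using ind unfolding indep_processes_def P_def .
  have Pm: "P \<in> N \<rightarrow>\<^sub>M (\<Pi>\<^sub>M t\<in>{0..T}. borel)" using indep B.indep_var_rv1 by blast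
  have VP: "AE \<omega> in N. V \<omega> = path_functional (P \<omega>)"
  proof -
    have "AE \<omega> in distr N M \<pi>. Y \<omega> = path_functional (\<lambda>t\<in>{0..T}. W t \<omega>)"
      unfolding dist by (rule AE_Y_eq_path_functional)
    from AE_distrD[OF \<pi> this] show ?thesis unfolding V_def P_def .
  qed
  have zero: "B.expectation (\<lambda>\<omega>. V \<omega> * simple_integral B (Suc l) (\<tau> l) (\<xi> l) \<omega>) = 0" for l
  proof -
    have each: "integrable N (\<lambda>\<omega>. V \<omega> * (\<xi> l i \<omega> * (B (\<tau> l (Suc i)) \<omega> - B (\<tau> l i) \<omega>)))"
      "B.expectation (\<lambda>\<omega>. V \<omega> * (\<xi> l i \<omega> * (B (\<tau> l (Suc i)) \<omega> - B (\<tau> l i) \<omega>))) = 0" if i: "i < Suc l" for i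
    proof -
      have s: "0 \<le> \<tau> l i" "\<tau> l i \<le> \<tau> l (Suc i)" "\<tau> l (Suc i) \<le> T" using \<tau>[of i l] \<tau>[of "Suc i" l] \<tau>mono i by auto
      have s': "\<tau> l i \<le> T" "0 \<le> \<tau> l (Suc i)" using s by linarith+
      have xm: "\<xi> l i \<in> borel_measurable N" using xG[of i l] i B.measurable_F_imp by auto
      \<comment> \<open>The product of \<open>V\<close> and the coefficient as one functional of the
        path of \<open>W\<close>, so that independence of the two processes can be used in a single
        composition.\<close>
      define \<Phi> where "\<Phi> w = path_functional w * min (S0 * exp ((r - \<sigma>\<^sup>2 / 2) * \<tau> l i + \<sigma> * w (\<tau> l i))) (real (Suc l))" for w
      have \<Phi>m: "\<Phi> \<in> borel_measurable (\<Pi>\<^sub>M t\<in>{0..T}. borel)"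
        unfolding \<Phi>_def[abs_def]
        by (intro borel_measurable_times path_functional_measurable borel_measurable_min borel_measurable_add borel_measurable_const
          measurable_compose[OF _ borel_measurable_exp] path_component_measurable s s')
      have \<Psi>m: "(\<lambda>b. b (\<tau> l (Suc i)) - b (\<tau> l i)) \<in> borel_measurable (\<Pi>\<^sub>M t\<in>{0..T}. (borel :: real measure))"
        by (intro borel_measurable_diff path_component_measurable s s')
      have "B.indep_var borel (\<Phi> \<circ> P) borel ((\<lambda>b. b (\<tau> l (Suc i)) - b (\<tau> l i)) \<circ> (\<lambda>\<omega>. \<lambda>t\<in>{0..T}. B t \<omega>))"
        by (rule B.indep_var_compose[OF indep \<Phi>m \<Psi>m])
      moreover have "(\<lambda>b. b (\<tau> l (Suc i)) - b (\<tau> l i)) \<circ> (\<lambda>\<omega>. \<lambda>t\<in>{0..T}. B t \<omega>) = (\<lambda>\<omega>. B (\<tau> l (Suc i)) \<omega> - B (\<tau> l i) \<omega>)"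
        using s s' by (auto simp: fun_eq_iff)
      ultimately have iv: "B.indep_var borel (\<lambda>\<omega>. \<Phi> (P \<omega>)) borel (\<lambda>\<omega>. B (\<tau> l (Suc i)) \<omega> - B (\<tau> l i) \<omega>)"
        by (simp add: comp_def)
      have ae: "AE \<omega> in N. V \<omega> * \<xi> l i \<omega> = \<Phi> (P \<omega>)"
        using VP by eventually_elim (use s s' in \<open>simp add: \<Phi>_def \<xi>_def P_def stock_def\<close>)
      have x2: "integrable N (\<lambda>\<omega>. (\<xi> l i \<omega>)\<^sup>2)"
        using xm xb by (intro B.integrable_const_bound[where B="(real (Suc l))\<^sup>2"]) (auto intro!: AE_I2 abs_le_square_iff[THEN iffD1] simp del: of_nat_Suc)
      have \<Phi>Pm: "(\<lambda>\<omega>. \<Phi> (P \<omega>)) \<in> borel_measurable N" by (rule measurable_compose[OF Pm \<Phi>m])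
      have \<Phi>i: "integrable N (\<lambda>\<omega>. \<Phi> (P \<omega>))"
        using integrable_mult_L2[OF Vm xm V2 x2] ae \<Phi>Pm Vm xm
        by (subst integrable_cong_AE[where g="\<lambda>\<omega>. V \<omega> * \<xi> l i \<omega>"]) (auto elim: eventually_mono)
      note Bi = B.increment_moments(3,4)[OF s]
      have Bm: "(\<lambda>\<omega>. B (\<tau> l (Suc i)) \<omega> - B (\<tau> l i) \<omega>) \<in> borel_measurable N" using Bi(1) by auto
      have ae2: "AE \<omega> in N. \<Phi> (P \<omega>) * (B (\<tau> l (Suc i)) \<omega> - B (\<tau> l i) \<omega>) = V \<omega> * (\<xi> l i \<omega> * (B (\<tau> l (Suc i)) \<omega> - B (\<tau> l i) \<omega>))"
        using ae by eventually_elim (simp add: mult.assoc[symmetric])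
      have m1: "(\<lambda>\<omega>. \<Phi> (P \<omega>) * (B (\<tau> l (Suc i)) \<omega> - B (\<tau> l i) \<omega>)) \<in> borel_measurable N"
        using \<Phi>Pm Bm by (rule borel_measurable_times)
      have m2: "(\<lambda>\<omega>. V \<omega> * (\<xi> l i \<omega> * (B (\<tau> l (Suc i)) \<omega> - B (\<tau> l i) \<omega>))) \<in> borel_measurable N"
        using Vm xm Bm by (intro borel_measurable_times)
      show "integrable N (\<lambda>\<omega>. V \<omega> * (\<xi> l i \<omega> * (B (\<tau> l (Suc i)) \<omega> - B (\<tau> l i) \<omega>)))"
        using B.indep_var_integrable[OF iv \<Phi>i Bi(1)] by (rule Bochner_Integration.integrable_cong_AE_imp[OF _ m2 ae2])
      show "B.expectation (\<lambda>\<omega>. V \<omega> * (\<xi> l i \<omega> * (B (\<tau> l (Suc i)) \<omega> - B (\<tau> l i) \<omega>))) = 0"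
        using integral_cong_AE[OF m1 m2 ae2] B.indep_var_lebesgue_integral[OF iv \<Phi>i Bi(1)] Bi(2) by simp
    qed
    have "B.expectation (\<lambda>\<omega>. V \<omega> * simple_integral B (Suc l) (\<tau> l) (\<xi> l) \<omega>)
      = (\<Sum>i<Suc l. B.expectation (\<lambda>\<omega>. V \<omega> * (\<xi> l i \<omega> * (B (\<tau> l (Suc i)) \<omega> - B (\<tau> l i) \<omega>))))"
      unfolding simple_integral_def sum_distrib_left by (rule Bochner_Integration.integral_sum) (use each in auto)
    also have "\<dots> = 0" by (rule sum.neutral) (use each in auto)
    finally show ?thesis .
  qed
  note J = B.ito_integral_orthogonal[OF ito Vm V2 simple lim zero]
  show "integrable N (\<lambda>\<omega>. Y (\<pi> \<omega>) * J \<omega>)"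
    using integrable_mult_L2[OF Vm J(1) V2 J(2)] unfolding V_def .
  show "(\<integral>\<omega>. Y (\<pi> \<omega>) * J \<omega> \<partial>N) = 0" using J(3) unfolding V_def .
qed

end

text \<open>The limit is stated together with integrability of both integrands: a Bochner integral
  without integrability is 0 by convention, and the common limit is 0 here, so the convergence alone
  would not guarantee that the expectations exist.\<close>

theorem mainTheorem6:
  fixes M :: "'a measure" and F :: "real \<Rightarrow> 'a measure"
    and N :: "'b measure" and G :: "real \<Rightarrow> 'b measure" and \<pi> :: "'b \<Rightarrow> 'a"
    and T S0 r \<sigma> :: real
    and W :: "real \<Rightarrow> 'a \<Rightarrow> real" and B' :: "real \<Rightarrow> 'b \<Rightarrow> real"
    and J chi_T :: "'b \<Rightarrow> real"
    and f :: "real \<times> real \<Rightarrow> real" and C p :: real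
  defines "S_T \<equiv> stock S0 r \<sigma> W T"
    and "I_T \<equiv> average S0 r \<sigma> T W"
    and "I \<equiv> trapezoidal S0 r \<sigma> T W"
  assumes "T > 0" "S0 > 0" "\<sigma> > 0"
    and "brownian_motion M F T W"
    and "basis_extension M F N G \<pi>"
    and "brownian_motion N G T B'"
    and "indep_processes N T (\<lambda>t \<omega>. W t (\<pi> \<omega>)) B'"
    and "has_ito_integral N G T B' (\<lambda>t \<omega>. stock S0 r \<sigma> W t (\<pi> \<omega>)) J"
    and "\<And>\<omega>. chi_T \<omega> = \<sigma> / (2 * sqrt 3) * J \<omega>"
    and "f \<in> borel_measurable borel"
    and "C > 0" "p > 0"
    and "\<And>x y1 y2. \<bar>f (x, y1) - f (x, y2)\<bar>
           \<le> C * (1 + \<bar>x\<bar> powr p + \<bar>y1\<bar> powr p + \<bar>y2\<bar> powr p) * \<bar>y1 - y2\<bar>"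
    and "AE \<omega> in M. (S_T \<omega>, I_T \<omega>) \<in> partial2_domain f"
  shows "(\<forall>n>0. integrable M (\<lambda>\<omega>. f (S_T \<omega>, I n \<omega>) - f (S_T \<omega>, I_T \<omega>))) \<and>
    integrable N (\<lambda>\<omega>. partial2 f (S_T (\<pi> \<omega>), I_T (\<pi> \<omega>)) * chi_T \<omega>) \<and>
    (\<lambda>n. real n * (\<integral>\<omega>. f (S_T \<omega>, I n \<omega>) - f (S_T \<omega>, I_T \<omega>) \<partial>M))
      \<longlonglongrightarrow> (\<integral>\<omega>. partial2 f (S_T (\<pi> \<omega>), I_T (\<pi> \<omega>)) * chi_T \<omega> \<partial>N)"
proof -
  interpret payoff M F T W S0 r \<sigma> f C p
    by unfold_locales (use assms(4-7,13-17) in \<open>simp_all add: S_T_def I_T_def\<close>)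
  note ext = extension_expectation_zero[OF assms(8-11)]
  have eq: "partial2 f (S_T (\<pi> \<omega>), I_T (\<pi> \<omega>)) * chi_T \<omega> = \<sigma> / (2 * sqrt 3) * (Y (\<pi> \<omega>) * J \<omega>)" for \<omega>
    by (simp add: assms(12) Y_def S_T_def I_T_def)
  have "integrable N (\<lambda>\<omega>. partial2 f (S_T (\<pi> \<omega>), I_T (\<pi> \<omega>)) * chi_T \<omega>)"
    unfolding eq by (rule integrable_mult_right) (rule ext(1))
  moreover have "(\<integral>\<omega>. partial2 f (S_T (\<pi> \<omega>), I_T (\<pi> \<omega>)) * chi_T \<omega> \<partial>N) = 0"
    unfolding eq Bochner_Integration.integral_mult_right_zero ext(2) by simp
  ultimately show ?thesis
    using f_diff_integrable discretization_error_tendsto unfolding S_T_def I_T_def I_def by simp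
qed

end
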